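(* Let $X$ be a compact Riemann surface of genus $g\ge2$ with $\Pi=\pi_1(X)$. For any affine embedding $\mathcal X(\Pi)\hookrightarrow\mathbb C^n$ and any norm $\|\cdot\|$ on $\mathbb C^n$ there are constants $A>0$ and $B$ such that, for all $\phi\in Q(X)$, $$A^{-1}\|\phi\|^{1/2}-B<\log(1+\|\mathrm{hol}(\phi)\|)<A\|\phi\|^{1/2}+B.$$
   Context: $Q(X)$ is the vector space of holomorphic quadratic differentials on $X$, with norm $\|\phi\|=\int_X|\phi|$. An affine embedding is an embedding of the affine algebraic variety $\mathcal X(\Pi)$ as a closed algebraic subvariety of $\mathbb C^n$. Holonomy map: identify the universal cover $\tilde X$ of $X$ with the upper half-plane $\mathbb H$. For $\phi\in Q(X)$ with lift $\tilde\phi$ to $\tilde X$ there is a locally injective holomorphic map $f_\phi:\tilde X\to\mathbb{CP}^1$, unique up to post-composition with a Möbius transformation, whose Schwarzian derivative $\left((f''/f')'-\tfrac12(f''/f')^2\right)dz^2$ equals $\tilde\phi$. It satisfies $f_\phi(\gamma x)=\rho_\phi(\gamma)f_\phi(x)$ for a homomorphism $\rho_\phi:\Pi\to \mathrm{PSL}_2(\mathbb C)$, unique up to conjugation. After fixing a spin structure on $X$, these are lifted consistently and continuously in $\phi$ to $\rho_\phi:\Pi\to\mathrm{SL}_2(\mathbb C)$. $\mathcal X(\Pi)$ is the $\mathrm{SL}_2(\mathbb C)$-character variety of $\Pi$, i.e. the affine algebraic variety of characters $[\rho]$ of representations, equivalently the algebraic quotient $\mathrm{Hom}(\Pi,\mathrm{SL}_2(\mathbb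 C))/\!/\mathrm{SL}_2(\mathbb C)$ by conjugation. The holonomy map $\mathrm{hol}:Q(X)\to\mathcal X(\Pi)$ is $\mathrm{hol}(\phi)=[\rho_\phi]$. *)

theory Defs
  imports
    "HOL-Complex_Analysis.Complex_Analysis"
    "HOL-Homology.Homology"
    "HOL-Algebra.Bij"
    "HOL-Algebra.Free_Abelian_Groups"
begin

section \<open>Riemann surfaces\<close>

text \<open>A chart is a pair \<open>(U, f)\<close> of its domain and its coordinate. Values of \<open>f\<close> outside \<open>U\<close>
  are irrelevant. The Hausdorff axiom is carried by the type class of the ambient type.\<close>

type_synonym 'a chart = "'a set \<times> ('a \<Rightarrow> complex)"

definition riemann_surface :: "'a::t2_space set \<Rightarrow> 'a chart set \<Rightarrow> bool" where
  "riemann_surface X \<A> \<longleftrightarrow>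
     connected X \<and> X = (\<Union>(U, f)\<in>\<A>. U) \<and>
     (\<forall>(U, f)\<in>\<A>. openin (top_of_set X) U \<and> open (f ` U) \<and>
                 (\<exists>f'. homeomorphism U (f ` U) f f')) \<and>
     (\<forall>(U, f)\<in>\<A>. \<forall>(V, g)\<in>\<A>. (g \<circ> inv_into U f) holomorphic_on (f ` (U \<inter> V)))"

text \<open>For compact connected orientable surfaces the genus is half the rank of the first integral
  homology group.\<close>

definition has_genus :: "'a::topological_space set \<Rightarrow> nat \<Rightarrow> bool" where
  "has_genus X g \<longleftrightarrow> homology_group 1 (top_of_set X) \<cong> free_Abelian_group {..<2 * g}"


section \<open>Holomorphic quadratic differentials\<close>

text \<open>A quadratic differential is given by its coefficient functions: in the chart \<open>c = (U, f)\<close> it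
  is \<open>\<phi> c w dw\<^sup>2\<close> on \<open>f ` U\<close>. Coefficients are normalised to vanish off the charts, so that distinct
  elements of \<open>quad_diffs\<close> are distinct differentials and the pointwise operations make it a
  complex vector space.\<close>

definition quad_diffs :: "'a::t2_space chart set \<Rightarrow> ('a chart \<Rightarrow> complex \<Rightarrow> complex) set" where
  "quad_diffs \<A> = {\<phi>.
     (\<forall>(U, f)\<in>\<A>. \<phi> (U, f) holomorphic_on (f ` U)) \<and>
     (\<forall>(U, f)\<in>\<A>. \<forall>(V, g)\<in>\<A>. \<forall>x\<in>U \<inter> V.
        \<phi> (U, f) (f x) = \<phi> (V, g) (g x) * (deriv (g \<circ> inv_into U f) (f x))\<^sup>2) \<and>
     (\<forall>U f w. \<not> ((U, f) \<in> \<A> \<and> w \<in> f ` U) \<longrightarrow> \<phi> (U, f) w = 0)}"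

text \<open>The norm is the integral over \<open>X\<close> of the area density \<open>|\<phi>|\<close>. To integrate, \<open>X\<close> is cut into
  finitely many Borel pieces, each lying in one chart: \<open>\<kappa> x\<close> is the chart used at the point \<open>x\<close>.
  Such a \<open>\<kappa>\<close> exists since \<open>X\<close> is compact, and by the change of variables formula the value does
  not depend on it.\<close>

definition chart_selection :: "'a::t2_space set \<Rightarrow> 'a chart set \<Rightarrow> ('a \<Rightarrow> 'a chart) \<Rightarrow> bool" where
  "chart_selection X \<A> \<kappa> \<longleftrightarrow>
     finite (\<kappa> ` X) \<and> (\<forall>x\<in>X. \<kappa> x \<in> \<A> \<and> x \<in> fst (\<kappa> x)) \<and>
     (\<forall>c\<in>\<A>. snd c ` {x \<in> X. \<kappa> x = c} \<in> sets borel)"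

definition qd_norm ::
    "'a::t2_space set \<Rightarrow> 'a chart set \<Rightarrow> ('a chart \<Rightarrow> complex \<Rightarrow> complex) \<Rightarrow> real" where
  "qd_norm X \<A> \<phi> =
     (let \<kappa> = (SOME \<kappa>. chart_selection X \<A> \<kappa>)
      in \<Sum>c\<in>\<kappa> ` X. LINT w : snd c ` {x \<in> X. \<kappa> x = c} | lborel. cmod (\<phi> c w))"


section \<open>The universal cover and the fundamental group\<close>

definition upper_half_plane :: "complex set" where
  "upper_half_plane = {z. Im z > 0}"

text \<open>The identification of the universal cover of \<open>X\<close> with the upper half-plane amounts to a
  holomorphic covering map from the (simply connected) upper half-plane to \<open>X\<close>.\<close>

definition holomorphic_universal_cover ::
    "(complex \<Rightarrow> 'a::t2_space) \<Rightarrow> 'a set \<Rightarrow> 'a chart set \<Rightarrow> bool" where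
  "holomorphic_universal_cover p X \<A> \<longleftrightarrow>
     covering_space upper_half_plane p X \<and>
     (\<forall>(U, f)\<in>\<A>. (f \<circ> p) holomorphic_on (upper_half_plane \<inter> p -` U))"

text \<open>The fundamental group of \<open>X\<close>, in the form in which it acts on the universal cover: the group
  of deck transformations.\<close>

definition deck_group :: "(complex \<Rightarrow> 'a) \<Rightarrow> (complex \<Rightarrow> complex) monoid" where
  "deck_group p = (BijGroup upper_half_plane)
     \<lparr>carrier := {\<gamma> \<in> Bij upper_half_plane.
        (\<exists>\<gamma>'. homeomorphism upper_half_plane upper_half_plane \<gamma> \<gamma>') \<and>
        (\<forall>z\<in>upper_half_plane. p (\<gamma> z) = p z)}\<rparr>"

text \<open>The coefficient of the pull-back of \<open>\<phi>\<close> to the upper half-plane; by the transformation law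
  it does not depend on the chart around \<open>p z\<close>.\<close>

definition qd_lift ::
    "'a::t2_space chart set \<Rightarrow> (complex \<Rightarrow> 'a) \<Rightarrow> ('a chart \<Rightarrow> complex \<Rightarrow> complex) \<Rightarrow> complex \<Rightarrow> complex"
  where
  "qd_lift \<A> p \<phi> z =
     (let c = (SOME c. c \<in> \<A> \<and> p z \<in> fst c)
      in \<phi> c (snd c (p z)) * (deriv (snd c \<circ> p) z)\<^sup>2)"


section \<open>Maps to the projective line and the Schwarzian derivative\<close>

datatype cp1 = Fin complex | Infty

text \<open>The two standard affine coordinates \<open>w\<close> and \<open>1 / w\<close> of the projective line, meaningful off
  \<open>Infty\<close> and off \<open>Fin 0\<close> respectively.\<close>

fun coord0 :: "cp1 \<Rightarrow> complex" where
  "coord0 (Fin w) = w"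
| "coord0 Infty = 0"

fun coord1 :: "cp1 \<Rightarrow> complex" where
  "coord1 (Fin w) = inverse w"
| "coord1 Infty = 0"

text \<open>The action of an invertible matrix by the Moebius transformation \<open>w \<mapsto> (a w + b) / (c w + d)\<close>.\<close>

fun moebius :: "complex^2^2 \<Rightarrow> cp1 \<Rightarrow> cp1" where
  "moebius M (Fin w) =
     (if M $ 2 $ 1 * w + M $ 2 $ 2 = 0 then Infty
      else Fin ((M $ 1 $ 1 * w + M $ 1 $ 2) / (M $ 2 $ 1 * w + M $ 2 $ 2)))"
| "moebius M Infty = (if M $ 2 $ 1 = 0 then Infty else Fin (M $ 1 $ 1 / M $ 2 $ 1))"

definition cp1_holomorphic_on :: "(complex \<Rightarrow> cp1) \<Rightarrow> complex set \<Rightarrow> bool" where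
  "cp1_holomorphic_on F S \<longleftrightarrow>
     (\<forall>z\<in>S. \<exists>U. open U \<and> z \<in> U \<and>
        (Infty \<notin> F ` U \<and> (coord0 \<circ> F) holomorphic_on U \<or>
         Fin 0 \<notin> F ` U \<and> (coord1 \<circ> F) holomorphic_on U))"

definition locally_injective_on :: "(complex \<Rightarrow> cp1) \<Rightarrow> complex set \<Rightarrow> bool" where
  "locally_injective_on F S \<longleftrightarrow> (\<forall>z\<in>S. \<exists>U. open U \<and> z \<in> U \<and> inj_on F U)"

definition schwarzian :: "(complex \<Rightarrow> complex) \<Rightarrow> complex \<Rightarrow> complex" where
  "schwarzian f z =
     deriv (\<lambda>w. deriv (deriv f) w / deriv f w) z - (1 / 2) * (deriv (deriv f) z / deriv f z)\<^sup>2"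

text \<open>The Schwarzian derivative is invariant under post-composition with Moebius transformations,
  so that at poles it may be computed in the coordinate \<open>1 / w\<close>.\<close>

definition cp1_schwarzian :: "(complex \<Rightarrow> cp1) \<Rightarrow> complex \<Rightarrow> complex" where
  "cp1_schwarzian F z =
     (if F z = Infty then schwarzian (coord1 \<circ> F) z else schwarzian (coord0 \<circ> F) z)"

definition developing_map ::
    "'a::t2_space chart set \<Rightarrow> (complex \<Rightarrow> 'a) \<Rightarrow> ('a chart \<Rightarrow> complex \<Rightarrow> complex)
       \<Rightarrow> (complex \<Rightarrow> cp1) \<Rightarrow> bool" where
  "developing_map \<A> p \<phi> F \<longleftrightarrow>
     cp1_holomorphic_on F upper_half_plane \<and> locally_injective_on F upper_half_plane \<and>
     (\<forall>z\<in>upper_half_plane. cp1_schwarzian F z = qd_lift \<A> p \<phi> z)"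


section \<open>Character varieties\<close>

definition SL2C :: "(complex^2^2) monoid" where
  "SL2C = \<lparr>carrier = {M. det M = 1}, mult = (**), one = mat 1\<rparr>"

definition char_of :: "'g monoid \<Rightarrow> ('g \<Rightarrow> complex^2^2) \<Rightarrow> 'g \<Rightarrow> complex" where
  "char_of G \<rho> = (\<lambda>\<gamma>\<in>carrier G. trace (\<rho> \<gamma>))"

definition character_variety :: "'g monoid \<Rightarrow> ('g \<Rightarrow> complex) set" where
  "character_variety G = char_of G ` hom G SL2C"

text \<open>Functions that are polynomial expressions, with complex coefficients, in the functions
  from \<open>S\<close>.\<close>

inductive_set generated_algebra :: "('b \<Rightarrow> complex) set \<Rightarrow> ('b \<Rightarrow> complex) set"
  for S where
  const: "(\<lambda>_. a) \<in> generated_algebra S"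
| gen: "f \<in> S \<Longrightarrow> f \<in> generated_algebra S"
| add: "f \<in> generated_algebra S \<Longrightarrow> h \<in> generated_algebra S \<Longrightarrow> (\<lambda>x. f x + h x) \<in> generated_algebra S"
| mult: "f \<in> generated_algebra S \<Longrightarrow> h \<in> generated_algebra S \<Longrightarrow> (\<lambda>x. f x * h x) \<in> generated_algebra S"

definition polynomial_functions :: "(complex^'n \<Rightarrow> complex) set" where
  "polynomial_functions = generated_algebra {(\<lambda>v. v $ i) | i. True}"

text \<open>The regular functions on the variety of characters are the polynomials in the trace
  functions \<open>[\<rho>] \<mapsto> tr (\<rho> \<gamma>)\<close>; these are all the conjugation invariant regular functions
  on the representation variety. Only the values on \<open>character_variety G\<close> matter.\<close>

definition regular_functions :: "'g monoid \<Rightarrow> (('g \<Rightarrow> complex) \<Rightarrow> complex) set" where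
  "regular_functions G = generated_algebra {(\<lambda>x. x \<gamma>) | \<gamma>. \<gamma> \<in> carrier G}"

definition zariski_closed :: "(complex^'n) set \<Rightarrow> bool" where
  "zariski_closed Z \<longleftrightarrow> (\<exists>P \<subseteq> polynomial_functions. Z = {v. \<forall>f\<in>P. f v = 0})"

text \<open>An isomorphism of affine varieties from the character variety onto a closed subvariety of
  affine space: the components are regular, the image is closed, and the inverse is a morphism,
  i.e. every regular function on the source is the pull-back of a polynomial.\<close>

definition affine_embedding :: "'g monoid \<Rightarrow> (('g \<Rightarrow> complex) \<Rightarrow> complex^'n) \<Rightarrow> bool" where
  "affine_embedding G E \<longleftrightarrow>
     (\<forall>i. \<exists>f\<in>regular_functions G. \<forall>x\<in>character_variety G. E x $ i = f x) \<and>
     inj_on E (character_variety G) \<and>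
     zariski_closed (E ` character_variety G) \<and>
     (\<forall>f\<in>regular_functions G. \<exists>h\<in>polynomial_functions.
        \<forall>x\<in>character_variety G. f x = h (E x))"

definition is_norm :: "(complex^'n \<Rightarrow> real) \<Rightarrow> bool" where
  "is_norm N \<longleftrightarrow>
     (\<forall>v. N v \<ge> 0) \<and> (\<forall>v. N v = 0 \<longleftrightarrow> v = 0) \<and>
     (\<forall>a v. N (a *s v) = cmod a * N v) \<and> (\<forall>v w. N (v + w) \<le> N v + N w)"


section \<open>The holonomy map\<close>

text \<open>Spin structures on \<open>X\<close> correspond to the lifts to \<open>SL\<^sub>2\<close> of the uniformising (Fuchsian)
  representation, which is the holonomy of \<open>\<phi> = 0\<close>.\<close>

definition spin_structure :: "(complex \<Rightarrow> 'a) \<Rightarrow> ((complex \<Rightarrow> complex) \<Rightarrow> complex^2^2) \<Rightarrow> bool" where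
  "spin_structure p \<sigma> \<longleftrightarrow>
     \<sigma> \<in> hom (deck_group p) SL2C \<and>
     (\<forall>\<gamma>\<in>carrier (deck_group p). \<forall>z\<in>upper_half_plane. Fin (\<gamma> z) = moebius (\<sigma> \<gamma>) (Fin z))"

text \<open>The representations \<open>\<rho> \<phi>\<close> are only determined up to conjugation. The sign ambiguity of the
  lifts from \<open>PSL\<^sub>2\<close> to \<open>SL\<^sub>2\<close> is resolved by continuity in \<open>\<phi>\<close> and the choice of the spin
  structure \<open>\<sigma>\<close>, which prescribes the lift at \<open>\<phi> = 0\<close>.\<close>

definition holonomy_map ::
    "'a::t2_space set \<Rightarrow> 'a chart set \<Rightarrow> (complex \<Rightarrow> 'a) \<Rightarrow> ((complex \<Rightarrow> complex) \<Rightarrow> complex^2^2)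
       \<Rightarrow> (('a chart \<Rightarrow> complex \<Rightarrow> complex) \<Rightarrow> (complex \<Rightarrow> complex) \<Rightarrow> complex) \<Rightarrow> bool" where
  "holonomy_map X \<A> p \<sigma> hol \<longleftrightarrow>
     (\<exists>\<rho>. (\<forall>\<phi>\<in>quad_diffs \<A>.
             \<rho> \<phi> \<in> hom (deck_group p) SL2C \<and>
             (\<exists>F. developing_map \<A> p \<phi> F \<and>
                  (\<forall>\<gamma>\<in>carrier (deck_group p). \<forall>z\<in>upper_half_plane.
                     F (\<gamma> z) = moebius (\<rho> \<phi> \<gamma>) (F z)))) \<and>
          (\<forall>\<gamma>\<in>carrier (deck_group p). \<forall>\<phi>\<in>quad_diffs \<A>. \<forall>\<epsilon>>0. \<exists>\<delta>>0. \<forall>\<psi>\<in>quad_diffs \<A>.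
             qd_norm X \<A> (\<lambda>c w. \<psi> c w - \<phi> c w) < \<delta> \<longrightarrow> norm (\<rho> \<psi> \<gamma> - \<rho> \<phi> \<gamma>) < \<epsilon>) \<and>
          (\<exists>M\<in>carrier SL2C. \<forall>\<gamma>\<in>carrier (deck_group p).
             \<rho> (\<lambda>_ _. 0) \<gamma> ** M = M ** \<sigma> \<gamma>) \<and>
          (\<forall>\<phi>\<in>quad_diffs \<A>. hol \<phi> = char_of (deck_group p) (\<rho> \<phi>)))"

end

theory Submission
  imports Defs
begin

text \<open>A differential \<open>\<phi>\<close> lifts to a holomorphic function on the upper half-plane, also called \<open>\<phi>\<close> here.
  A map with Schwarzian derivative \<open>\<phi>\<close> is the ratio of two solutions of \<open>u'' = - (\<phi> / 2) u\<close>, and a deck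
  transformation \<open>M\<close> acts on the solutions by the slash action \<open>u \<mapsto> (c z + d) u (M z)\<close>. The holonomy
  is therefore, up to sign, the monodromy of this equation, and the absolute values of its traces are
  those of the monodromy (\<open>holonomy_trace\<close>). What has to be compared are the traces and the
  square root of the norm. The other data are harmless: the coordinates of an affine
  embedding and the trace functions are polynomials in each other (\<open>generated_algebra_growth\<close>),
  every norm is comparable with the coordinates, and the area norm of \<open>\<phi>\<close> is comparable with its
  supremum \<open>t\<^sup>2\<close> over a compact set that meets all orbits (\<open>qd_norm_le_dsup\<close>, \<open>dsup_le_qd_norm\<close>).

  For the upper bound, a Gronwall estimate for the energy \<open>(1 + t)\<^sup>2 \<bar>u\<bar>\<^sup>2 + \<bar>u'\<bar>\<^sup>2\<close> along the segment from
  \<open>\<i>\<close> to its image under \<open>M\<close> bounds the monodromy by the exponential of a multiple of \<open>1 + t\<close>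
  (\<open>solution_growth\<close>).

  The lower bound is proved by contradiction. In a sequence \<open>\<phi> n\<close> that violates it \<open>t n\<close> is unbounded,
  and after passing to a subsequence \<open>\<phi> n / t n\<^sup>2\<close> converges to a nonzero automorphic function \<open>q\<close>
  (\<open>normal_family\<close>). The equation then has the large parameter \<open>t n\<close>, and the WKB method applies:
  along a path \<open>z\<close> with a root \<open>W\<close> of \<open>- q / 2\<close> such that \<open>Re (W z') > 0\<close>, the solutions with
  \<open>\<bar>u' - t W u\<bar> \<le> \<bar>u' + t W u\<bar>\<close> stay in a narrower cone and grow like \<open>exp (c t)\<close> (\<open>path_expands\<close>).
  Near every point, also near a zero of \<open>q\<close>, such paths lead from any starting point with a nonzero root into
  a finite set of targets (\<open>local_reach\<close>). Since the quotient is compact, finitely many targets suffice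
  globally: from each target such a path leads, after a deck transformation, to another one. Hence
  some chain of paths closes up in the quotient (\<open>wkb_loop\<close>); a deck transformation changes the cones
  only by terms of order \<open>1 / t\<close>. The monodromy of this loop maps a cone into itself and expands it, so
  it has an eigenvalue of size at least \<open>exp (c t)\<close> (\<open>slash_eigenvector\<close>). So the trace of one fixed group
  element grows exponentially in \<open>t n\<close>, and with it the point in the affine embedding, contrary to
  the choice of the sequence.\<close>

section \<open>Growth of polynomial expressions, and norms\<close>

text \<open>Functions of at most exponential growth in \<open>k\<close> form an algebra. The constants are made positive
  so that each of two summands is bounded with the sum of the exponents.\<close>

lemma generated_algebra_growth:
  fixes x :: "'i \<Rightarrow> 'b" and k :: "'i \<Rightarrow> real"
  assumes f: "f \<in> generated_algebra S"
    and k: "\<And>i. i \<in> I \<Longrightarrow> k i \<ge> 0"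
    and S: "\<And>s. s \<in> S \<Longrightarrow> \<exists>A B. \<forall>i\<in>I. cmod (s (x i)) \<le> exp (A * k i + B)"
  shows "\<exists>A B. A > 0 \<and> B > 0 \<and> (\<forall>i\<in>I. cmod (f (x i)) \<le> exp (A * k i + B))"
  using f
proof induction
  case (const a)
  have "cmod a \<le> exp (1 * k i + cmod a + 1)" if "i \<in> I" for i
    using exp_ge_add_one_self[of "1 * k i + cmod a + 1"] k[OF that] by linarith
  then show ?case
    by (intro exI[of _ 1] exI[of _ "cmod a + 1"]) (auto simp: algebra_simps add_pos_nonneg)
next
  case (gen s)
  from S[OF this] obtain A B where AB: "\<And>i. i \<in> I \<Longrightarrow> cmod (s (x i)) \<le> exp (A * k i + B)" by blast
  have "cmod (s (x i)) \<le> exp ((\<bar>A\<bar>+1) * k i + (\<bar>B\<bar> + 1))" if "i \<in> I" for i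
  proof -
    have "A * k i \<le> (\<bar>A\<bar>+1) * k i" by (intro mult_right_mono k that) auto
    then show ?thesis using AB[OF that] by (smt (verit) exp_le_cancel_iff)
  qed
  then show ?case by (intro exI[of _ "\<bar>A\<bar>+1"] exI[of _ "\<bar>B\<bar>+1"]) auto
next
  case (add f h)
  then obtain A B A' B' where AB: "A > 0" "B > 0" "A' > 0" "B' > 0"
      "\<And>i. i \<in> I \<Longrightarrow> cmod (f (x i)) \<le> exp (A * k i + B)"
      "\<And>i. i \<in> I \<Longrightarrow> cmod (h (x i)) \<le> exp (A' * k i + B')" by blast
  have "cmod (f (x i) + h (x i)) \<le> exp ((A+A') * k i + (B+B'+1))" if "i \<in> I" for i
  proof -
    let ?m = "exp ((A+A') * k i + (B+B'))"
    have "cmod (f (x i) + h (x i)) \<le> exp (A * k i + B) + exp (A' * k i + B')"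
      using AB(5,6)[OF that] norm_triangle_le add_mono by blast
    also have "\<dots> \<le> 2 * ?m"
    proof -
      have "0 \<le> A' * k i" "0 \<le> A * k i" using AB k[OF that] by auto
      then have "exp (A * k i + B) \<le> ?m" "exp (A' * k i + B') \<le> ?m" using AB by (auto simp: algebra_simps)
      then show ?thesis by linarith
    qed
    also have "\<dots> \<le> exp 1 * ?m"
      using exp_ge_add_one_self[of 1] by (intro mult_right_mono) auto
    also have "\<dots> = exp ((A+A') * k i + (B+B'+1))" by (simp add: exp_add)
    finally show ?thesis .
  qed
  then show ?case using AB by (intro exI[of _ "A+A'"] exI[of _ "B+B'+1"]) auto
next
  case (mult f h)
  then obtain A B A' B' where AB: "A > 0" "B > 0" "A' > 0" "B' > 0"
      "\<And>i. i \<in> I \<Longrightarrow> cmod (f (x i)) \<le> exp (A * k i + B)"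
      "\<And>i. i \<in> I \<Longrightarrow> cmod (h (x i)) \<le> exp (A' * k i + B')" by blast
  have "cmod (f (x i) * h (x i)) \<le> exp ((A+A') * k i + (B+B'))" if "i \<in> I" for i
  proof -
    have "cmod (f (x i) * h (x i)) \<le> exp (A * k i + B) * exp (A' * k i + B')"
      unfolding norm_mult by (intro mult_mono AB that) auto
    also have "\<dots> = exp ((A+A') * k i + (B+B'))" by (simp add: exp_add[symmetric] algebra_simps)
    finally show ?thesis .
  qed
  then show ?case using AB by (intro exI[of _ "A+A'"] exI[of _ "B+B'"]) auto
qed

lemma is_norm_le_sum:
  fixes N :: "complex^'n \<Rightarrow> real"
  assumes "is_norm N"
  shows "N v \<le> (\<Sum>i\<in>UNIV. cmod (v $ i) * N (axis i 1))"
proof -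
  have N: "N (v + w) \<le> N v + N w" "N (a *s v) = cmod a * N v" "N 0 = 0" for v w a
    using assms unfolding is_norm_def by auto
  have "N (sum f S) \<le> (\<Sum>i\<in>S. N (f i))" if "finite S" for S and f :: "'n \<Rightarrow> complex^'n"
    using that by induction (auto simp: N intro: order_trans[OF N(1)])
  from this[of UNIV "\<lambda>i. v $ i *s axis i 1"] show ?thesis
    by (simp add: basis_expansion N)
qed

text \<open>The norm is continuous and positive on the compact Euclidean unit sphere.\<close>

lemma is_norm_component_le:
  fixes N :: "complex^'n \<Rightarrow> real"
  assumes "is_norm N"
  shows "\<exists>C>0. \<forall>v i. cmod (v $ i) \<le> C * N v"
proof -
  have N: "N (v + w) \<le> N v + N w" "N (a *s v) = cmod a * N v" "N 0 = 0" "N v \<ge> 0"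
     "N v = 0 \<longleftrightarrow> v = 0" for v w a
    using assms unfolding is_norm_def by auto
  define K where "K = (\<Sum>i\<in>(UNIV::'n set). N (axis i 1))"
  have K: "N v \<le> norm v * K" for v
  proof -
    have "N v \<le> (\<Sum>i\<in>UNIV. cmod (v $ i) * N (axis i 1))" by (rule is_norm_le_sum[OF assms])
    also have "\<dots> \<le> (\<Sum>i\<in>UNIV. norm v * N (axis i 1))"
      by (intro sum_mono mult_right_mono N Finite_Cartesian_Product.norm_nth_le)
    finally show ?thesis by (simp add: K_def sum_distrib_left)
  qed
  have K0: "K \<ge> 0" unfolding K_def by (intro sum_nonneg N)
  have sc: "N (r *\<^sub>R v) = \<bar>r\<bar> * N v" for r v
  proof -
    have "r *\<^sub>R v = of_real r *s v" by (auto simp: vec_eq_iff complex_eq_iff)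
    then show ?thesis by (simp add: N)
  qed
  have lip: "\<bar>N v - N w\<bar> \<le> K * norm (v - w)" for v w
  proof -
    have "N v \<le> N w + N (v - w)" "N w \<le> N v + N (w - v)"
      using N(1)[of w "v - w"] N(1)[of v "w - v"] by auto
    with K[of "v-w"] K[of "w - v"] show ?thesis by (simp add: norm_minus_commute mult.commute)
  qed
  have "K-lipschitz_on UNIV N" by (rule lipschitz_onI) (use lip K0 in \<open>auto simp: dist_norm\<close>)
  then have cont: "continuous_on (sphere 0 1) N"
    using lipschitz_on_continuous_on continuous_on_subset by blast
  have "axis undefined 1 \<in> sphere (0::complex^'n) 1" by (simp add: norm_axis_1)
  then have "sphere (0::complex^'n) 1 \<noteq> {}" by blast
  from continuous_attains_inf[OF compact_sphere this cont] obtain v0 where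
    v0: "norm v0 = 1" "\<And>v. norm v = 1 \<Longrightarrow> N v0 \<le> N v" by auto
  have pos: "N v0 > 0" using N(4,5)[of v0] v0(1) by fastforce
  have "cmod (v $ i) \<le> inverse (N v0) * N v" for v i
  proof (cases "v = 0")
    case False
    have "N v0 \<le> N (inverse (norm v) *\<^sub>R v)" using False by (intro v0) auto
    then have "N v0 * norm v \<le> N v" using False by (simp add: sc field_simps)
    then have "norm v \<le> inverse (N v0) * N v" using pos by (simp add: field_simps)
    then show ?thesis using Finite_Cartesian_Product.norm_nth_le[of v i] by linarith
  qed (use N in auto)
  then show ?thesis using pos by (intro exI[of _ "inverse (N v0)"]) auto
qed

section \<open>The linear differential equation\<close>

abbreviation HP :: "complex set" where "HP \<equiv> upper_half_plane"

lemma open_HP: "open HP" unfolding upper_half_plane_def by (rule open_halfspace_Im_gt)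
lemma convex_HP: "convex HP" unfolding upper_half_plane_def by (rule convex_halfspace_Im_gt)
lemma connected_HP: "connected HP" by (rule convex_connected[OF convex_HP])

text \<open>Each integration raises the order of vanishing at \<open>a\<close> and contributes the factor \<open>1 / (k + 1)\<close>; in an
  iteration these factors accumulate to a factorial.\<close>

lemma primitive_bound:
  fixes F :: "complex \<Rightarrow> complex"
  assumes F: "\<And>w. w \<in> closed_segment a z \<Longrightarrow> (F has_field_derivative f w) (at w)" and "F a = 0"
    and b: "\<And>w. w \<in> closed_segment a z \<Longrightarrow> cmod (f w) \<le> A * cmod (w - a) ^ k"
  shows "cmod (F z) \<le> A * cmod (z - a) ^ Suc k / real (Suc k)"
proof -
  let ?l = "\<lambda>s::real. a + of_real s * (z - a)"
  have l: "?l s \<in> closed_segment a z" if "0 \<le> s" "s \<le> 1" for s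
    using that unfolding in_segment by (intro exI[of _ s]) (auto simp: algebra_simps scaleR_conv_of_real)
  have der: "((F \<circ> ?l) has_vector_derivative ((z - a) * f (?l s))) (at s)" if "0 \<le> s" "s \<le> 1" for s
    by (rule field_vector_diff_chain_at)
       (auto intro!: F l that derivative_eq_intros simp: has_vector_derivative_def scaleR_conv_of_real)
  have cont: "continuous_on {0..1} (F \<circ> ?l)"
    using der has_vector_derivative_continuous by (intro continuous_at_imp_continuous_on) force
  have "norm ((F \<circ> ?l) 1 - (F \<circ> ?l) 0) \<le> (\<lambda>s. A * cmod (z-a)^Suc k / real (Suc k) * s ^ Suc k) 1
       - (\<lambda>s. A * cmod (z-a)^Suc k / real (Suc k) * s ^ Suc k) 0"
  proof (rule differentiable_bound_general[where \<phi> = "\<lambda>s. A * cmod (z-a)^Suc k / real (Suc k) * s ^ Suc k" and f = "F \<circ> ?l"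
      and f' = "\<lambda>s. (z - a) * f (?l s)" and \<phi>' = "\<lambda>s. A * cmod (z-a)^Suc k * s ^ k" and a = 0 and b = 1])
    show "continuous_on {0..1} (F \<circ> ?l)" by (rule cont)
    fix s :: real assume s: "0 < s" "s < 1"
    show "((\<lambda>s. A * cmod (z-a)^Suc k / real (Suc k) * s ^ Suc k) has_vector_derivative
        (A * cmod (z-a)^Suc k * s ^ k)) (at s)"
      unfolding has_real_derivative_iff_has_vector_derivative[symmetric]
      using DERIV_cmult[OF DERIV_pow[of "Suc k" s], of "A * cmod (z-a)^Suc k / real (Suc k)"]
      by (simp del: power_Suc of_nat_Suc add: mult.assoc)
    show "((F \<circ> ?l) has_vector_derivative ((z - a) * f (?l s))) (at s)" using s der by auto
    have "cmod (f (?l s)) \<le> A * cmod (?l s - a) ^ k" using s by (intro b l) auto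
    also have "\<dots> = A * (s * cmod (z - a)) ^ k" using s by (simp add: norm_mult)
    finally have "cmod (z - a) * cmod (f (?l s)) \<le> cmod (z - a) * (A * (s * cmod (z - a)) ^ k)"
      by (intro mult_left_mono) auto
    then show "norm ((z - a) * f (?l s)) \<le> A * cmod (z-a)^Suc k * s ^ k"
      by (simp add: norm_mult power_mult_distrib mult_ac)
  next
    show "continuous_on {0..1} (\<lambda>s. A * cmod (z-a)^Suc k / real (Suc k) * s ^ Suc k)"
      by (intro continuous_on_mult_left continuous_on_power continuous_on_id)
  qed (rule zero_less_one)
  then show ?thesis using assms(2) by simp
qed

text \<open>Picard iteration: the corrections \<open>v n\<close> solve \<open>v (n+1)'' = \<psi> v n\<close>; they are bounded by
  the terms of an exponential series, so that their sum solves \<open>u'' = \<psi> u\<close>.\<close>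

lemma linear_ode_exists:
  fixes \<psi> :: "complex \<Rightarrow> complex"
  assumes S: "open S" "convex S" and z0: "z0 \<in> S" and \<psi>: "\<psi> holomorphic_on S"
  shows "\<exists>u u'. u z0 = a \<and> u' z0 = b \<and> (\<forall>z\<in>S. (u has_field_derivative u' z) (at z) \<and>
     (u' has_field_derivative \<psi> z * u z) (at z))"
proof -
  define prim where "prim = (\<lambda>f. SOME F. F z0 = 0 \<and> (\<forall>z\<in>S. (F has_field_derivative f z) (at z)))"
  have prim: "prim f z0 = 0 \<and> (\<forall>z\<in>S. (prim f has_field_derivative f z) (at z))"
    if fh: "f holomorphic_on S" for f :: "complex \<Rightarrow> complex"
  proof -
    obtain F where "\<And>z. z \<in> S \<Longrightarrow> (F has_field_derivative f z) (at z within S)"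
      using holomorphic_convex_primitive'[OF S(2,1) fh] by blast
    then have "(F has_field_derivative f z) (at z)" if "z \<in> S" for z
      using at_within_open[OF that S(1)] that by metis
    then have "\<forall>z\<in>S. ((\<lambda>z. F z - F z0) has_field_derivative f z) (at z)"
      using DERIV_diff[OF _ DERIV_const] by fastforce
    then have "\<exists>F. F z0 = 0 \<and> (\<forall>z\<in>S. (F has_field_derivative f z) (at z))"
      by (intro exI[of _ "\<lambda>z. F z - F z0"]) auto
    then show ?thesis unfolding prim_def by (rule someI_ex)
  qed
  have prim_holo: "prim f holomorphic_on S" if "f holomorphic_on S" for f
    using prim[OF that] S holomorphic_on_open by blast
  define v where "v = rec_nat (\<lambda>z. a + b * (z - z0)) (\<lambda>n f. prim (prim (\<lambda>z. \<psi> z * f z)))"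
  have v0: "v 0 = (\<lambda>z. a + b * (z - z0))" and vS: "v (Suc n) = prim (prim (\<lambda>z. \<psi> z * v n z))" for n
    by (simp_all add: v_def)
  define dv where "dv = (\<lambda>n. case n of 0 \<Rightarrow> (\<lambda>_. b) | Suc n \<Rightarrow> prim (\<lambda>z. \<psi> z * v n z))"
  have vh: "v n holomorphic_on S" for n
    by (induction n) (auto simp: v0 vS intro!: holomorphic_intros prim_holo \<psi>)
  have dvS: "dv (Suc n) z0 = 0" "z \<in> S \<Longrightarrow> (dv (Suc n) has_field_derivative \<psi> z * v n z) (at z)"
     "dv (Suc n) holomorphic_on S" for n z
    using prim[of "\<lambda>z. \<psi> z * v n z"] prim_holo[of "\<lambda>z. \<psi> z * v n z"] \<psi> vh[of n]
    by (auto simp: dv_def intro!: holomorphic_intros)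
  have vd: "(v n has_field_derivative dv n z) (at z)" if "z \<in> S" for n z
  proof (cases n)
    case 0 then show ?thesis by (auto simp: v0 dv_def intro!: derivative_eq_intros)
  next
    case (Suc m)
    with prim[OF dvS(3)[of m]] that show ?thesis by (auto simp: vS dv_def)
  qed
  have vSz: "v (Suc n) z0 = 0" for n using prim[OF dvS(3)[of n]] by (auto simp: vS dv_def)
  \<comment> \<open>The bounds for \<open>v n\<close> near \<open>x\<close> come from integration along segments from \<open>z0\<close>; the convex hull of a
    disc and \<open>z0\<close> is a compact set that contains these segments.\<close>
  have bounds: "\<exists>d>0. \<exists>C P R. \<forall>n. \<forall>y\<in>ball x d \<inter> S. cmod (v n y) \<le> C * (P*R)^n / fact n
         \<and> cmod (dv (Suc n) y) \<le> P * (C * (P*R)^n / fact n)" if x: "x \<in> S" for x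
  proof -
    obtain d where d: "d > 0" "cball x d \<subseteq> S" using S x open_contains_cball by blast
    define K where "K = convex hull (insert z0 (cball x d))"
    have K: "compact K" "convex K" "K \<subseteq> S" "z0 \<in> K" "cball x d \<subseteq> K"
    proof -
      show "compact K" unfolding K_def by (intro compact_convex_hull) simp
      show "convex K" unfolding K_def by simp
      show "K \<subseteq> S" unfolding K_def by (intro hull_minimal) (use d z0 S in auto)
      show "z0 \<in> K" "cball x d \<subseteq> K" unfolding K_def
        using hull_subset[of "insert z0 (cball x d)" convex] by auto
    qed
    obtain P where P: "P > 0" "\<And>z. z \<in> K \<Longrightarrow> cmod (\<psi> z) \<le> P"
      using compact_imp_bounded[OF compact_continuous_image[OF holomorphic_on_imp_continuous_on[OF holomorphic_on_subset[OF \<psi> K(3)]] K(1)]]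
      by (auto simp: bounded_pos)
    obtain C where C: "C > 0" "\<And>z. z \<in> K \<Longrightarrow> cmod (v 0 z) \<le> C"
      using compact_imp_bounded[OF compact_continuous_image[OF holomorphic_on_imp_continuous_on[OF holomorphic_on_subset[OF vh[of 0] K(3)]] K(1)]]
      by (auto simp: bounded_pos)
    obtain R0 where R0: "R0 > 0" "\<And>z. z \<in> K \<Longrightarrow> cmod z \<le> R0"
      using compact_imp_bounded[OF K(1)] by (auto simp: bounded_pos)
    define R where "R = 2 * R0 + 1"
    have R: "R \<ge> 1" "\<And>z. z \<in> K \<Longrightarrow> cmod (z - z0) \<le> R"
    proof -
      show "R \<ge> 1" using R0 by (simp add: R_def)
      fix z assume "z \<in> K"
      then show "cmod (z - z0) \<le> R" using R0(2)[of z] R0(2)[OF K(4)] norm_triangle_ineq4[of z z0]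
        by (simp add: R_def)
    qed
    have seg: "closed_segment z0 z \<subseteq> K" if "z \<in> K" for z
      using K that by (intro closed_segment_subset) auto
    have main: "cmod (v n z) \<le> C * (P*R)^n * cmod (z - z0)^n / fact n \<and>
        cmod (dv (Suc n) z) \<le> P * (C * (P*R)^n / fact n) * cmod (z - z0)^Suc n / real (Suc n)"
      if "z \<in> K" for n z using that
    proof (induction n arbitrary: z)
      have dvb: "cmod (dv (Suc n) z) \<le> P * (C * (P*R)^n / fact n) * cmod (z - z0)^Suc n / real (Suc n)"
        if "\<And>w. w \<in> K \<Longrightarrow> cmod (v n w) \<le> C * (P*R)^n * cmod (w - z0)^n / fact n" "z \<in> K" for n z
      proof (rule primitive_bound[where f = "\<lambda>w. \<psi> w * v n w"])
        fix w assume "w \<in> closed_segment z0 z"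
        then have w: "w \<in> K" using seg that by auto
        show "(dv (Suc n) has_field_derivative \<psi> w * v n w) (at w)" using w K dvS by blast
        have "cmod (\<psi> w * v n w) \<le> P * (C * (P*R)^n * cmod (w - z0)^n / fact n)"
          unfolding norm_mult using that w P by (intro mult_mono) auto
        then show "cmod (\<psi> w * v n w) \<le> P * (C * (P*R)^n / fact n) * cmod (w - z0)^n" by (simp add: field_simps)
      qed (rule dvS)
      {
        case 0
        then show ?case using dvb[of 0 z] C by auto
      next
        case (Suc n)
        have vb: "cmod (v (Suc n) z) \<le> C * (P*R)^Suc n * cmod (z - z0)^Suc n / fact (Suc n)" if "z \<in> K" for z
        proof -
          let ?A = "P * (C * (P*R)^n / fact n) * cmod (z - z0)^Suc n / real (Suc n)"
          have A0: "?A \<ge> 0" using P C R by auto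
          have "cmod (v (Suc n) z) \<le> ?A * cmod (z - z0) ^ Suc 0 / real (Suc 0)"
          proof (rule primitive_bound[where f = "dv (Suc n)"])
            fix w assume w: "w \<in> closed_segment z0 z"
            then have wK: "w \<in> K" using seg that by auto
            show "(v (Suc n) has_field_derivative dv (Suc n) w) (at w)" using wK K vd by blast
            have "cmod (w - z0) \<le> cmod (z - z0)" using segment_bound1[of w z0 z] w by simp
            then have "P * (C * (P*R)^n / fact n) * cmod (w - z0)^Suc n / real (Suc n) \<le> ?A"
              using P C R by (intro divide_right_mono mult_left_mono power_mono) auto
            then show "cmod (dv (Suc n) w) \<le> ?A * cmod (w - z0) ^ 0" using Suc.IH[OF wK] by auto
          qed (rule vSz)
          also have "\<dots> \<le> ?A * R" using mult_left_mono[OF R(2)[OF that] A0] by simp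
          also have "\<dots> = C * (P*R)^Suc n * cmod (z - z0)^Suc n / fact (Suc n)" by (simp add: field_simps)
          finally show ?thesis .
        qed
        show ?case using vb dvb[of "Suc n", OF vb] Suc.prems by auto
      }
    qed
    have "cmod (v n y) \<le> C * (P*R*R)^n / fact n
         \<and> cmod (dv (Suc n) y) \<le> (P*R) * (C * (P*R*R)^n / fact n)" if "y \<in> ball x d" for n y
    proof -
      have y: "y \<in> K" using that K(5) by (auto simp: mem_ball)
      have p: "cmod (y - z0)^m \<le> R^m" for m using R(2)[OF y] by (intro power_mono) auto
      have "C * (P*R)^n * cmod (y - z0)^n / fact n \<le> C * (P*R)^n * R^n / fact n"
        using P C R by (intro divide_right_mono mult_left_mono p) auto
      also have "\<dots> = C * (P*R*R)^n / fact n" by (simp add: power_mult_distrib)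
      finally have 1: "cmod (v n y) \<le> C * (P*R*R)^n / fact n" using main[OF y, of n] by linarith
      have "P * (C * (P*R)^n / fact n) * cmod (y - z0)^Suc n / real (Suc n)
          \<le> P * (C * (P*R)^n / fact n) * R^Suc n / 1"
        using P C R by (intro frac_le mult_left_mono p) auto
      also have "\<dots> = (P*R) * (C * (P*R*R)^n / fact n)" by (simp add: power_mult_distrib)
      finally show ?thesis using 1 main[OF y, of n] by linarith
    qed
    then have "\<forall>n. \<forall>y\<in>ball x d \<inter> S. cmod (v n y) \<le> C * ((P*R)*R)^n / fact n
         \<and> cmod (dv (Suc n) y) \<le> (P*R) * (C * ((P*R)*R)^n / fact n)" by auto
    then show ?thesis using d(1) by (intro exI[of _ d] conjI exI[of _ C] exI[of _ "P*R"] exI[of _ R])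
  qed
  have summ: "summable (\<lambda>n. C * (x::real)^n / fact n)" for C x
    using summable_mult[OF summable_exp[of x], of C] by (simp add: field_simps)
  have "\<exists>u u'. \<forall>x\<in>S. (\<lambda>n. v n x) sums u x \<and> (\<lambda>n. dv n x) sums u' x \<and> (u has_field_derivative u' x) (at x)"
  proof (rule series_and_derivative_comparison_local[OF S(1), of v dv])
    fix n x assume "x \<in> S" then show "(v n has_field_derivative dv n x) (at x)" by (rule vd)
  next
    fix x assume x: "x \<in> S"
    from bounds[OF this] obtain d C P R where d: "d > 0" "\<forall>n. \<forall>y\<in>ball x d \<inter> S. cmod (v n y) \<le> C * (P*R)^n / fact n" by blast
    then show "\<exists>d h. 0 < d \<and> summable h \<and> (\<forall>\<^sub>F n in sequentially. \<forall>y\<in>ball x d \<inter> S. cmod (v n y) \<le> h n)"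
      by (intro exI[of _ d] exI[of _ "\<lambda>n. C * (P*R)^n / fact n"]) (auto intro: summ)
  qed
  then obtain u u' where u: "\<And>x. x \<in> S \<Longrightarrow> (\<lambda>n. v n x) sums u x \<and> (\<lambda>n. dv n x) sums u' x \<and> (u has_field_derivative u' x) (at x)"
    by blast
  define du where "du = (\<lambda>n z. \<psi> z * v n z)"
  have "\<exists>w w'. \<forall>x\<in>S. (\<lambda>n. dv (Suc n) x) sums w x \<and> (\<lambda>n. du n x) sums w' x \<and> (w has_field_derivative w' x) (at x)"
  proof (rule series_and_derivative_comparison_local[OF S(1), of "\<lambda>n. dv (Suc n)" du])
    fix n x assume "x \<in> S" then show "(dv (Suc n) has_field_derivative du n x) (at x)" unfolding du_def by (intro dvS)
  next
    fix x assume x: "x \<in> S"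
    from bounds[OF this] obtain d C P R where d: "d > 0" "\<forall>n. \<forall>y\<in>ball x d \<inter> S. cmod (dv (Suc n) y) \<le> P * (C * (P*R)^n / fact n)" by blast
    then show "\<exists>d h. 0 < d \<and> summable h \<and> (\<forall>\<^sub>F n in sequentially. \<forall>y\<in>ball x d \<inter> S. cmod (dv (Suc n) y) \<le> h n)"
      using summable_mult[OF summ[of C "P*R"], of P]
      by (intro exI[of _ d] exI[of _ "\<lambda>n. P * (C * (P*R)^n / fact n)"]) auto
  qed
  then obtain w w' where w: "\<And>x. x \<in> S \<Longrightarrow> (\<lambda>n. dv (Suc n) x) sums w x \<and> (\<lambda>n. du n x) sums w' x \<and> (w has_field_derivative w' x) (at x)"
    by blast
  have w'eq: "w' x = \<psi> x * u x" if "x \<in> S" for x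
    using w[OF that] sums_mult[of "\<lambda>n. v n x" "u x" "\<psi> x"] u[OF that] sums_unique2 unfolding du_def by blast
  have u'eq: "u' x = w x + b" if "x \<in> S" for x
  proof -
    have "(\<lambda>n. dv n x) sums (w x + dv 0 x)" using w[OF that] sums_Suc_iff by blast
    with u[OF that] have "u' x = w x + dv 0 x" using sums_unique2 by blast
    then show ?thesis by (simp add: dv_def)
  qed
  have "(u' has_field_derivative \<psi> x * u x) (at x)" if "x \<in> S" for x
  proof -
    have "((\<lambda>x. w x + b) has_field_derivative \<psi> x * u x) (at x)"
      using w[OF that] w'eq[OF that] by (auto intro!: derivative_eq_intros)
    then show ?thesis
      by (rule has_field_derivative_transform_within_open[OF _ S(1) that]) (simp add: u'eq)
  qed
  moreover have "u z0 = a"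
  proof -
    have "v n z0 = 0" if "n \<notin> {0}" for n using that vSz[of "n - 1"] by simp
    then have "(\<lambda>n. v n z0) sums (\<Sum>n\<in>{0}. v n z0)" by (intro sums_finite) auto
    then have "(\<lambda>n. v n z0) sums a" by (simp add: v0)
    with u[OF z0] show ?thesis using sums_unique2 by blast
  qed
  moreover have "u' z0 = b"
  proof -
    have "(\<lambda>n. dv (Suc n) z0) sums 0" by (simp add: dvS)
    with w[OF z0] have "w z0 = 0" using sums_unique2 by blast
    then show ?thesis using u'eq[OF z0] by simp
  qed
  ultimately show ?thesis using u by blast
qed

text \<open>The coefficient is chosen such that the ratio of two independent solutions has Schwarzian
  derivative \<open>\<phi>\<close>.\<close>

definition is_sol :: "(complex \<Rightarrow> complex) \<Rightarrow> (complex \<Rightarrow> complex) \<Rightarrow> bool" where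
  "is_sol \<phi> u \<longleftrightarrow> (\<forall>z\<in>HP. (u has_field_derivative deriv u z) (at z) \<and>
      (deriv u has_field_derivative - (\<phi> z / 2) * u z) (at z))"

definition wronskian :: "(complex \<Rightarrow> complex) \<Rightarrow> (complex \<Rightarrow> complex) \<Rightarrow> complex \<Rightarrow> complex" where
  "wronskian u v z = deriv u z * v z - u z * deriv v z"

lemma is_solD:
  assumes "is_sol \<phi> u" "z \<in> HP"
  shows "(u has_field_derivative deriv u z) (at z)"
    "(deriv u has_field_derivative - (\<phi> z / 2) * u z) (at z)"
  using assms unfolding is_sol_def by auto

lemma is_solI:
  assumes "open S" "HP \<subseteq> S" "\<And>z. z \<in> S \<Longrightarrow> (u has_field_derivative u' z) (at z)"
    and "\<And>z. z \<in> HP \<Longrightarrow> (u' has_field_derivative - (\<phi> z / 2) * u z) (at z)"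
  shows "is_sol \<phi> u"
  unfolding is_sol_def
proof (intro ballI conjI)
  fix z assume z: "z \<in> HP"
  have d: "deriv u w = u' w" if "w \<in> S" for w using assms(3)[OF that] by (rule DERIV_imp_deriv)
  show "(u has_field_derivative deriv u z) (at z)" using z d assms by auto
  show "(deriv u has_field_derivative - (\<phi> z / 2) * u z) (at z)"
    by (rule has_field_derivative_transform_within_open[OF assms(4)[OF z] assms(1)]) (use z assms d in auto)
qed

lemma is_sol_exists:
  assumes "\<phi> holomorphic_on HP" "z0 \<in> HP"
  shows "\<exists>u. is_sol \<phi> u \<and> u z0 = a \<and> deriv u z0 = b"
proof -
  have h: "(\<lambda>z. - (\<phi> z / 2)) holomorphic_on HP" using assms(1) by (auto intro!: holomorphic_intros)
  obtain u u' where u: "u z0 = a" "u' z0 = b" "\<And>z. z\<in>HP \<Longrightarrow> (u has_field_derivative u' z) (at z)"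
     "\<And>z. z\<in>HP \<Longrightarrow> (u' has_field_derivative (- (\<phi> z / 2)) * u z) (at z)"
    using linear_ode_exists[OF open_HP convex_HP assms(2) h, of a b] by blast
  have "is_sol \<phi> u" by (rule is_solI[OF open_HP _ u(3,4)]) auto
  then show ?thesis using u DERIV_imp_deriv[OF u(3)[OF assms(2)]] by auto
qed

lemma is_sol_lincomb:
  assumes "is_sol \<phi> u" "is_sol \<phi> v"
  shows "is_sol \<phi> (\<lambda>z. a * u z + b * v z)"
    "z \<in> HP \<Longrightarrow> deriv (\<lambda>z. a * u z + b * v z) z = a * deriv u z + b * deriv v z"
proof -
  have d: "((\<lambda>z. a * u z + b * v z) has_field_derivative a * deriv u z + b * deriv v z) (at z)"
    if "z \<in> HP" for z
    using is_solD(1)[OF assms(1) that] is_solD(1)[OF assms(2) that] by (auto intro!: derivative_eq_intros)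
  show "is_sol \<phi> (\<lambda>z. a * u z + b * v z)"
  proof (rule is_solI[OF open_HP _ d])
    fix z assume "z \<in> HP"
    then show "((\<lambda>z. a * deriv u z + b * deriv v z) has_field_derivative - (\<phi> z / 2) * (a * u z + b * v z)) (at z)"
      using is_solD(2)[OF assms(1)] is_solD(2)[OF assms(2)]
      by (auto intro!: derivative_eq_intros simp: algebra_simps)
  qed auto
  show "z \<in> HP \<Longrightarrow> deriv (\<lambda>z. a * u z + b * v z) z = a * deriv u z + b * deriv v z"
    using d DERIV_imp_deriv by blast
qed

lemma is_sol_deriv_cmult:
  assumes "is_sol \<phi> u" "z \<in> HP"
  shows "deriv (\<lambda>z. c * u z) z = c * deriv u z"
  by (rule DERIV_imp_deriv[OF DERIV_cmult[OF is_solD(1)[OF assms]]])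

text \<open>The Wronskian has derivative \<open>\<psi> u v - u \<psi> v = 0\<close>.\<close>

lemma wronskian_constant_local:
  assumes S: "open S" "convex S" and S2: "z \<in> S" "w \<in> S"
    and u: "\<And>z. z\<in>S \<Longrightarrow> (u has_field_derivative u' z) (at z)"
     "\<And>z. z\<in>S \<Longrightarrow> (u' has_field_derivative \<psi> z * u z) (at z)"
    and v: "\<And>z. z\<in>S \<Longrightarrow> (v has_field_derivative v' z) (at z)"
     "\<And>z. z\<in>S \<Longrightarrow> (v' has_field_derivative \<psi> z * v z) (at z)"
  shows "u' z * v z - u z * v' z = u' w * v w - u w * v' w"
proof -
  have "((\<lambda>z. u' z * v z - u z * v' z) has_field_derivative 0) (at z within S)" if "z \<in> S" for z
    using u[OF that] v[OF that] 
    by (auto intro!: derivative_eq_intros has_field_derivative_at_within[of _ _ z S] simp: algebra_simps)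
  from has_field_derivative_zero_constant[OF S(2) this] S2 show ?thesis by metis
qed

lemma wronskian_constant:
  assumes "is_sol \<phi> u" "is_sol \<phi> v" "z \<in> HP" "w \<in> HP"
  shows "wronskian u v z = wronskian u v w"
  unfolding wronskian_def
  by (rule wronskian_constant_local[OF open_HP convex_HP, where \<psi>="\<lambda>z. - (\<phi> z / 2)"]) (use assms is_solD in auto)

text \<open>By Cramer's rule the coefficients are Wronskians of \<open>v\<close> with the two basis solutions, and these
  are constant. Also solutions defined on a part of the half-plane are covered, so that they extend.\<close>

lemma sol_in_basis_local:
  assumes S: "open S" "convex S" "S \<subseteq> HP" "S \<noteq> {}"
    and "is_sol \<phi> u1" "is_sol \<phi> u2" and wr1: "\<And>z. z \<in> HP \<Longrightarrow> wronskian u1 u2 z = 1"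
    and v: "\<And>z. z\<in>S \<Longrightarrow> (v has_field_derivative v' z) (at z)"
     "\<And>z. z\<in>S \<Longrightarrow> (v' has_field_derivative - (\<phi> z / 2) * v z) (at z)"
  shows "\<exists>a b. \<forall>z\<in>S. v z = a * u1 z + b * u2 z"
proof -
  obtain w where w: "w \<in> S" using S by blast
  define a where "a = v' w * u2 w - v w * deriv u2 w"
  define b where "b = v' w * u1 w - v w * deriv u1 w"
  have "v z = a * u1 z + (-b) * u2 z" if z: "z \<in> S" for z
  proof -
    have "v' z * u2 z - v z * deriv u2 z = a" unfolding a_def
      by (rule wronskian_constant_local[OF S(1,2) z w, where \<psi>="\<lambda>z. - (\<phi> z / 2)"]) (use assms(3,5,6) v is_solD in auto)
    moreover have "v' z * u1 z - v z * deriv u1 z = b" unfolding b_def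
      by (rule wronskian_constant_local[OF S(1,2) z w, where \<psi>="\<lambda>z. - (\<phi> z / 2)"]) (use assms(3,5,6) v is_solD in auto)
    moreover have "deriv u1 z * u2 z - u1 z * deriv u2 z = 1" using wr1[of z] z S by (auto simp: wronskian_def)
    moreover have "(v' z * u2 z - v z * deriv u2 z) * u1 z + (- (v' z * u1 z - v z * deriv u1 z)) * u2 z
        = v z * (deriv u1 z * u2 z - u1 z * deriv u2 z)" by (simp add: algebra_simps)
    ultimately show ?thesis by simp
  qed
  then show ?thesis by blast
qed

lemma sol_in_basis:
  assumes "is_sol \<phi> u1" "is_sol \<phi> u2" "\<And>z. z \<in> HP \<Longrightarrow> wronskian u1 u2 z = 1" "is_sol \<phi> v"
  shows "\<exists>a b. \<forall>z\<in>HP. v z = a * u1 z + b * u2 z"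
proof (rule sol_in_basis_local[OF open_HP convex_HP _ _ assms(1-3)])
  have "\<i> \<in> HP" by (simp add: upper_half_plane_def)
  then show "HP \<noteq> {}" by blast
qed (use assms(4) is_solD in auto)

lemma deriv_cong_HP:
  assumes "\<And>z. z \<in> HP \<Longrightarrow> u z = v z" "z \<in> HP"
  shows "deriv u z = deriv v z"
  by (rule deriv_cong_ev) (use assms open_HP eventually_nhds_in_open[of HP z] in \<open>auto elim: eventually_mono\<close>)

text \<open>The vectors \<open>(p, q)\<close> and \<open>(p', q')\<close> form a basis, and the form and its polar form vanish on them.\<close>

lemma quadratic_form_zero:
  fixes a b c p q p' q' :: complex
  assumes e: "a * p^2 + b * p * q + c * q^2 = 0"
    "2 * a * p * p' + b * (p' * q + p * q') + 2 * c * q * q' = 0"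
    "a * p'^2 + b * p' * q' + c * q'^2 = 0" "p' * q - p * q' = 1"
  shows "a = 0 \<and> b = 0 \<and> c = 0"
proof -
  have "(p' * q - p * q')^2 * a = q^2 * (a * p'^2 + b * p' * q' + c * q'^2)
     - q * q' * (2 * a * p * p' + b * (p' * q + p * q') + 2 * c * q * q') + q'^2 * (a * p^2 + b * p * q + c * q^2)"
    by (simp add: algebra_simps power2_eq_square)
  then have a: "a = 0" unfolding e by simp
  have "(p' * q - p * q')^2 * c = p^2 * (a * p'^2 + b * p' * q' + c * q'^2)
     - p * p' * (2 * a * p * p' + b * (p' * q + p * q') + 2 * c * q * q') + p'^2 * (a * p^2 + b * p * q + c * q^2)"
    by (simp add: algebra_simps power2_eq_square)
  then have c: "c = 0" unfolding e by simp
  have "b = 0"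
  proof (rule ccontr)
    assume "b \<noteq> 0"
    with e a c have "p * q = 0" "p' * q + p * q' = 0" by auto
    then have "p * q' = 0 \<and> p' * q = 0" by auto
    with e(4) show False by auto
  qed
  with a c show ?thesis by simp
qed

text \<open>Differentiating the relation once and twice, the form vanishes on the vector of values and on the
  vector of derivatives, and its polar form vanishes on this pair.\<close>

lemma quadratic_relation_trivial:
  assumes x: "is_sol \<phi> x" and y: "is_sol \<phi> y" and w: "\<And>z. z \<in> HP \<Longrightarrow> wronskian x y z = 1"
    and U: "open U" "U \<subseteq> HP" "z0 \<in> U"
    and Q: "\<And>z. z \<in> U \<Longrightarrow> a * (x z)^2 + b * x z * y z + c * (y z)^2 = 0"
  shows "a = 0 \<and> b = 0 \<and> c = 0"
proof -
  have d0: "deriv f z = 0" if "\<And>z. z \<in> U \<Longrightarrow> f z = 0" "z \<in> U" for f :: "complex \<Rightarrow> complex" and z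
  proof -
    have "(f has_field_derivative 0) (at z)"
      by (rule has_field_derivative_transform_within_open[OF DERIV_const U(1) that(2)]) (use that in auto)
    then show ?thesis by (rule DERIV_imp_deriv)
  qed
  have Q': "2 * a * x z * deriv x z + b * (deriv x z * y z + x z * deriv y z) + 2 * c * y z * deriv y z = 0"
    (is "?P z = 0") if "z \<in> U" for z
  proof -
    have z: "z \<in> HP" using that U by auto
    have "((\<lambda>z. a * (x z)^2 + b * x z * y z + c * (y z)^2) has_field_derivative ?P z) (at z)"
      using is_solD(1)[OF x z] is_solD(1)[OF y z] by (auto intro!: derivative_eq_intros simp: algebra_simps power2_eq_square)
    from DERIV_imp_deriv[OF this] d0[OF Q that] show ?thesis by simp
  qed
  have z: "z0 \<in> HP" using U by auto
  have "(?P has_field_derivative 2 * (a * (deriv x z0)^2 + b * deriv x z0 * deriv y z0 + c * (deriv y z0)^2)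
       - \<phi> z0 * (a * (x z0)^2 + b * x z0 * y z0 + c * (y z0)^2)) (at z0)"
    using is_solD[OF x z] is_solD[OF y z] by (auto intro!: derivative_eq_intros simp: algebra_simps power2_eq_square)
  from DERIV_imp_deriv[OF this] d0[of ?P, OF Q' U(3)]
  have eq: "2 * (a * (deriv x z0)^2 + b * deriv x z0 * deriv y z0 + c * (deriv y z0)^2)
       - \<phi> z0 * (a * (x z0)^2 + b * x z0 * y z0 + c * (y z0)^2) = 0"
    by (rule trans[OF sym])
  have aux: "2 * X - f * Y = 0 \<Longrightarrow> Y = 0 \<Longrightarrow> X = 0" for X f Y :: complex by simp
  have Q'': "a * (deriv x z0)^2 + b * deriv x z0 * deriv y z0 + c * (deriv y z0)^2 = 0"
    by (rule aux[OF eq Q[OF U(3)]])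
  note e = Q[OF U(3)] Q'[OF U(3)] Q'' w[OF z, unfolded wronskian_def]
  show ?thesis by (rule quadratic_form_zero) (use e in auto)
qed

text \<open>The point of the projective line with homogeneous coordinates \<open>a\<close> and \<open>b\<close>, for \<open>(a, b) \<noteq> (0, 0)\<close>.\<close>

definition cpt :: "complex \<Rightarrow> complex \<Rightarrow> cp1" where
  "cpt a b = (if b = 0 then Infty else Fin (a / b))"

text \<open>Two pairs of solutions differ by a linear map. If the ratios agree, cross-multiplication is a
  quadratic relation between \<open>w1\<close> and \<open>w2\<close>, which is trivial; so the linear map is a scalar, and
  comparing the Wronskians its square is one.\<close>

lemma same_ratio:
  assumes v: "is_sol \<phi> v1" "is_sol \<phi> v2" "\<And>z. z \<in> HP \<Longrightarrow> wronskian v1 v2 z = 1"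
    and w: "is_sol \<phi> w1" "is_sol \<phi> w2" "\<And>z. z \<in> HP \<Longrightarrow> wronskian w1 w2 z = 1"
    and U: "open U" "U \<subseteq> HP" "z0 \<in> U" and eq: "\<And>z. z \<in> U \<Longrightarrow> cpt (v1 z) (v2 z) = cpt (w1 z) (w2 z)"
  shows "\<exists>k. k^2 = 1 \<and> (\<forall>z\<in>HP. v1 z = k * w1 z \<and> v2 z = k * w2 z)"
proof -
  obtain a b where ab: "\<forall>z\<in>HP. v1 z = a * w1 z + b * w2 z" using sol_in_basis[OF w v(1)] by blast
  obtain c d where cd: "\<forall>z\<in>HP. v2 z = c * w1 z + d * w2 z" using sol_in_basis[OF w v(2)] by blast
  have "(-c) * (w1 z)^2 + (a-d) * w1 z * w2 z + b * (w2 z)^2 = 0" if "z \<in> U" for z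
  proof -
    have z: "z \<in> HP" using that U by auto
    have "v1 z * w2 z = v2 z * w1 z"
      using eq[OF that] by (auto simp: cpt_def field_simps split: if_splits)
    with ab cd z show ?thesis by (simp add: algebra_simps power2_eq_square)
  qed
  from quadratic_relation_trivial[OF w U this] have k: "c = 0" "a = d" "b = 0" by auto
  have z0: "z0 \<in> HP" using U by auto
  have "deriv v1 z0 = a * deriv w1 z0" "deriv v2 z0 = a * deriv w2 z0"
    using deriv_cong_HP[OF _ z0, of v1 "\<lambda>z. a * w1 z"] deriv_cong_HP[OF _ z0, of v2 "\<lambda>z. a * w2 z"]
      ab cd k is_sol_deriv_cmult[OF w(1) z0] is_sol_deriv_cmult[OF w(2) z0] by auto
  then have "1 = a^2 * wronskian w1 w2 z0"
    using v(3)[OF z0] ab cd k z0 by (simp add: wronskian_def algebra_simps power2_eq_square)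
  then have "a^2 = 1" using w(3)[OF z0] by simp
  then show ?thesis using ab cd k by (intro exI[of _ a]) auto
qed

section \<open>Monodromy of the equation\<close>

abbreviation mA :: "complex^2^2 \<Rightarrow> complex" where "mA M \<equiv> vec_nth (vec_nth M 1) 1"
abbreviation mB :: "complex^2^2 \<Rightarrow> complex" where "mB M \<equiv> vec_nth (vec_nth M 1) 2"
abbreviation mC :: "complex^2^2 \<Rightarrow> complex" where "mC M \<equiv> vec_nth (vec_nth M 2) 1"
abbreviation mD :: "complex^2^2 \<Rightarrow> complex" where "mD M \<equiv> vec_nth (vec_nth M 2) 2"

definition jf :: "complex^2^2 \<Rightarrow> complex \<Rightarrow> complex" where "jf M z = mC M * z + mD M"
definition mob :: "complex^2^2 \<Rightarrow> complex \<Rightarrow> complex" where "mob M z = (mA M * z + mB M) / jf M z"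

text \<open>Solutions are forms of weight \<open>-1\<close>, that is, sections of the inverse of the spin bundle. The
  matrix, and not only its Moebius transformation, enters through the sign.\<close>

definition slash :: "complex^2^2 \<Rightarrow> (complex \<Rightarrow> complex) \<Rightarrow> complex \<Rightarrow> complex" where
  "slash M u z = jf M z * u (mob M z)"

definition hp_aut :: "complex^2^2 \<Rightarrow> bool" where
  "hp_aut M \<longleftrightarrow> det M = 1 \<and> (\<forall>z\<in>HP. jf M z \<noteq> 0 \<and> mob M z \<in> HP)"

definition automorphic :: "complex^2^2 \<Rightarrow> (complex \<Rightarrow> complex) \<Rightarrow> bool" where
  "automorphic M \<phi> \<longleftrightarrow> (\<forall>z\<in>HP. \<phi> (mob M z) = \<phi> z * jf M z ^ 4)"

lemma det_eq: "det M = mA M * mD M - mB M * mC M" for M :: "complex^2^2"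
  by (simp add: det_2)

lemma mob_deriv:
  assumes "hp_aut M" "z \<in> HP"
  shows "(mob M has_field_derivative 1 / (jf M z)^2) (at z)"
proof -
  have j: "mC M * z + mD M \<noteq> 0" using assms by (auto simp: hp_aut_def jf_def)
  have d: "mA M * mD M - mB M * mC M = 1" using assms by (simp add: hp_aut_def det_eq)
  have "(mA M * (mC M * z + mD M) - (mA M * z + mB M) * mC M) = 1" using d by (simp add: algebra_simps)
  then show ?thesis unfolding mob_def[abs_def] jf_def using j
    by (auto intro!: derivative_eq_intros simp: power2_eq_square)
qed

lemma slash_deriv:
  assumes M: "hp_aut M" and u: "\<And>z. z \<in> HP \<Longrightarrow> (u has_field_derivative u' z) (at z)" and z: "z \<in> HP"
  shows "(slash M u has_field_derivative mC M * u (mob M z) + u' (mob M z) / jf M z) (at z)"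
proof -
  have j: "jf M z \<noteq> 0" "mob M z \<in> HP" using M z by (auto simp: hp_aut_def)
  have dj: "(jf M has_field_derivative mC M) (at z)"
    unfolding jf_def[abs_def] by (auto intro!: derivative_eq_intros)
  have "((\<lambda>z. u (mob M z)) has_field_derivative u' (mob M z) * (1 / (jf M z)^2)) (at z)"
    by (rule DERIV_chain2[OF u[OF j(2)] mob_deriv[OF M z]])
  from DERIV_mult[OF dj this] show ?thesis unfolding slash_def[abs_def] using j
    by (simp add: field_simps power2_eq_square)
qed

text \<open>The weight \<open>4\<close> of \<open>\<phi>\<close> is what makes the factors \<open>1 / (c z + d)\<^sup>4\<close>, from two derivatives of the
  Moebius transformation, disappear from the equation.\<close>

lemma slash_sol:
  assumes M: "hp_aut M" and a: "automorphic M \<phi>" and u: "is_sol \<phi> u"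
  shows "is_sol \<phi> (slash M u)"
    "z \<in> HP \<Longrightarrow> deriv (slash M u) z = mC M * u (mob M z) + deriv u (mob M z) / jf M z"
proof -
  have d: "(slash M u has_field_derivative mC M * u (mob M z) + deriv u (mob M z) / jf M z) (at z)" if "z \<in> HP" for z
    by (rule slash_deriv[OF M _ that]) (use is_solD[OF u] in auto)
  then show "z \<in> HP \<Longrightarrow> deriv (slash M u) z = mC M * u (mob M z) + deriv u (mob M z) / jf M z"
    using DERIV_imp_deriv by blast
  show "is_sol \<phi> (slash M u)"
  proof (rule is_solI[OF open_HP _ d])
    fix z assume z: "z \<in> HP"
    have j: "jf M z \<noteq> 0" "mob M z \<in> HP" using M z by (auto simp: hp_aut_def)
    have dj: "(jf M has_field_derivative mC M) (at z)"
      unfolding jf_def[abs_def] by (auto intro!: derivative_eq_intros)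
    have 1: "((\<lambda>z. u (mob M z)) has_field_derivative deriv u (mob M z) * (1 / (jf M z)^2)) (at z)"
      by (rule DERIV_chain2[OF is_solD(1)[OF u j(2)] mob_deriv[OF M z]])
    have 2: "((\<lambda>z. deriv u (mob M z)) has_field_derivative (- (\<phi> (mob M z) / 2) * u (mob M z)) * (1 / (jf M z)^2)) (at z)"
      by (rule DERIV_chain2[OF is_solD(2)[OF u j(2)] mob_deriv[OF M z]])
    have a': "\<phi> (mob M z) = \<phi> z * jf M z ^ 4" using a z by (simp add: automorphic_def)
    show "((\<lambda>z. mC M * u (mob M z) + deriv u (mob M z) / jf M z) has_field_derivative - (\<phi> z / 2) * slash M u z) (at z)"
      by (rule DERIV_cong[OF DERIV_add[OF DERIV_cmult[OF 1] DERIV_divide[OF 2 dj j(1)]]])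
         (use j in \<open>simp add: a' slash_def field_simps power2_eq_square power4_eq_xxxx\<close>)
  qed auto
qed

lemma wronskian_slash:
  assumes M: "hp_aut M" and a: "automorphic M \<phi>" and u: "is_sol \<phi> u" "is_sol \<phi> v" and z: "z \<in> HP"
  shows "wronskian (slash M u) (slash M v) z = wronskian u v (mob M z)"
  using M z unfolding wronskian_def slash_sol(2)[OF M a u(1) z] slash_sol(2)[OF M a u(2) z] slash_def hp_aut_def
  by (auto simp: field_simps)

lemma slash_slash:
  assumes "hp_aut M" "hp_aut N" "z \<in> HP"
  shows "slash N (slash M u) z = slash (M ** N) u z"
    "jf (M ** N) z = jf M (mob N z) * jf N z" "mob (M ** N) z = mob M (mob N z)"
proof -
  have j: "jf N z \<noteq> 0" "mob N z \<in> HP" "jf M (mob N z) \<noteq> 0" using assms by (auto simp: hp_aut_def)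
  show 1: "jf (M ** N) z = jf M (mob N z) * jf N z"
    using j(1) by (simp add: jf_def mob_def matrix_matrix_mult_def sum_2 field_simps)
  have "mob M (mob N z) = (mA M * mob N z + mB M) * jf N z / (jf M (mob N z) * jf N z)"
    using j by (simp add: mob_def[of M])
  also have "(mA M * mob N z + mB M) * jf N z = mA (M ** N) * z + mB (M ** N)"
    using j(1) by (simp add: jf_def mob_def matrix_matrix_mult_def sum_2 field_simps)
  finally show 2: "mob (M ** N) z = mob M (mob N z)" by (simp add: mob_def[of "M ** N"] 1)
  show "slash N (slash M u) z = slash (M ** N) u z" by (simp add: slash_def 1 2)
qed

text \<open>The trace of the monodromy \<open>A\<close>, characterised without choosing a basis of solutions: an alternating form
  \<open>B\<close> on a plane satisfies \<open>B (A v, w) + B (v, A w) = tr A B (v, w)\<close>.\<close>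

definition is_mtrace :: "(complex \<Rightarrow> complex) \<Rightarrow> complex^2^2 \<Rightarrow> complex \<Rightarrow> bool" where
  "is_mtrace \<phi> M \<tau> \<longleftrightarrow> (\<forall>v1 v2. is_sol \<phi> v1 \<longrightarrow> is_sol \<phi> v2 \<longrightarrow> (\<forall>z\<in>HP.
      wronskian (slash M v1) v2 z + wronskian v1 (slash M v2) z = \<tau> * wronskian v1 v2 z))"

text \<open>Both sides of the characterisation are bilinear and alternating in the two solutions, so that it
  suffices to expand in a basis.\<close>

lemma is_mtrace_basis:
  assumes M: "hp_aut M" and au: "automorphic M \<phi>" and u: "is_sol \<phi> u1" "is_sol \<phi> u2" "\<And>z. z \<in> HP \<Longrightarrow> wronskian u1 u2 z = 1"
    and s1: "\<And>z. z \<in> HP \<Longrightarrow> slash M u1 z = a * u1 z + b * u2 z"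
    and s2: "\<And>z. z \<in> HP \<Longrightarrow> slash M u2 z = c * u1 z + d * u2 z"
  shows "is_mtrace \<phi> M (a + d)"
  unfolding is_mtrace_def
proof (intro allI impI ballI)
  fix v1 v2 z assume v: "is_sol \<phi> v1" "is_sol \<phi> v2" and z: "z \<in> HP"
  obtain p1 q1 where p1: "\<forall>z\<in>HP. v1 z = p1 * u1 z + q1 * u2 z" using sol_in_basis[OF u v(1)] by blast
  obtain p2 q2 where p2: "\<forall>z\<in>HP. v2 z = p2 * u1 z + q2 * u2 z" using sol_in_basis[OF u v(2)] by blast
  have sl: "slash M v z = (p * a + q * c) * u1 z + (p * b + q * d) * u2 z"
     "deriv v z = p * deriv u1 z + q * deriv u2 z"
     "deriv (slash M v) z = (p * a + q * c) * deriv u1 z + (p * b + q * d) * deriv u2 z"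
    if v: "\<forall>z\<in>HP. v z = p * u1 z + q * u2 z" for v p q
  proof -
    have *: "slash M v z = (p * a + q * c) * u1 z + (p * b + q * d) * u2 z" if z: "z \<in> HP" for z
    proof -
      have "slash M v z = p * slash M u1 z + q * slash M u2 z"
        using v M z by (simp add: slash_def hp_aut_def algebra_simps)
      also have "\<dots> = (p * a + q * c) * u1 z + (p * b + q * d) * u2 z"
        by (simp add: s1[OF z] s2[OF z] algebra_simps)
      finally show ?thesis .
    qed
    show "slash M v z = (p * a + q * c) * u1 z + (p * b + q * d) * u2 z" by (rule *[OF z])
    show "deriv v z = p * deriv u1 z + q * deriv u2 z"
      using deriv_cong_HP[OF _ z, of v "\<lambda>z. p * u1 z + q * u2 z"] is_sol_lincomb(2)[OF u(1,2) z] v by simp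
    show "deriv (slash M v) z = (p * a + q * c) * deriv u1 z + (p * b + q * d) * deriv u2 z"
      using deriv_cong_HP[OF * z] is_sol_lincomb(2)[OF u(1,2) z] by simp
  qed
  have comb: "(\<alpha> * y1 + \<beta> * y2) * (\<gamma> * x1 + \<delta> * x2) - (\<alpha> * x1 + \<beta> * x2) * (\<gamma> * y1 + \<delta> * y2)
      = (\<alpha> * \<delta> - \<beta> * \<gamma>) * (y1 * x2 - x1 * y2)" for \<alpha> \<beta> \<gamma> \<delta> x1 x2 y1 y2 :: complex
    by (simp add: algebra_simps)
  have fin: "(P * q2 - Q * p2) * D + (p1 * Q' - q1 * P') * D = (a + d) * ((p1 * q2 - q1 * p2) * D)"
    if "P = p1 * a + q1 * c" "Q = p1 * b + q1 * d" "P' = p2 * a + q2 * c" "Q' = p2 * b + q2 * d" for P Q P' Q' D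
    unfolding that by (simp add: algebra_simps)
  have W: "wronskian f g z = (\<alpha> * \<delta> - \<beta> * \<gamma>) * wronskian u1 u2 z"
    if "f z = \<alpha> * u1 z + \<beta> * u2 z" "deriv f z = \<alpha> * deriv u1 z + \<beta> * deriv u2 z"
      "g z = \<gamma> * u1 z + \<delta> * u2 z" "deriv g z = \<gamma> * deriv u1 z + \<delta> * deriv u2 z" for f g \<alpha> \<beta> \<gamma> \<delta>
    unfolding wronskian_def that by (rule comb)
  show "wronskian (slash M v1) v2 z + wronskian v1 (slash M v2) z = (a + d) * wronskian v1 v2 z"
    unfolding W[OF sl(1)[OF p1] sl(3)[OF p1] p2[rule_format, OF z] sl(2)[OF p2]]
      W[OF p1[rule_format, OF z] sl(2)[OF p1] sl(1)[OF p2] sl(3)[OF p2]] W[OF p1[rule_format, OF z] sl(2)[OF p1] p2[rule_format, OF z] sl(2)[OF p2]]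
    by (rule fin) (rule refl)+
qed

text \<open>The slash action preserves the Wronskian, so that the other eigenvalue is \<open>1 / l\<close>.\<close>

lemma is_mtrace_eigenvalue:
  assumes M: "hp_aut M" and au: "automorphic M \<phi>" and ho: "\<phi> holomorphic_on HP" and t: "is_mtrace \<phi> M \<tau>"
    and v: "is_sol \<phi> v" "z0 \<in> HP" "v z0 \<noteq> 0 \<or> deriv v z0 \<noteq> 0"
    and ev: "\<And>z. z \<in> HP \<Longrightarrow> slash M v z = l * v z"
  shows "l \<noteq> 0" "\<tau> = l + 1 / l"
proof -
  obtain w where w: "is_sol \<phi> w" "wronskian v w z0 \<noteq> 0"
  proof (cases "v z0 = 0")
    case True
    obtain w where "is_sol \<phi> w" "w z0 = 1" "deriv w z0 = 0" using is_sol_exists[OF ho v(2), of 1 0] by blast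
    then show ?thesis using that[of w] v(3) True by (simp add: wronskian_def)
  next
    case False
    obtain w where "is_sol \<phi> w" "w z0 = 0" "deriv w z0 = 1" using is_sol_exists[OF ho v(2), of 0 1] by blast
    then show ?thesis using that[of w] False by (simp add: wronskian_def)
  qed
  have dv: "deriv (slash M v) z0 = l * deriv v z0"
    using deriv_cong_HP[OF ev v(2)] is_sol_deriv_cmult[OF v(1) v(2)] by simp
  have wz: "wronskian v w (mob M z0) = wronskian v w z0"
    by (rule wronskian_constant[OF v(1) w(1)]) (use M v(2) in \<open>auto simp: hp_aut_def\<close>)
  have lw: "wronskian (slash M v) g z0 = l * wronskian v g z0" for g
    by (simp add: wronskian_def dv ev[OF v(2)] algebra_simps)
  have 1: "l * wronskian v (slash M w) z0 = wronskian v w z0"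
    using wronskian_slash[OF M au v(1) w(1) v(2)] wz lw[of "slash M w"] by simp
  then show l: "l \<noteq> 0" using w by auto
  have "wronskian (slash M v) w z0 + wronskian v (slash M w) z0 = \<tau> * wronskian v w z0"
    using t v w unfolding is_mtrace_def by blast
  then have 2: "l * wronskian v w z0 + wronskian v (slash M w) z0 = \<tau> * wronskian v w z0" by (simp only: lw)
  have "(l * l + 1) * wronskian v w z0 = l * (l * wronskian v w z0 + wronskian v (slash M w) z0)"
    by (simp add: algebra_simps 1)
  also have "\<dots> = (\<tau> * l) * wronskian v w z0" unfolding 2 by simp
  finally have "(l * l + 1) * wronskian v w z0 = (\<tau> * l) * wronskian v w z0" .
  then have "l * l + 1 = \<tau> * l" using w by simp
  then show "\<tau> = l + 1 / l" using l by (simp add: field_simps)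
qed

text \<open>The diagonal entries of the monodromy matrix in the basis with the standard initial values.\<close>

lemma is_mtrace_formula:
  assumes M: "hp_aut M" and t: "is_mtrace \<phi> M \<tau>" and z: "z0 \<in> HP"
    and u: "is_sol \<phi> u1" "u1 z0 = 1" "deriv u1 z0 = 0" "is_sol \<phi> u2" "u2 z0 = 0" "deriv u2 z0 = 1"
  shows "\<tau> = slash M u1 z0 + deriv (slash M u2) z0"
proof -
  have "wronskian (slash M u2) u1 z0 + wronskian u2 (slash M u1) z0 = \<tau> * wronskian u2 u1 z0"
    using t u z unfolding is_mtrace_def by blast
  then have "deriv (slash M u2) z0 + slash M u1 z0 = \<tau>" using u by (simp add: wronskian_def)
  then show ?thesis by (metis add.commute)
qed

section \<open>Developing maps as ratios of solutions\<close>

lemma cpt_eq_scale: "k \<noteq> 0 \<Longrightarrow> cpt (k * a) (k * b) = cpt a b"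
  by (auto simp: cpt_def)

lemma moebius_cpt:
  assumes "det M \<noteq> 0" "(a, b) \<noteq> (0, 0)"
  shows "moebius M (cpt a b) = cpt (mA M * a + mB M * b) (mC M * a + mD M * b)"
proof (cases "b = 0")
  case True
  then show ?thesis using assms by (auto simp: cpt_def)
next
  case False
  then have "mC M * (a / b) + mD M = (mC M * a + mD M * b) / b" "mA M * (a / b) + mB M = (mA M * a + mB M * b) / b"
    by (auto simp: field_simps)
  then show ?thesis using False by (auto simp: cpt_def)
qed

text \<open>The classical substitution: \<open>s = (f')\<^sup>-\<^sup>1\<^sup>/\<^sup>2\<close> and \<open>f s\<close> both solve the equation, and have Wronskian
  one.\<close>

lemma schwarzian_sqrt_solution:
  assumes S: "open S" "convex S" and f: "f holomorphic_on S" and nz: "\<And>z. z \<in> S \<Longrightarrow> deriv f z \<noteq> 0"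
    and sch: "\<And>z. z \<in> S \<Longrightarrow> schwarzian f z = \<phi> z"
  shows "\<exists>s s' t'. \<forall>z\<in>S. s z \<noteq> 0 \<and> (s has_field_derivative s' z) (at z) \<and>
      (s' has_field_derivative - (\<phi> z / 2) * s z) (at z) \<and>
      ((\<lambda>z. f z * s z) has_field_derivative t' z) (at z) \<and>
      (t' has_field_derivative - (\<phi> z / 2) * (f z * s z)) (at z) \<and>
      t' z * s z - (f z * s z) * s' z = 1"
proof -
  have df: "deriv f holomorphic_on S" "deriv (deriv f) holomorphic_on S"
    by (intro holomorphic_deriv f S)+
  have "(\<lambda>z. inverse (deriv f z)) holomorphic_on S" using df nz f S by (intro holomorphic_intros) auto
  then obtain s where s: "s holomorphic_on S" "\<And>z. z \<in> S \<Longrightarrow> inverse (deriv f z) = (s z)^2"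
    by (rule contractible_imp_holomorphic_sqrt[OF _ convex_imp_contractible[OF S(2)]]) (use nz in simp, rule that)
  have s2: "(s z)^2 * deriv f z = 1" if "z \<in> S" for z
    using s(2)[OF that, symmetric] nz[OF that] by simp
  have s0: "s z \<noteq> 0" if "z \<in> S" for z using s2[OF that] by auto
  have D: "(g has_field_derivative deriv g z) (at z)" if "g holomorphic_on S" "z \<in> S" for g z
    using that S holomorphic_derivI by blast
  define L where "L = (\<lambda>z. deriv (deriv f) z / deriv f z)"
  have Lh: "L holomorphic_on S" unfolding L_def using df nz f S by (intro holomorphic_intros) auto
  define s' where "s' = (\<lambda>z. - s z * L z / 2)"
  have ds: "(s has_field_derivative s' z) (at z)" if z: "z \<in> S" for z
  proof -
    have "((\<lambda>z. (s z)^2 * deriv f z) has_field_derivative 2 * s z * deriv s z * deriv f z + (s z)^2 * deriv (deriv f) z) (at z)"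
      using D[OF s(1) z] D[OF df(1) z] by (auto intro!: derivative_eq_intros)
    moreover have "((\<lambda>z. (s z)^2 * deriv f z) has_field_derivative 0) (at z)"
      by (rule has_field_derivative_transform_within_open[OF DERIV_const S(1) z, of 1]) (simp add: s2)
    ultimately have "2 * s z * deriv s z * deriv f z + (s z)^2 * deriv (deriv f) z = 0" by (rule DERIV_unique)
    then have "s z * (2 * deriv s z * deriv f z + s z * deriv (deriv f) z) = 0" by (simp add: power2_eq_square algebra_simps)
    then have "2 * deriv s z * deriv f z + s z * deriv (deriv f) z = 0" using s0[OF z] by simp
    then have "2 * deriv s z * deriv f z = - s z * deriv (deriv f) z" by (simp add: add_eq_0_iff2)
    then have "deriv s z = s' z" unfolding s'_def L_def using nz[OF z] by (simp add: field_simps)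
    then show ?thesis using D[OF s(1) z] by simp
  qed
  have sc: "deriv L z = \<phi> z + (L z)^2 / 2" if "z \<in> S" for z
  proof -
    have "deriv L z - (1 / 2) * (L z)^2 = \<phi> z" using sch[OF that] unfolding schwarzian_def L_def .
    then show ?thesis by (simp add: algebra_simps)
  qed
  have ds': "(s' has_field_derivative - (\<phi> z / 2) * s z) (at z)" if z: "z \<in> S" for z
    unfolding s'_def[abs_def]
    by (rule DERIV_cong[OF DERIV_cdivide[OF DERIV_mult[OF DERIV_minus[OF ds[OF z]] D[OF Lh z]]]])
       (simp add: sc[OF z] s'_def field_simps power2_eq_square)
  define t' where "t' = (\<lambda>z. deriv f z * s z + f z * s' z)"
  have dt: "((\<lambda>z. f z * s z) has_field_derivative t' z) (at z)" if z: "z \<in> S" for z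
    by (rule DERIV_cong[OF DERIV_mult[OF D[OF f z] ds[OF z]]]) (simp add: t'_def algebra_simps)
  have dt': "(t' has_field_derivative - (\<phi> z / 2) * (f z * s z)) (at z)" if z: "z \<in> S" for z
    unfolding t'_def[abs_def]
    by (rule DERIV_cong[OF DERIV_add[OF DERIV_mult[OF D[OF df(1) z] ds[OF z]] DERIV_mult[OF D[OF f z] ds'[OF z]]]])
       (use nz[OF z] in \<open>simp add: s'_def L_def field_simps\<close>)
  have "t' z * s z - (f z * s z) * s' z = 1" if "z \<in> S" for z
    using s2[OF that] by (simp add: t'_def power2_eq_square algebra_simps)
  then show ?thesis using s0 ds ds' dt dt' by (intro exI[of _ s] exI[of _ s'] exI[of _ t']) auto
qed

text \<open>This transfers the equation to the points at which only the coordinate \<open>1 / w\<close> of the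
  projective line is available.\<close>

lemma schwarzian_inverse:
  assumes S: "open S" and g: "g holomorphic_on S" and nz: "\<And>z. z \<in> S \<Longrightarrow> deriv g z \<noteq> 0" "\<And>z. z \<in> S \<Longrightarrow> g z \<noteq> 0"
    and z: "z \<in> S"
  shows "schwarzian (\<lambda>z. inverse (g z)) z = schwarzian g z"
proof -
  have dg: "deriv g holomorphic_on S" "deriv (deriv g) holomorphic_on S"
    by (intro holomorphic_deriv g S)+
  have D: "(h has_field_derivative deriv h z) (at z)" if "h holomorphic_on S" "z \<in> S" for h z
    using that S holomorphic_derivI by blast
  have tr: "(h has_field_derivative d) (at w)" if "(k has_field_derivative d) (at w)" "\<And>z. z \<in> S \<Longrightarrow> h z = k z" "w \<in> S" for h k d w
    by (rule has_field_derivative_transform_within_open[OF that(1) S that(3)]) (use that in auto)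
  let ?f = "\<lambda>z. inverse (g z)"
  have 1: "deriv ?f z = - deriv g z / (g z)^2" if "z \<in> S" for z
    by (rule DERIV_imp_deriv, rule DERIV_cong[OF DERIV_inverse_fun[OF D[OF g that] nz(2)[OF that]]])
       (use nz(2)[OF that] in \<open>simp add: field_simps power2_eq_square\<close>)
  have 2: "deriv (deriv ?f) z = - deriv (deriv g) z / (g z)^2 + 2 * (deriv g z)^2 / (g z)^3" if "z \<in> S" for z
  proof (rule DERIV_imp_deriv, rule tr[OF _ 1 that])
    show "((\<lambda>z. - deriv g z / (g z)^2) has_field_derivative - deriv (deriv g) z / (g z)^2 + 2 * (deriv g z)^2 / (g z)^3) (at z)"
      using D[OF g that] D[OF dg(1) that] nz(2)[OF that]
      by (auto intro!: derivative_eq_intros simp: field_simps power2_eq_square power3_eq_cube)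
  qed
  have 3: "deriv (deriv ?f) z / deriv ?f z = deriv (deriv g) z / deriv g z - 2 * deriv g z / g z" if "z \<in> S" for z
    unfolding 1[OF that] 2[OF that] using nz[OF that] by (simp add: field_simps power2_eq_square power3_eq_cube)
  define L where "L = (\<lambda>z. deriv (deriv g) z / deriv g z)"
  have Lh: "L holomorphic_on S" unfolding L_def using dg nz g S by (intro holomorphic_intros) auto
  have "deriv (\<lambda>z. deriv (deriv ?f) z / deriv ?f z) z = deriv L z - 2 * (deriv (deriv g) z / g z - (deriv g z)^2 / (g z)^2)"
  proof (rule DERIV_imp_deriv, rule tr[OF _ 3 z])
    show "((\<lambda>z. deriv (deriv g) z / deriv g z - 2 * deriv g z / g z) has_field_derivative
       deriv L z - 2 * (deriv (deriv g) z / g z - (deriv g z)^2 / (g z)^2)) (at z)"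
      unfolding L_def
      by (rule DERIV_cong[OF DERIV_diff[OF D[OF Lh z, unfolded L_def] DERIV_divide[OF DERIV_cmult[OF D[OF dg(1) z]] D[OF g z] nz(2)[OF z]]]])
         (use nz(2)[OF z] in \<open>simp add: field_simps power2_eq_square\<close>)
  qed
  then have e: "deriv (\<lambda>z. deriv (deriv ?f) z / deriv ?f z) z = deriv L z - 2 * (L z * (deriv g z / g z) - (deriv g z / g z)^2)"
    using nz[OF z] by (simp add: L_def field_simps)
  have aux: "P - 2 * (l * a - a^2) - 1 / 2 * (l - 2 * a)^2 = P - 1 / 2 * l^2" for P l a :: complex
    by (simp add: power2_eq_square algebra_simps)
  have l3: "deriv (deriv ?f) z / deriv ?f z = L z - 2 * (deriv g z / g z)" using 3[OF z] by (simp add: L_def)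
  have "schwarzian (\<lambda>z. inverse (g z)) z = deriv L z - 1 / 2 * (L z)^2"
    unfolding schwarzian_def e l3 by (rule aux)
  then show ?thesis by (simp add: schwarzian_def L_def)
qed

text \<open>In a disc without poles the substitution above applies to \<open>F\<close>, and in a disc without zeros to
  \<open>1 / F\<close>; in the latter case the two solutions are exchanged.\<close>

lemma developing_local_ratio:
  assumes ho: "\<phi> holomorphic_on HP" and F: "cp1_holomorphic_on F HP" "locally_injective_on F HP"
    and sch: "\<And>z. z \<in> HP \<Longrightarrow> cp1_schwarzian F z = \<phi> z" and z0: "z0 \<in> HP"
  shows "\<exists>v1 v2 r. is_sol \<phi> v1 \<and> is_sol \<phi> v2 \<and> (\<forall>z\<in>HP. wronskian v1 v2 z = 1) \<and> r > 0 \<and> ball z0 r \<subseteq> HP \<and>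
     (\<forall>z\<in>ball z0 r. F z = cpt (v1 z) (v2 z))"
proof -
  obtain U where U: "open U" "z0 \<in> U" "Infty \<notin> F ` U \<and> (coord0 \<circ> F) holomorphic_on U \<or>
         Fin 0 \<notin> F ` U \<and> (coord1 \<circ> F) holomorphic_on U" using F(1) z0 unfolding cp1_holomorphic_on_def by blast
  obtain V where V: "open V" "z0 \<in> V" "inj_on F V" using F(2) z0 unfolding locally_injective_on_def by blast
  have "open (U \<inter> V \<inter> HP)" using U V open_HP by auto
  then obtain r where r: "r > 0" "ball z0 r \<subseteq> U \<inter> V \<inter> HP" using U V z0 open_contains_ball by blast
  let ?B = "ball z0 r"
  have B: "open ?B" "convex ?B" "?B \<subseteq> HP" "?B \<noteq> {}" using r by auto
  obtain u1 where u1: "is_sol \<phi> u1" "u1 z0 = 0" "deriv u1 z0 = 1" using is_sol_exists[OF ho z0] by blast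
  obtain u2 where u2: "is_sol \<phi> u2" "u2 z0 = 1" "deriv u2 z0 = 0" using is_sol_exists[OF ho z0] by blast
  have w12: "wronskian u1 u2 z = 1" if "z \<in> HP" for z
    using wronskian_constant[OF u1(1) u2(1) that z0] u1 u2 by (simp add: wronskian_def)
  \<comment> \<open>Solutions on the disc extend to the half-plane, being combinations of global solutions.\<close>
  have ext: "\<exists>v1 v2. is_sol \<phi> v1 \<and> is_sol \<phi> v2 \<and> (\<forall>z\<in>HP. wronskian v1 v2 z = 1) \<and> (\<forall>z\<in>?B. v1 z = w1 z \<and> v2 z = w2 z)"
    if w: "\<And>z. z\<in>?B \<Longrightarrow> (w1 has_field_derivative w1' z) (at z)" "\<And>z. z\<in>?B \<Longrightarrow> (w1' has_field_derivative - (\<phi> z / 2) * w1 z) (at z)"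
     "\<And>z. z\<in>?B \<Longrightarrow> (w2 has_field_derivative w2' z) (at z)" "\<And>z. z\<in>?B \<Longrightarrow> (w2' has_field_derivative - (\<phi> z / 2) * w2 z) (at z)"
     "\<And>z. z\<in>?B \<Longrightarrow> w1' z * w2 z - w1 z * w2' z = 1" for w1 w2 w1' w2'
  proof -
    obtain a b where ab: "\<forall>z\<in>?B. w1 z = a * u1 z + b * u2 z" using sol_in_basis_local[OF B u1(1) u2(1) w12 w(1,2)] by blast
    obtain c d where cd: "\<forall>z\<in>?B. w2 z = c * u1 z + d * u2 z" using sol_in_basis_local[OF B u1(1) u2(1) w12 w(3,4)] by blast
    let ?v1 = "\<lambda>z. a * u1 z + b * u2 z" and ?v2 = "\<lambda>z. c * u1 z + d * u2 z"
    have v: "is_sol \<phi> ?v1" "is_sol \<phi> ?v2" using is_sol_lincomb u1 u2 by auto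
    have z0B: "z0 \<in> ?B" using r by auto
    have "deriv ?v1 z0 = w1' z0" "deriv ?v2 z0 = w2' z0"
      by (rule DERIV_imp_deriv, rule has_field_derivative_transform_within_open[OF _ B(1) z0B], rule w, use z0B ab cd in auto)+
    then have "wronskian ?v1 ?v2 z0 = 1" using w(5)[OF z0B] ab cd z0B by (simp add: wronskian_def)
    then have W1: "wronskian ?v1 ?v2 z = 1" if "z \<in> HP" for z
      by (rule trans[OF wronskian_constant[OF v that z0]])
    then have "\<forall>z\<in>HP. wronskian ?v1 ?v2 z = 1" by blast
    then show ?thesis using v ab cd by (intro exI[of _ ?v1] exI[of _ ?v2]) auto
  qed
  have hol: "h holomorphic_on ?B" if "h holomorphic_on U" for h :: "complex \<Rightarrow> complex"
    using that r holomorphic_on_subset by blast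
  have inj: "inj_on F ?B" using V(3) r by (meson inf.boundedE inj_on_subset)
  from U(3) show ?thesis
  proof
    assume A: "Infty \<notin> F ` U \<and> (coord0 \<circ> F) holomorphic_on U"
    let ?f = "coord0 \<circ> F"
    have Ff: "F z = Fin (?f z)" if "z \<in> ?B" for z
      using A that r by (cases "F z") force+
    have fh: "?f holomorphic_on ?B" using A hol by blast
    have "inj_on ?f ?B" using inj Ff unfolding inj_on_def by metis
    then have nz: "deriv ?f z \<noteq> 0" if "z \<in> ?B" for z using holomorphic_injective_imp_regular[OF fh B(1)] that by blast
    have "schwarzian ?f z = \<phi> z" if "z \<in> ?B" for z
    proof -
      have "F z \<noteq> Infty" by (subst Ff[OF that]) simp
      then show ?thesis using sch[of z] that B(3) by (auto simp: cp1_schwarzian_def)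
    qed
    from schwarzian_sqrt_solution[OF B(1,2) fh nz this]
    obtain s s' t' where s: "\<forall>z\<in>?B. s z \<noteq> 0 \<and> (s has_field_derivative s' z) (at z) \<and>
      (s' has_field_derivative - (\<phi> z / 2) * s z) (at z) \<and>
      ((\<lambda>z. ?f z * s z) has_field_derivative t' z) (at z) \<and>
      (t' has_field_derivative - (\<phi> z / 2) * (?f z * s z)) (at z) \<and>
      t' z * s z - (?f z * s z) * s' z = 1" by blast
    have s1: "s z \<noteq> 0" "(s has_field_derivative s' z) (at z)" "(s' has_field_derivative - (\<phi> z / 2) * s z) (at z)"
        "((\<lambda>z. ?f z * s z) has_field_derivative t' z) (at z)" "(t' has_field_derivative - (\<phi> z / 2) * (?f z * s z)) (at z)"
        "t' z * s z - (?f z * s z) * s' z = 1" if "z \<in> ?B" for z using s[rule_format, OF that] by simp_all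
    obtain v1 v2 where v: "is_sol \<phi> v1" "is_sol \<phi> v2" "\<forall>z\<in>HP. wronskian v1 v2 z = 1" "\<forall>z\<in>?B. v1 z = ?f z * s z \<and> v2 z = s z"
      using ext[of "\<lambda>z. ?f z * s z" t' s s', OF s1(4,5,2,3,6)] by blast
    have "F z = cpt (v1 z) (v2 z)" if "z \<in> ?B" for z
    proof -
      have "cpt (v1 z) (v2 z) = Fin (?f z)" using v(4) s1(1)[OF that] that by (simp add: cpt_def)
      then show ?thesis by (rule trans[OF Ff[OF that] sym])
    qed
    then show ?thesis using v r by (intro exI[of _ v1] exI[of _ v2] exI[of _ r]) auto
  next
    assume A: "Fin 0 \<notin> F ` U \<and> (coord1 \<circ> F) holomorphic_on U"
    let ?f = "coord1 \<circ> F"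
    have Ff: "F z = (if ?f z = 0 then Infty else Fin (1 / ?f z))" if "z \<in> ?B" for z
    proof (cases "F z")
      case (Fin w)
      moreover have "w \<noteq> 0"
      proof
        assume "w = 0"
        then have "Fin 0 \<in> F ` U" using Fin that r by (intro image_eqI[of _ _ z]) auto
        then show False using A by blast
      qed
      ultimately show ?thesis by (simp add: field_simps)
    qed simp
    have FI: "F z = Infty \<longleftrightarrow> ?f z = 0" if "z \<in> ?B" for z
      by (subst Ff[OF that]) simp
    have fh: "?f holomorphic_on ?B" using A hol by blast
    have "inj_on ?f ?B" using inj Ff unfolding inj_on_def by metis
    then have nz: "deriv ?f z \<noteq> 0" if "z \<in> ?B" for z using holomorphic_injective_imp_regular[OF fh B(1)] that by blast
    have c01: "coord0 \<circ> F = (\<lambda>z. inverse (?f z))"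
    proof
      fix z show "(coord0 \<circ> F) z = inverse (?f z)" by (cases "F z") auto
    qed
    have "schwarzian ?f z = \<phi> z" if z: "z \<in> ?B" for z
    proof (cases "?f z = 0")
      case True
      then show ?thesis using sch[of z] z B(3) FI[OF z] by (auto simp: cp1_schwarzian_def)
    next
      case False
      let ?S = "{z \<in> ?B. ?f z \<in> - {0}}"
      have S: "open ?S"
        using continuous_open_preimage[OF holomorphic_on_imp_continuous_on[OF fh] B(1) open_Compl[OF closed_singleton], of 0]
        by (simp add: vimage_def Int_def)
      have gS: "?f holomorphic_on ?S" by (rule holomorphic_on_subset[OF fh]) blast
      have "schwarzian (\<lambda>z. inverse (?f z)) z = schwarzian ?f z"
        using nz False z by (intro schwarzian_inverse[OF S gS]) blast+
      moreover have "cp1_schwarzian F z = schwarzian (\<lambda>z. inverse (?f z)) z"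
        unfolding cp1_schwarzian_def c01 using FI[OF z] False by simp
      ultimately show ?thesis using sch[OF subsetD[OF B(3) z]] by simp
    qed
    from schwarzian_sqrt_solution[OF B(1,2) fh nz this]
    obtain s s' t' where s: "\<forall>z\<in>?B. s z \<noteq> 0 \<and> (s has_field_derivative s' z) (at z) \<and>
      (s' has_field_derivative - (\<phi> z / 2) * s z) (at z) \<and>
      ((\<lambda>z. ?f z * s z) has_field_derivative t' z) (at z) \<and>
      (t' has_field_derivative - (\<phi> z / 2) * (?f z * s z)) (at z) \<and>
      t' z * s z - (?f z * s z) * s' z = 1" by blast
    have s1: "s z \<noteq> 0" "(s has_field_derivative s' z) (at z)" "(s' has_field_derivative - (\<phi> z / 2) * s z) (at z)"
        "((\<lambda>z. ?f z * s z) has_field_derivative t' z) (at z)" "(t' has_field_derivative - (\<phi> z / 2) * (?f z * s z)) (at z)"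
        "t' z * s z - (?f z * s z) * s' z = 1" if "z \<in> ?B" for z using s[rule_format, OF that] by simp_all
    \<comment> \<open>Exchanging the solutions changes the sign of the Wronskian, and the factor \<open>\<i>\<close> on both restores it.\<close>
    have i: "((\<lambda>z. \<i> * h z) has_field_derivative \<i> * d) (at z)" if "(h has_field_derivative d) (at z)" for h d z
      using that by (rule DERIV_cmult)
    have W: "\<i> * s' z * (\<i> * (?f z * s z)) - \<i> * s z * (\<i> * t' z) = 1" if "z \<in> ?B" for z
    proof -
      have ii: "\<i> * a * (\<i> * b) = - (a * b)" for a b
      proof -
        have "\<i> * a * (\<i> * b) = (\<i> * \<i>) * (a * b)" by (simp only: mult_ac)
        then show ?thesis by simp
      qed
      have "\<i> * s' z * (\<i> * (?f z * s z)) - \<i> * s z * (\<i> * t' z) = t' z * s z - (?f z * s z) * s' z"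
        unfolding ii by (simp add: mult_ac)
      then show ?thesis using s1(6)[OF that] by simp
    qed
    have i2: "(h has_field_derivative - (\<phi> z / 2) * (\<i> * w)) (at z)" if "(h has_field_derivative \<i> * (- (\<phi> z / 2) * w)) (at z)" for h w z
      by (rule DERIV_cong[OF that]) simp
    obtain v1 v2 where v: "is_sol \<phi> v1" "is_sol \<phi> v2" "\<forall>z\<in>HP. wronskian v1 v2 z = 1"
        "\<forall>z\<in>?B. v1 z = \<i> * s z \<and> v2 z = \<i> * (?f z * s z)"
      using ext[of "\<lambda>z. \<i> * s z" "\<lambda>z. \<i> * s' z" "\<lambda>z. \<i> * (?f z * s z)" "\<lambda>z. \<i> * t' z", OF i[OF s1(2)] i2[OF i[OF s1(3)]] i[OF s1(4)] i2[OF i[OF s1(5)]] W] by blast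
    have "F z = cpt (v1 z) (v2 z)" if "z \<in> ?B" for z
    proof -
      have "cpt (v1 z) (v2 z) = (if ?f z = 0 then Infty else Fin (1 / ?f z))"
        using v(4) s1(1)[OF that] that by (simp add: cpt_def)
      then show ?thesis by (rule trans[OF Ff[OF that] sym])
    qed
    then show ?thesis using v r by (intro exI[of _ v1] exI[of _ v2] exI[of _ r]) auto
  qed
qed

text \<open>Globally the pair of solutions is unique up to sign, so the local representations continue
  along the connected half-plane.\<close>

lemma developing_global_ratio:
  assumes ho: "\<phi> holomorphic_on HP" and F: "cp1_holomorphic_on F HP" "locally_injective_on F HP"
    and sch: "\<And>z. z \<in> HP \<Longrightarrow> cp1_schwarzian F z = \<phi> z"
  shows "\<exists>v1 v2. is_sol \<phi> v1 \<and> is_sol \<phi> v2 \<and> (\<forall>z\<in>HP. wronskian v1 v2 z = 1) \<and>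
     (\<forall>z\<in>HP. F z = cpt (v1 z) (v2 z))"
proof -
  have loc: "\<exists>v1 v2 r. is_sol \<phi> v1 \<and> is_sol \<phi> v2 \<and> (\<forall>z\<in>HP. wronskian v1 v2 z = 1) \<and> r > 0 \<and> ball z0 r \<subseteq> HP \<and>
     (\<forall>z\<in>ball z0 r. F z = cpt (v1 z) (v2 z))" if "z0 \<in> HP" for z0
    by (rule developing_local_ratio[OF ho F _ that]) (rule sch)
  have iHP: "\<i> \<in> HP" by (simp add: upper_half_plane_def)
  obtain v1 v2 r where v: "is_sol \<phi> v1" "is_sol \<phi> v2" "\<forall>z\<in>HP. wronskian v1 v2 z = 1" "r > 0" "ball \<i> r \<subseteq> HP"
     "\<forall>z\<in>ball \<i> r. F z = cpt (v1 z) (v2 z)" using loc[OF iHP] by blast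
  define G where "G = (\<lambda>z. cpt (v1 z) (v2 z))"
  define A where "A = {z \<in> HP. \<exists>r>0. \<forall>w\<in>ball z r. F w = G w}"
  have oA: "open A"
  proof (rule openI)
    fix z assume "z \<in> A"
    then obtain r where r: "r > 0" "\<forall>w\<in>ball z r. F w = G w" "z \<in> HP" unfolding A_def by blast
    obtain e where e: "e > 0" "ball z e \<subseteq> HP" using r(3) open_HP open_contains_ball by blast
    have "ball z (min r e) \<subseteq> A"
    proof
      fix w assume w: "w \<in> ball z (min r e)"
      then obtain d where "d > 0" "ball w d \<subseteq> ball z (min r e)" using open_contains_ball[of "ball z (min r e)"] open_ball by blast
      moreover have "ball z (min r e) \<subseteq> ball z r" by auto
      ultimately have "\<forall>x\<in>ball w d. F x = G x" using r by blast
      moreover have "w \<in> HP" using w e by auto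
      ultimately show "w \<in> A" using \<open>d > 0\<close> unfolding A_def by blast
    qed
    then show "\<exists>e>0. ball z e \<subseteq> A" using r e by (intro exI[of _ "min r e"]) auto
  qed
  have oC: "open (HP - A)"
  proof (rule openI)
    fix z assume "z \<in> HP - A"
    then have z: "z \<in> HP" "z \<notin> A" by auto
    obtain w1 w2 d where w: "is_sol \<phi> w1" "is_sol \<phi> w2" "\<forall>z\<in>HP. wronskian w1 w2 z = 1" "d > 0" "ball z d \<subseteq> HP"
      "\<forall>x\<in>ball z d. F x = cpt (w1 x) (w2 x)" using loc[OF z(1)] by blast
    have "x \<notin> A" if x: "x \<in> ball z d" for x
    proof
      assume "x \<in> A"
      then obtain e where e: "e > 0" "\<forall>w\<in>ball x e. F w = G w" unfolding A_def by blast
      let ?U = "ball x e \<inter> ball z d"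
      have "\<exists>k. k^2 = 1 \<and> (\<forall>z\<in>HP. v1 z = k * w1 z \<and> v2 z = k * w2 z)"
      proof (rule same_ratio[OF v(1,2) _ w(1,2), where U = ?U and ?z0.0 = x])
        show "cpt (v1 y) (v2 y) = cpt (w1 y) (w2 y)" if "y \<in> ?U" for y
          using that e(2) w(6) unfolding G_def by (metis IntE)
      qed (use v(3) w x e in auto)
      then obtain k where k: "k^2 = 1" "\<forall>z\<in>HP. v1 z = k * w1 z \<and> v2 z = k * w2 z" by blast
      then have "k \<noteq> 0" by auto
      then have "F y = G y" if "y \<in> ball z d" for y
      proof -
        have y: "y \<in> HP" using that w(5) by blast
        show ?thesis using w(6)[rule_format, OF that] k(2)[rule_format, OF y] cpt_eq_scale[OF \<open>k \<noteq> 0\<close>]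
          by (simp add: G_def)
      qed
      then have "z \<in> A" using w(4) z(1) unfolding A_def by blast
      then show False using z by blast
    qed
    then show "\<exists>e>0. ball z e \<subseteq> HP - A" using w(4,5) by (intro exI[of _ d]) blast
  qed
  have "\<i> \<in> A" using v iHP unfolding A_def G_def by blast
  moreover have "A \<subseteq> HP" unfolding A_def by blast
  ultimately have "HP = A" using connectedD[OF connected_HP oA oC] iHP by blast
  then have "F z = G z" if "z \<in> HP" for z using that unfolding A_def by force
  then show ?thesis using v unfolding G_def by blast
qed

text \<open>With \<open>F = v1 / v2\<close>, the pairs obtained from \<open>(v1, v2)\<close> by the slash action and by the matrix \<open>R\<close> have the
  same ratio and Wronskian one, so that they differ by a sign.\<close>

lemma holonomy_trace:
  assumes ho: "\<phi> holomorphic_on HP" and F: "cp1_holomorphic_on F HP" "locally_injective_on F HP"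
    and sch: "\<And>z. z \<in> HP \<Longrightarrow> cp1_schwarzian F z = \<phi> z"
    and M: "hp_aut M" "automorphic M \<phi>" and R: "det R = 1" "\<And>z. z \<in> HP \<Longrightarrow> F (mob M z) = moebius R (F z)"
  shows "\<exists>\<tau>. is_mtrace \<phi> M \<tau> \<and> cmod \<tau> = cmod (trace R)"
proof -
  have g: "\<exists>v1 v2. is_sol \<phi> v1 \<and> is_sol \<phi> v2 \<and> (\<forall>z\<in>HP. wronskian v1 v2 z = 1) \<and>
     (\<forall>z\<in>HP. F z = cpt (v1 z) (v2 z))" by (rule developing_global_ratio[OF ho F]) (rule sch)
  obtain v1 v2 where v: "is_sol \<phi> v1" "is_sol \<phi> v2" "\<forall>z\<in>HP. wronskian v1 v2 z = 1"
     "\<forall>z\<in>HP. F z = cpt (v1 z) (v2 z)" using g by blast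
  let ?x = "\<lambda>z. mA R * v1 z + mB R * v2 z" and ?y = "\<lambda>z. mC R * v1 z + mD R * v2 z"
  have iHP: "\<i> \<in> HP" by (simp add: upper_half_plane_def)
  have xy: "is_sol \<phi> ?x" "is_sol \<phi> ?y" using is_sol_lincomb v by auto
  have dR: "mA R * mD R - mB R * mC R = 1" using R(1) by (simp add: det_eq)
  have wxy: "wronskian ?x ?y z = 1" if "z \<in> HP" for z
  proof -
    have "wronskian ?x ?y z = (mA R * mD R - mB R * mC R) * wronskian v1 v2 z"
      unfolding wronskian_def is_sol_lincomb(2)[OF v(1,2) that] by (simp add: algebra_simps)
    then show ?thesis using dR v that by simp
  qed
  have ws: "wronskian (slash M v1) (slash M v2) z = 1" if "z \<in> HP" for z
    using wronskian_slash[OF M v(1,2) that] v(3) M(1) that by (auto simp: hp_aut_def)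
  have eq: "cpt (slash M v1 z) (slash M v2 z) = cpt (?x z) (?y z)" if z: "z \<in> HP" for z
  proof -
    have j: "jf M z \<noteq> 0" "mob M z \<in> HP" using M z by (auto simp: hp_aut_def)
    have "(v1 z, v2 z) \<noteq> (0, 0)" using v(3) z by (auto simp: wronskian_def)
    then have "moebius R (cpt (v1 z) (v2 z)) = cpt (?x z) (?y z)" by (intro moebius_cpt) (simp add: R(1))
    then have "moebius R (F z) = cpt (?x z) (?y z)" using v(4) z by metis
    moreover have "F (mob M z) = cpt (slash M v1 z) (slash M v2 z)"
      unfolding slash_def using v(4) j(2) cpt_eq_scale[OF j(1)] by metis
    ultimately show ?thesis using R(2)[OF z] by simp
  qed
  have "\<exists>k. k^2 = 1 \<and> (\<forall>z\<in>HP. slash M v1 z = k * ?x z \<and> slash M v2 z = k * ?y z)"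
    by (rule same_ratio[OF slash_sol(1)[OF M v(1)] slash_sol(1)[OF M v(2)] ws xy wxy open_HP order_refl iHP eq])
  then obtain k where k: "k^2 = 1" "\<forall>z\<in>HP. slash M v1 z = k * ?x z \<and> slash M v2 z = k * ?y z" by blast
  have "is_mtrace \<phi> M (k * mA R + k * mD R)"
    by (rule is_mtrace_basis[OF M v(1,2), where b = "k * mB R" and c = "k * mC R"])
       (use v(3) k in \<open>auto simp: algebra_simps\<close>)
  moreover have "cmod (k * mA R + k * mD R) = cmod (trace R)"
  proof -
    have "cmod k ^ 2 = 1" using k(1) by (metis norm_one norm_power)
    then have "cmod k = 1" using power2_eq_1_iff[of "cmod k"] norm_ge_zero[of k] by linarith
    moreover have "k * mA R + k * mD R = k * trace R" by (simp add: trace_def sum_2 algebra_simps)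
    ultimately show ?thesis by (simp add: norm_mult)
  qed
  ultimately show ?thesis by blast
qed

section \<open>Growth of solutions along WKB paths\<close>

text \<open>Put \<open>P = \<bar>x\<bar>\<^sup>2\<close> and \<open>Q = \<bar>y\<bar>\<^sup>2\<close>. The perturbations are so small that \<open>Q - k P\<close> is nonincreasing for
  every \<open>k\<close> between \<open>1/8\<close> and \<open>1\<close>. With \<open>k = 1\<close> the solution stays in the cone \<open>Q \<le> P\<close>; there the
  perturbation of \<open>x\<close> costs at most half of the growth rate \<open>2 \<kappa>\<close> of \<open>P\<close>. Since \<open>\<kappa> \<ge> 3\<close>, \<open>P\<close> grows by a
  factor of at least \<open>7\<close>, and \<open>k = 1/8\<close> then yields \<open>Q \<le> P / 8 + 7/8 P(0) \<le> P / 4\<close> at the end.\<close>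

lemma cone_flow:
  fixes x y :: "real \<Rightarrow> complex"
  assumes x: "\<And>s. 0 \<le> s \<Longrightarrow> s \<le> 1 \<Longrightarrow> (x has_vector_derivative a s * x s + f s) (at s)"
    and y: "\<And>s. 0 \<le> s \<Longrightarrow> s \<le> 1 \<Longrightarrow> (y has_vector_derivative - (a s * y s) + g s) (at s)"
    and a: "\<And>s. 0 \<le> s \<Longrightarrow> s \<le> 1 \<Longrightarrow> \<kappa> \<le> Re (a s)"
    and f: "\<And>s. 0 \<le> s \<Longrightarrow> s \<le> 1 \<Longrightarrow> cmod (f s) \<le> \<kappa> / 16 * (cmod (x s) + cmod (y s))"
    and g: "\<And>s. 0 \<le> s \<Longrightarrow> s \<le> 1 \<Longrightarrow> cmod (g s) \<le> \<kappa> / 16 * (cmod (x s) + cmod (y s))"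
    and \<kappa>: "\<kappa> \<ge> 3" and start: "cmod (y 0) \<le> cmod (x 0)"
  shows "cmod (y 1) \<le> cmod (x 1) / 2" "exp (\<kappa> / 2) * cmod (x 0) \<le> cmod (x 1)"
proof -
  have der: "((\<lambda>s. h s \<bullet> h s) has_real_derivative 2 * (h s \<bullet> h')) (at s)"
    if "(h has_vector_derivative h') (at s)" for h :: "real \<Rightarrow> complex" and h' s
    using has_derivative_inner[OF that[unfolded has_vector_derivative_def] that[unfolded has_vector_derivative_def]]
    unfolding has_field_derivative_def
    by (rule has_derivative_eq_rhs) (auto simp: fun_eq_iff inner_commute)
  have ia: "u \<bullet> (c * u) = Re c * (cmod u)^2" for u c :: complex
    unfolding inner_complex_def cmod_power2 by (simp add: algebra_simps power2_eq_square)
  define P where "P = (\<lambda>s. (cmod (x s))^2)"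
  define Q where "Q = (\<lambda>s. (cmod (y s))^2)"
  have dP: "(P has_real_derivative 2 * (Re (a s) * P s + x s \<bullet> f s)) (at s)" if "0 \<le> s" "s \<le> 1" for s
    using der[OF x[OF that]] by (simp add: P_def inner_add_right ia dot_square_norm)
  have dQ: "(Q has_real_derivative 2 * (- (Re (a s) * Q s) + y s \<bullet> g s)) (at s)" if "0 \<le> s" "s \<le> 1" for s
    using der[OF y[OF that]] ia[of "y s" "a s"] by (simp add: Q_def inner_diff_right dot_square_norm algebra_simps)
  have PQ: "P s \<ge> 0" "Q s \<ge> 0" for s by (auto simp: P_def Q_def)
  have am: "2 * (cmod (x s) * cmod (y s)) \<le> P s + Q s" for s
    unfolding P_def Q_def using sum_squares_bound[of "cmod (x s)" "cmod (y s)"] by simp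
  have xf: "\<bar>x s \<bullet> f s\<bar> \<le> \<kappa> / 16 * (P s + cmod (x s) * cmod (y s))"
    and yg: "\<bar>y s \<bullet> g s\<bar> \<le> \<kappa> / 16 * (Q s + cmod (x s) * cmod (y s))" if s: "0 \<le> s" "s \<le> 1" for s
  proof -
    have "\<bar>x s \<bullet> f s\<bar> \<le> cmod (x s) * cmod (f s)" by (rule Cauchy_Schwarz_ineq2)
    also have "\<dots> \<le> cmod (x s) * (\<kappa> / 16 * (cmod (x s) + cmod (y s)))" by (intro mult_left_mono f s) auto
    finally show "\<bar>x s \<bullet> f s\<bar> \<le> \<kappa> / 16 * (P s + cmod (x s) * cmod (y s))"
      by (simp add: P_def power2_eq_square algebra_simps)
    have "\<bar>y s \<bullet> g s\<bar> \<le> cmod (y s) * cmod (g s)" by (rule Cauchy_Schwarz_ineq2)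
    also have "\<dots> \<le> cmod (y s) * (\<kappa> / 16 * (cmod (x s) + cmod (y s)))" by (intro mult_left_mono g s) auto
    finally show "\<bar>y s \<bullet> g s\<bar> \<le> \<kappa> / 16 * (Q s + cmod (x s) * cmod (y s))"
      by (simp add: Q_def power2_eq_square algebra_simps)
  qed
  have dec: "Q s - k * P s \<le> Q 0 - k * P 0" if k: "1 / 8 \<le> k" "k \<le> 1" and s: "0 \<le> s" "s \<le> 1" for k s
  proof (rule DERIV_nonpos_imp_nonincreasing[OF s(1)])
    fix r assume r: "0 \<le> r" "r \<le> s"
    then have r1: "r \<le> 1" using s by simp
    let ?d = "2 * (- (Re (a r) * Q r) + y r \<bullet> g r) - k * (2 * (Re (a r) * P r + x r \<bullet> f r))"
    have "((\<lambda>s. Q s - k * P s) has_real_derivative ?d) (at r)"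
      by (intro DERIV_diff DERIV_cmult dP dQ r r1)
    moreover have "?d \<le> 0"
    proof -
      have 1: "\<kappa> * Q r \<le> Re (a r) * Q r" "\<kappa> * P r \<le> Re (a r) * P r" using a[OF r(1) r1] PQ by (auto intro!: mult_right_mono)
      let ?m = "cmod (x r) * cmod (y r)"
      have "y r \<bullet> g r - k * (x r \<bullet> f r) \<le> \<kappa> / 16 * (Q r + ?m) + k * (\<kappa> / 16 * (P r + ?m))"
      proof -
        have "k * \<bar>x r \<bullet> f r\<bar> \<le> k * (\<kappa> / 16 * (P r + ?m))" using k xf[OF r(1) r1] by (intro mult_left_mono) auto
        moreover have "- (k * (x r \<bullet> f r)) \<le> k * \<bar>x r \<bullet> f r\<bar>"
          using k mult_left_mono[of "- (x r \<bullet> f r)" "\<bar>x r \<bullet> f r\<bar>" k] by simp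
        ultimately show ?thesis using yg[OF r(1) r1] by linarith
      qed
      also have "\<dots> = \<kappa> * ((Q r + k * P r + (1 + k) * ?m) / 16)" by (simp add: algebra_simps)
      also have "\<dots> \<le> \<kappa> * (Q r + k * P r)"
      proof (rule mult_left_mono)
        have "(1 + k) * ?m \<le> 2 * ?m" using k by (intro mult_right_mono) auto
        moreover have "1/8 * P r \<le> k * P r" using k PQ by (intro mult_right_mono) auto
        ultimately show "(Q r + k * P r + (1 + k) * ?m) / 16 \<le> Q r + k * P r" using am[of r] PQ[of r] by argo
      qed (use \<kappa> in simp)
      finally have 2: "y r \<bullet> g r - k * (x r \<bullet> f r) \<le> \<kappa> * (Q r + k * P r)" .
      have "k * (\<kappa> * P r) \<le> k * (Re (a r) * P r)" using 1 k by (intro mult_left_mono) auto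
      then have 3: "\<kappa> * (Q r + k * P r) \<le> Re (a r) * Q r + k * (Re (a r) * P r)" using 1 by (simp add: algebra_simps)
      have "?d = 2 * ((y r \<bullet> g r - k * (x r \<bullet> f r)) - (Re (a r) * Q r + k * (Re (a r) * P r)))" by (simp add: algebra_simps)
      moreover have "y r \<bullet> g r - k * (x r \<bullet> f r) \<le> Re (a r) * Q r + k * (Re (a r) * P r)"
        using 2 3 by (rule order_trans)
      ultimately show ?thesis by simp
    qed
    ultimately show "\<exists>d. ((\<lambda>s. Q s - k * P s) has_real_derivative d) (at r) \<and> d \<le> 0" by blast
  qed
  have QP0: "Q 0 \<le> P 0" unfolding P_def Q_def using start by (intro power_mono) auto
  have QP: "Q s \<le> P s" if "0 \<le> s" "s \<le> 1" for s using dec[of 1 s] that QP0 by simp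
  have yx: "cmod (y s) \<le> cmod (x s)" if "0 \<le> s" "s \<le> 1" for s
    using QP[OF that] unfolding P_def Q_def by (rule power2_le_imp_le) simp
  have "(\<lambda>s. exp (- \<kappa> * s) * P s) 0 \<le> (\<lambda>s. exp (- \<kappa> * s) * P s) 1"
  proof (rule DERIV_nonneg_imp_nondecreasing[OF zero_le_one])
    fix s :: real assume s: "0 \<le> s" "s \<le> 1"
    let ?d = "exp (- \<kappa> * s) * (2 * (Re (a s) * P s + x s \<bullet> f s)) + (- \<kappa> * exp (- \<kappa> * s)) * P s"
    have "((\<lambda>s. exp (- \<kappa> * s) * P s) has_real_derivative ?d) (at s)"
      by (rule DERIV_cong[OF DERIV_mult[OF _ dP[OF s]]], (rule derivative_eq_intros refl)+) (simp add: algebra_simps)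
    moreover have "0 \<le> ?d"
    proof -
      have 1: "\<kappa> * P s \<le> Re (a s) * P s" using a[OF s] PQ by (intro mult_right_mono) auto
      have "cmod (x s) * cmod (y s) \<le> P s" using yx[OF s] mult_left_mono[of "cmod (y s)" "cmod (x s)" "cmod (x s)"]
        by (simp add: P_def power2_eq_square)
      then have "\<kappa> / 16 * (P s + cmod (x s) * cmod (y s)) \<le> \<kappa> / 16 * (2 * P s)" using \<kappa> by (intro mult_left_mono) auto
      then have "- (x s \<bullet> f s) \<le> \<kappa> * P s / 8" using xf[OF s] by simp
      moreover have "0 \<le> \<kappa> * P s" using \<kappa> PQ by simp
      ultimately have "0 \<le> 2 * (Re (a s) * P s + x s \<bullet> f s) - \<kappa> * P s" using 1 by argo
      then have "0 \<le> exp (- \<kappa> * s) * (2 * (Re (a s) * P s + x s \<bullet> f s) - \<kappa> * P s)" by simp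
      then show ?thesis by (simp only: algebra_simps)
    qed
    ultimately show "\<exists>d. ((\<lambda>s. exp (- \<kappa> * s) * P s) has_real_derivative d) (at s) \<and> d \<ge> 0" by blast
  qed
  then have g1: "exp \<kappa> * P 0 \<le> P 1" by (simp add: exp_minus field_simps)
  have "(exp (\<kappa> / 2) * cmod (x 0))^2 = exp \<kappa> * P 0"
    by (simp add: P_def power_mult_distrib flip: exp_double)
  then have "(exp (\<kappa> / 2) * cmod (x 0))^2 \<le> (cmod (x 1))^2" using g1 by (simp only: P_def)
  then show "exp (\<kappa> / 2) * cmod (x 0) \<le> cmod (x 1)" by (rule power2_le_imp_le) simp
  have "7 * P 0 \<le> exp \<kappa> * P 0"
  proof (intro mult_right_mono PQ)
    have "(7::real) \<le> 1 + 3 + 3^2 / 2" by simp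
    also have "\<dots> \<le> exp 3" by (rule exp_lower_Taylor_quadratic) simp
    also have "\<dots> \<le> exp \<kappa>" using \<kappa> by simp
    finally show "7 \<le> exp \<kappa>" .
  qed
  then have "7 * P 0 \<le> P 1" using g1 by linarith
  moreover have "Q 1 - 1/8 * P 1 \<le> Q 0 - 1/8 * P 0" using dec[of "1/8" 1] by simp
  ultimately have "Q 1 \<le> P 1 / 4" using QP0 by linarith
  then have "(cmod (y 1))^2 \<le> (cmod (x 1) / 2)^2" unfolding P_def Q_def by (simp add: power_divide)
  then show "cmod (y 1) \<le> cmod (x 1) / 2" by (rule power2_le_imp_le) simp
qed

text \<open>The endpoints carry the value of the chosen root of \<open>- q / 2\<close>; the root is continued along the path.
  The condition on the real part says that the WKB solution \<open>exp (t \<integral> W dz)\<close> grows along the path.\<close>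

definition wkb_path :: "(complex \<Rightarrow> complex) \<Rightarrow> complex \<times> complex \<Rightarrow> complex \<times> complex \<Rightarrow> bool" where
  "wkb_path q p p' \<longleftrightarrow> (\<exists>g g' W W'. (g 0, W 0) = p \<and> (g 1, W 1) = p' \<and>
     continuous_on {0..1} g' \<and> continuous_on {0..1} W' \<and>
     (\<forall>s::real\<in>{0..1}. g s \<in> HP \<and> (g has_vector_derivative g' s) (at s) \<and> (W has_vector_derivative W' s) (at s) \<and>
        (W s)^2 = - q (g s) / 2 \<and> W s \<noteq> 0 \<and> Re (W s * g' s) > 0))"

text \<open>For \<open>p = (z, W)\<close> these are the components of the solution in the growing and in the decaying direction
  of the leading term of the equation at \<open>z\<close>.\<close>

definition wX :: "real \<Rightarrow> complex \<times> complex \<Rightarrow> (complex \<Rightarrow> complex) \<Rightarrow> complex" where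
  "wX t p u = deriv u (fst p) + of_real t * snd p * u (fst p)"
definition wY :: "real \<Rightarrow> complex \<times> complex \<Rightarrow> (complex \<Rightarrow> complex) \<Rightarrow> complex" where
  "wY t p u = deriv u (fst p) - of_real t * snd p * u (fst p)"

locale wkb_seq =
  fixes \<phi> :: "nat \<Rightarrow> complex \<Rightarrow> complex" and t :: "nat \<Rightarrow> real" and q :: "complex \<Rightarrow> complex"
    and \<G> :: "(complex^2^2) set"
  assumes hol: "\<And>n. \<phi> n holomorphic_on HP" and qhol: "q holomorphic_on HP"
    and tpos: "\<And>n. t n > 0" and tlim: "filterlim t at_top sequentially"
    and lim: "\<And>K. compact K \<Longrightarrow> K \<subseteq> HP \<Longrightarrow> uniform_limit K (\<lambda>n z. \<phi> n z / of_real ((t n)^2)) q sequentially"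
    and aut: "\<And>M. M \<in> \<G> \<Longrightarrow> hp_aut M" "\<And>M n. M \<in> \<G> \<Longrightarrow> automorphic M (\<phi> n)"
    and mult: "\<And>M N. M \<in> \<G> \<Longrightarrow> N \<in> \<G> \<Longrightarrow> M ** N \<in> \<G>"
    and inv: "\<And>M. M \<in> \<G> \<Longrightarrow> \<exists>N\<in>\<G>. M ** N = mat 1 \<and> N ** M = mat 1"
begin

text \<open>In the components \<open>x = u' + t W u\<close> and \<open>y = u' - t W u\<close> the leading term of the equation is diagonal with
  entries \<open>\<plusminus> t W g'\<close>. The remaining terms are multiples of \<open>u = (x - y) / (2 t W)\<close>: one with the factor \<open>t W'\<close>,
  which after this division is of order one, and one with the factor \<open>\<phi> n - t\<^sup>2 q\<close>, which is
  small compared with \<open>t\<close>.\<close>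

lemma path_expands:
  assumes "wkb_path q p p'"
  shows "\<exists>c>0. \<forall>\<^sub>F n in sequentially. \<forall>u. is_sol (\<phi> n) u \<longrightarrow> cmod (wY (t n) p u) \<le> cmod (wX (t n) p u) \<longrightarrow>
     cmod (wY (t n) p' u) \<le> cmod (wX (t n) p' u) / 2 \<and> exp (c * t n) * cmod (wX (t n) p u) \<le> cmod (wX (t n) p' u)"
proof -
  obtain g g' W W' where ends: "(g 0, W 0) = p" "(g 1, W 1) = p'" and cg': "continuous_on {0..1} g'"
    and cW': "continuous_on {0..1} W'"
    and pt: "\<And>s. 0 \<le> s \<Longrightarrow> s \<le> (1::real) \<Longrightarrow> g s \<in> HP" "\<And>s. 0 \<le> s \<Longrightarrow> s \<le> 1 \<Longrightarrow> (g has_vector_derivative g' s) (at s)"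
      "\<And>s. 0 \<le> s \<Longrightarrow> s \<le> 1 \<Longrightarrow> (W has_vector_derivative W' s) (at s)" "\<And>s. 0 \<le> s \<Longrightarrow> s \<le> 1 \<Longrightarrow> (W s)^2 = - q (g s) / 2"
      "\<And>s. 0 \<le> s \<Longrightarrow> s \<le> 1 \<Longrightarrow> W s \<noteq> 0" "\<And>s. 0 \<le> s \<Longrightarrow> s \<le> 1 \<Longrightarrow> Re (W s * g' s) > 0"
    using assms unfolding wkb_path_def by auto
  have cg: "continuous_on {0..1} g" and cW: "continuous_on {0..1} W"
    by (intro continuous_at_imp_continuous_on ballI, rule has_vector_derivative_continuous, use pt(2,3) in force)+
  have cR: "continuous_on {0..1} (\<lambda>s. Re (W s * g' s))" by (intro continuous_intros cW cg')
  have ne: "{0..1::real} \<noteq> {}" by simp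
  obtain s0 where s0: "s0 \<in> {0..1}" "\<And>s. s \<in> {0..1} \<Longrightarrow> Re (W s0 * g' s0) \<le> Re (W s * g' s)"
    using continuous_attains_inf[OF compact_Icc ne cR] by blast
  define m where "m = Re (W s0 * g' s0)"
  have m: "m > 0" "\<And>s. 0 \<le> s \<Longrightarrow> s \<le> 1 \<Longrightarrow> m \<le> Re (W s * g' s)" using s0 pt(6) by (auto simp: m_def)
  have bd: "\<exists>L>0. \<forall>s\<in>{0..1}. cmod (h s) \<le> L" if "continuous_on {0..1::real} h" for h
    using compact_imp_bounded[OF compact_continuous_image[OF that compact_Icc]] by (auto simp: bounded_pos)
  obtain L where L: "L > 0" "\<And>s. 0 \<le> s \<Longrightarrow> s \<le> 1 \<Longrightarrow> cmod (g' s) \<le> L" using bd[OF cg'] by auto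
  obtain W1 where W1: "W1 > 0" "\<And>s. 0 \<le> s \<Longrightarrow> s \<le> 1 \<Longrightarrow> cmod (W' s) \<le> W1" using bd[OF cW'] by auto
  obtain s1 where s1: "s1 \<in> {0..1}" "\<And>s. s \<in> {0..1} \<Longrightarrow> cmod (W s1) \<le> cmod (W s)"
    using continuous_attains_inf[OF compact_Icc ne continuous_on_norm[OF cW]] by blast
  define w0 where "w0 = cmod (W s1)"
  have w0: "w0 > 0" "\<And>s. 0 \<le> s \<Longrightarrow> s \<le> 1 \<Longrightarrow> w0 \<le> cmod (W s)" using s1 pt(5) by (auto simp: w0_def)
  define K where "K = g ` {0..1}"
  have K: "compact K" "K \<subseteq> HP" unfolding K_def using cg pt(1) by (auto intro!: compact_continuous_image)
  \<comment> \<open>With this \<open>\<delta>\<close> the deviation of \<open>\<phi> n\<close> from \<open>t\<^sup>2 q\<close> uses up half of the perturbation admitted by the cone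
    estimate; the other half is left for the term with \<open>W'\<close>.\<close>
  define \<delta> where "\<delta> = m * w0 / (8 * L)"
  have \<delta>: "\<delta> > 0" using m w0 L by (simp add: \<delta>_def)
  have ev1: "\<forall>\<^sub>F n in sequentially. \<forall>z\<in>K. cmod (\<phi> n z / of_real ((t n)^2) - q z) < \<delta>"
    using uniform_limitD[OF lim[OF K] \<delta>] by (simp add: dist_norm)
  have ev2: "\<forall>\<^sub>F n in sequentially. max (16 * W1 / (w0 * m)) (3 / m) \<le> t n"
    using tlim unfolding filterlim_at_top by blast
  have "\<forall>\<^sub>F n in sequentially. \<forall>u. is_sol (\<phi> n) u \<longrightarrow> cmod (wY (t n) p u) \<le> cmod (wX (t n) p u) \<longrightarrow>
     cmod (wY (t n) p' u) \<le> cmod (wX (t n) p' u) / 2 \<and> exp (m / 2 * t n) * cmod (wX (t n) p u) \<le> cmod (wX (t n) p' u)"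
    using ev1 ev2
  proof eventually_elim
    case (elim n)
    show ?case
    proof (intro allI impI)
      fix u assume u: "is_sol (\<phi> n) u" and start: "cmod (wY (t n) p u) \<le> cmod (wX (t n) p u)"
      let ?t = "complex_of_real (t n)"
      define x where "x = (\<lambda>s. deriv u (g s) + ?t * W s * u (g s))"
      define y where "y = (\<lambda>s. deriv u (g s) - ?t * W s * u (g s))"
      define a where "a = (\<lambda>s. ?t * (W s * g' s))"
      define e where "e = (\<lambda>s. (?t^2 * q (g s) - \<phi> n (g s)) / 2 * g' s)"
      have xy: "u (g s) = (x s - y s) / (2 * ?t * W s)" if "0 \<le> s" "s \<le> 1" for s
        using pt(5)[OF that] tpos[of n] by (simp add: x_def y_def field_simps)
      have du: "((\<lambda>s. u (g s)) has_vector_derivative g' s * deriv u (g s)) (at s)"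
        "((\<lambda>s. deriv u (g s)) has_vector_derivative g' s * (- (\<phi> n (g s) / 2) * u (g s))) (at s)" if "0 \<le> s" "s \<le> 1" for s
        using field_vector_diff_chain_at[OF pt(2)[OF that] is_solD(1)[OF u pt(1)[OF that]]]
          field_vector_diff_chain_at[OF pt(2)[OF that] is_solD(2)[OF u pt(1)[OF that]]] by (simp_all add: o_def)
      have W2: "?t^2 * (W s)^2 = - (?t^2 * q (g s)) / 2" if "0 \<le> s" "s \<le> 1" for s
        using pt(4)[OF that] by simp
      have dx: "(x has_vector_derivative a s * x s + (?t * W' s + e s) * u (g s)) (at s)" if "0 \<le> s" "s \<le> 1" for s
      proof -
        have "a s * x s = ?t * W s * g' s * deriv u (g s) + (?t^2 * (W s)^2) * g' s * u (g s)"
          by (simp add: a_def x_def algebra_simps power2_eq_square)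
        also have "\<dots> = ?t * W s * g' s * deriv u (g s) - (?t^2 * q (g s)) / 2 * g' s * u (g s)"
          unfolding W2[OF that] by simp
        finally have A: "a s * x s = ?t * W s * g' s * deriv u (g s) - (?t^2 * q (g s)) / 2 * g' s * u (g s)" .
        have "(x has_vector_derivative g' s * (- (\<phi> n (g s) / 2) * u (g s)) +
           (?t * W s * (g' s * deriv u (g s)) + ?t * W' s * u (g s))) (at s)"
          unfolding x_def
          by (intro has_vector_derivative_add has_vector_derivative_mult has_vector_derivative_mult_right du that pt)
        moreover have "g' s * (- (\<phi> n (g s) / 2) * u (g s)) + (?t * W s * (g' s * deriv u (g s)) + ?t * W' s * u (g s))
           = a s * x s + (?t * W' s + e s) * u (g s)"
          unfolding A e_def by (simp add: algebra_simps add_divide_distrib diff_divide_distrib)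
        ultimately show ?thesis by simp
      qed
      have dy: "(y has_vector_derivative - (a s * y s) + (- (?t * W' s) + e s) * u (g s)) (at s)" if "0 \<le> s" "s \<le> 1" for s
      proof -
        have "a s * y s = ?t * W s * g' s * deriv u (g s) - (?t^2 * (W s)^2) * g' s * u (g s)"
          by (simp add: a_def y_def algebra_simps power2_eq_square)
        also have "\<dots> = ?t * W s * g' s * deriv u (g s) + (?t^2 * q (g s)) / 2 * g' s * u (g s)"
          unfolding W2[OF that] by simp
        finally have A: "a s * y s = ?t * W s * g' s * deriv u (g s) + (?t^2 * q (g s)) / 2 * g' s * u (g s)" .
        have "(y has_vector_derivative g' s * (- (\<phi> n (g s) / 2) * u (g s)) -
           (?t * W s * (g' s * deriv u (g s)) + ?t * W' s * u (g s))) (at s)"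
          unfolding y_def
          by (intro has_vector_derivative_diff has_vector_derivative_mult has_vector_derivative_mult_right du that pt)
        moreover have "g' s * (- (\<phi> n (g s) / 2) * u (g s)) - (?t * W s * (g' s * deriv u (g s)) + ?t * W' s * u (g s))
           = - (a s * y s) + (- (?t * W' s) + e s) * u (g s)"
          unfolding A e_def by (simp add: algebra_simps add_divide_distrib diff_divide_distrib)
        ultimately show ?thesis by simp
      qed
      have ra: "m * t n \<le> Re (a s)" if "0 \<le> s" "s \<le> 1" for s
        using mult_right_mono[OF m(2)[OF that], of "t n"] tpos[of n] by (simp add: a_def algebra_simps)
      have ee: "cmod (b + e s) * cmod (u (g s)) \<le> m * t n / 16 * (cmod (x s) + cmod (y s))"
        if s: "0 \<le> s" "s \<le> 1" and b: "cmod b \<le> t n * W1" for s b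
      proof -
        have "cmod (e s) \<le> (t n)^2 * \<delta> / 2 * L"
        proof -
          have "?t^2 * q (g s) - \<phi> n (g s) = - (of_real ((t n)^2) * (\<phi> n (g s) / of_real ((t n)^2) - q (g s)))"
            using tpos[of n] by (simp add: algebra_simps)
          then have "cmod (?t^2 * q (g s) - \<phi> n (g s)) = (t n)^2 * cmod (\<phi> n (g s) / of_real ((t n)^2) - q (g s))"
            by (simp only: norm_minus_cancel norm_mult norm_of_real) simp
          also have "\<dots> \<le> (t n)^2 * \<delta>"
            using elim(1) s tpos[of n] unfolding K_def by (intro mult_left_mono less_imp_le) auto
          finally show ?thesis unfolding e_def norm_mult norm_divide using L(2)[OF s] \<delta>
            by (intro mult_mono divide_right_mono) auto
        qed
        then have 1: "cmod (b + e s) \<le> t n * W1 + (t n)^2 * \<delta> / 2 * L" using b norm_triangle_ineq[of b "e s"] by linarith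
        have "cmod (u (g s)) = cmod (x s - y s) / (2 * t n * cmod (W s))"
          unfolding xy[OF s] using tpos[of n] by (simp add: norm_divide norm_mult)
        also have "\<dots> \<le> (cmod (x s) + cmod (y s)) / (2 * t n * w0)"
          using w0(1) w0(2)[OF s] tpos[of n] by (intro frac_le norm_triangle_ineq4 mult_left_mono mult_pos_pos) auto
        finally have 2: "cmod (u (g s)) \<le> (cmod (x s) + cmod (y s)) / (2 * t n * w0)" .
        have "cmod (b + e s) * cmod (u (g s)) \<le> (t n * W1 + (t n)^2 * \<delta> / 2 * L) * ((cmod (x s) + cmod (y s)) / (2 * t n * w0))"
          using 1 2 tpos[of n] W1 \<delta> L by (intro mult_mono) auto
        also have "\<dots> = (W1 / (2 * w0) + m * t n / 32) * (cmod (x s) + cmod (y s))"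
          using tpos[of n] w0(1) L(1) by (simp add: \<delta>_def field_simps power2_eq_square)
        also have "\<dots> \<le> (m * t n / 16) * (cmod (x s) + cmod (y s))"
        proof (rule mult_right_mono)
          have "16 * W1 / (w0 * m) \<le> t n" using elim(2) by simp
          then have "16 * W1 \<le> t n * w0 * m" using w0(1) m(1) by (simp add: field_simps)
          then show "W1 / (2 * w0) + m * t n / 32 \<le> m * t n / 16" using w0(1) by (simp add: field_simps)
        qed simp
        finally show ?thesis .
      qed
      have \<kappa>2: "3 \<le> m * t n" using elim(2) m(1) by (simp add: field_simps)
      have st: "cmod (y 0) \<le> cmod (x 0)" using start ends(1) by (auto simp: wX_def wY_def x_def y_def)
      have f1: "cmod ((?t * W' s + e s) * u (g s)) \<le> m * t n / 16 * (cmod (x s) + cmod (y s))" if "0 \<le> s" "s \<le> 1" for s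
        unfolding norm_mult[of _ "u (g s)"] using W1(2)[OF that] tpos[of n] by (intro ee that) (simp add: norm_mult)
      have f2: "cmod ((- (?t * W' s) + e s) * u (g s)) \<le> m * t n / 16 * (cmod (x s) + cmod (y s))" if "0 \<le> s" "s \<le> 1" for s
        unfolding norm_mult[of _ "u (g s)"] using W1(2)[OF that] tpos[of n] by (intro ee that) (simp add: norm_mult)
      note cf = cone_flow[where x = x and y = y and a = a and \<kappa> = "m * t n", OF dx dy ra f1 f2 \<kappa>2 st]
      have eX: "wX (t n) p u = x 0" "wX (t n) p' u = x 1" "wY (t n) p' u = y 1"
        using ends by (auto simp: wX_def wY_def x_def y_def)
      show "cmod (wY (t n) p' u) \<le> cmod (wX (t n) p' u) / 2 \<and> exp (m / 2 * t n) * cmod (wX (t n) p u) \<le> cmod (wX (t n) p' u)"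
        unfolding eX using cf by (simp add: algebra_simps)
    qed
  qed
  then show ?thesis using m(1) by (intro exI[of _ "m / 2"]) auto
qed

end

section \<open>Eigenvalues of expanding monodromy\<close>

lemma sol_unique:
  assumes ho: "\<phi> holomorphic_on HP" and u: "is_sol \<phi> u" "is_sol \<phi> v" and z0: "z0 \<in> HP"
    and eq: "u z0 = v z0" "deriv u z0 = deriv v z0" and z: "z \<in> HP"
  shows "u z = v z"
proof -
  obtain u1 where u1: "is_sol \<phi> u1" "u1 z0 = 0" "deriv u1 z0 = 1" using is_sol_exists[OF ho z0] by blast
  obtain u2 where u2: "is_sol \<phi> u2" "u2 z0 = 1" "deriv u2 z0 = 0" using is_sol_exists[OF ho z0] by blast
  have w12: "wronskian u1 u2 z = 1" if "z \<in> HP" for z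
    using wronskian_constant[OF u1(1) u2(1) that z0] u1 u2 by (simp add: wronskian_def)
  have rep: "w z = deriv w z0 * u1 z + w z0 * u2 z" if w: "is_sol \<phi> w" for w
  proof -
    obtain a b where ab: "\<forall>z\<in>HP. w z = a * u1 z + b * u2 z"
      using sol_in_basis[OF u1(1) u2(1) w12 w] by blast
    have "deriv w z0 = a * deriv u1 z0 + b * deriv u2 z0"
      using deriv_cong_HP[OF _ z0, of w "\<lambda>z. a * u1 z + b * u2 z"] is_sol_lincomb(2)[OF u1(1) u2(1) z0, of a b] ab by simp
    then have "a = deriv w z0" "b = w z0" using ab z0 u1 u2 by auto
    then show ?thesis using ab z by blast
  qed
  show ?thesis using rep[OF u(1)] rep[OF u(2)] eq by simp
qed

lemma wXY_cong:
  assumes "\<And>z. z \<in> HP \<Longrightarrow> u z = v z" "fst p \<in> HP"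
  shows "wX t p u = wX t p v" "wY t p u = wY t p v"
  using assms deriv_cong_HP[of u v "fst p"] by (auto simp: wX_def wY_def)

lemma wXY_lincomb:
  assumes "is_sol \<phi> u" "is_sol \<phi> v" "fst p \<in> HP"
  shows "wX t p (\<lambda>z. a * u z + b * v z) = a * wX t p u + b * wX t p v"
    "wY t p (\<lambda>z. a * u z + b * v z) = a * wY t p u + b * wY t p v"
  using is_sol_lincomb(2)[OF assms] by (simp_all add: wX_def wY_def algebra_simps)

text \<open>A linear self-map of the plane of solutions that maps the cone \<open>\<bar>Y\<bar> \<le> \<bar>X\<bar> / 2\<close> into itself and
  expands there has an eigenvector in it: Brouwer on the disc of the values of \<open>Y / X\<close>.\<close>

lemma slash_eigenvector:
  assumes ho: "\<phi> holomorphic_on HP" and M: "hp_aut M" "automorphic M \<phi>" and p: "fst p \<in> HP" "snd p \<noteq> 0" and t: "t > 0"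
    and cone: "\<And>u. is_sol \<phi> u \<Longrightarrow> cmod (wY t p u) \<le> cmod (wX t p u) / 2 \<Longrightarrow>
       cmod (wY t p (slash M u)) \<le> cmod (wX t p (slash M u)) / 2 \<and> \<Lambda> * cmod (wX t p u) \<le> cmod (wX t p (slash M u))"
    and \<Lambda>: "\<Lambda> > 0"
  shows "\<exists>v l. is_sol \<phi> v \<and> (v (fst p) \<noteq> 0 \<or> deriv v (fst p) \<noteq> 0) \<and> (\<forall>z\<in>HP. slash M v z = l * v z) \<and> cmod l \<ge> \<Lambda>"
proof -
  let ?z = "fst p" and ?c = "of_real t * snd p"
  have c: "?c \<noteq> 0" using p t by simp
  obtain u1 where u1: "is_sol \<phi> u1" "u1 ?z = 1 / (2 * ?c)" "deriv u1 ?z = 1 / 2" using is_sol_exists[OF ho p(1)] by blast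
  obtain u2 where u2: "is_sol \<phi> u2" "u2 ?z = - 1 / (2 * ?c)" "deriv u2 ?z = 1 / 2" using is_sol_exists[OF ho p(1)] by blast
  have XY: "wX t p u1 = 1" "wY t p u1 = 0" "wX t p u2 = 0" "wY t p u2 = 1"
    using c by (simp_all add: wX_def wY_def u1 u2)
  define v where "v = (\<lambda>y z. 1 * u1 z + y * u2 z)"
  have v: "is_sol \<phi> (v y)" for y unfolding v_def by (rule is_sol_lincomb(1)[OF u1(1) u2(1)])
  have vXY: "wX t p (v y) = 1" "wY t p (v y) = y" for y
    unfolding v_def wXY_lincomb[OF u1(1) u2(1) p(1)] by (simp_all add: XY)
  have sl: "slash M (v y) = (\<lambda>z. 1 * slash M u1 z + y * slash M u2 z)" for y
    by (simp add: v_def slash_def fun_eq_iff algebra_simps)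
  let ?X1 = "wX t p (slash M u1)" and ?X2 = "wX t p (slash M u2)" and ?Y1 = "wY t p (slash M u1)" and ?Y2 = "wY t p (slash M u2)"
  have sXY: "wX t p (slash M (v y)) = ?X1 + y * ?X2" "wY t p (slash M (v y)) = ?Y1 + y * ?Y2" for y
    unfolding sl wXY_lincomb[OF slash_sol(1)[OF M u1(1)] slash_sol(1)[OF M u2(1)] p(1)] by simp_all
  have cn: "cmod (?Y1 + y * ?Y2) \<le> cmod (?X1 + y * ?X2) / 2" "\<Lambda> \<le> cmod (?X1 + y * ?X2)" if "cmod y \<le> 1 / 2" for y
    using cone[OF v, of y] that unfolding vXY sXY by auto
  have nz: "?X1 + y * ?X2 \<noteq> 0" if "cmod y \<le> 1 / 2" for y using cn(2)[OF that] \<Lambda> by auto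
  let ?f = "\<lambda>y. (?Y1 + y * ?Y2) / (?X1 + y * ?X2)"
  have "continuous_on (cball 0 (1/2)) ?f" using nz by (intro continuous_intros) auto
  moreover have "?f \<in> cball 0 (1/2) \<rightarrow> cball 0 (1/2)"
    using cn(1) nz by (auto simp: norm_divide divide_le_eq)
  ultimately obtain y where y: "y \<in> cball 0 (1/2)" "?f y = y"
    using brouwer_ball[of "1/2" 0 ?f] by auto
  then have yn: "cmod y \<le> 1 / 2" by simp
  define l where "l = ?X1 + y * ?X2"
  have ly: "?Y1 + y * ?Y2 = l * y" using y(2) nz[OF yn] by (simp add: l_def field_simps)
  have lv: "is_sol \<phi> (\<lambda>z. l * v y z)" using is_sol_lincomb(1)[OF v v, of l y 0 y] by simp
  have X0: "deriv u ?z = (wX t p u + wY t p u) / 2" "u ?z = (wX t p u - wY t p u) / (2 * ?c)" for u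
    using c by (simp_all add: wX_def wY_def field_simps)
  have lX: "wX t p (\<lambda>z. l * v y z) = l" "wY t p (\<lambda>z. l * v y z) = l * y"
    using wXY_lincomb[OF v v p(1), of t l y 0 y] vXY by simp_all
  have "slash M (v y) z = l * v y z" if z: "z \<in> HP" for z
    by (rule sol_unique[OF ho slash_sol(1)[OF M v] lv p(1) _ _ z])
       (simp_all only: X0[of "slash M (v y)"] X0[of "\<lambda>z. l * v y z"] sXY lX ly flip: l_def)
  moreover have "v y ?z \<noteq> 0 \<or> deriv (v y) ?z \<noteq> 0"
  proof (rule ccontr)
    assume "\<not> ?thesis"
    then have "wX t p (v y) = 0" by (simp add: wX_def)
    then show False using vXY by simp
  qed
  moreover have "cmod l \<ge> \<Lambda>" using cn(2)[OF yn] by (simp add: l_def)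
  ultimately show ?thesis using v by blast
qed

context wkb_seq begin

text \<open>The narrower cone, with the factor \<open>1/2\<close>, is used at both ends: what a path gains by narrowing the
  cone pays for the next deck transformation.\<close>

definition expands :: "complex \<times> complex \<Rightarrow> complex \<times> complex \<Rightarrow> complex^2^2 \<Rightarrow> bool" where
  "expands p p' N \<longleftrightarrow> (\<exists>c>0. \<forall>\<^sub>F n in sequentially. \<forall>v. is_sol (\<phi> n) v \<longrightarrow> cmod (wY (t n) p v) \<le> cmod (wX (t n) p v) / 2 \<longrightarrow>
     cmod (wY (t n) p' (slash N v)) \<le> cmod (wX (t n) p' (slash N v)) / 2 \<and>
     exp (c * t n) * cmod (wX (t n) p v) \<le> cmod (wX (t n) p' (slash N v)))"

text \<open>Both steps expand, so that the rate of the second one is already a lower bound.\<close>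

lemma expands_trans:
  assumes "expands p p' N" "expands p' p'' N'" "N \<in> \<G>" "N' \<in> \<G>" "fst p'' \<in> HP"
  shows "expands p p'' (N ** N')"
proof -
  obtain c where c: "c > 0" and 1: "\<forall>\<^sub>F n in sequentially. \<forall>v. is_sol (\<phi> n) v \<longrightarrow> cmod (wY (t n) p v) \<le> cmod (wX (t n) p v) / 2 \<longrightarrow>
     cmod (wY (t n) p' (slash N v)) \<le> cmod (wX (t n) p' (slash N v)) / 2 \<and>
     exp (c * t n) * cmod (wX (t n) p v) \<le> cmod (wX (t n) p' (slash N v))"
    using assms(1) unfolding expands_def by blast
  obtain c' where c': "c' > 0" and 2: "\<forall>\<^sub>F n in sequentially. \<forall>v. is_sol (\<phi> n) v \<longrightarrow> cmod (wY (t n) p' v) \<le> cmod (wX (t n) p' v) / 2 \<longrightarrow>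
     cmod (wY (t n) p'' (slash N' v)) \<le> cmod (wX (t n) p'' (slash N' v)) / 2 \<and>
     exp (c' * t n) * cmod (wX (t n) p' v) \<le> cmod (wX (t n) p'' (slash N' v))"
    using assms(2) unfolding expands_def by blast
  have "\<forall>\<^sub>F n in sequentially. \<forall>v. is_sol (\<phi> n) v \<longrightarrow> cmod (wY (t n) p v) \<le> cmod (wX (t n) p v) / 2 \<longrightarrow>
     cmod (wY (t n) p'' (slash (N ** N') v)) \<le> cmod (wX (t n) p'' (slash (N ** N') v)) / 2 \<and>
     exp (c' * t n) * cmod (wX (t n) p v) \<le> cmod (wX (t n) p'' (slash (N ** N') v))"
    using 1 2
  proof eventually_elim
    case (elim n)
    show ?case
    proof (intro allI impI)
      fix v assume v: "is_sol (\<phi> n) v" "cmod (wY (t n) p v) \<le> cmod (wX (t n) p v) / 2"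
      have s: "slash N' (slash N v) z = slash (N ** N') v z" if "z \<in> HP" for z
        by (rule slash_slash(1)[OF aut(1)[OF assms(3)] aut(1)[OF assms(4)] that])
      have e: "wX (t n) p'' (slash N' (slash N v)) = wX (t n) p'' (slash (N ** N') v)"
        "wY (t n) p'' (slash N' (slash N v)) = wY (t n) p'' (slash (N ** N') v)"
        by (rule wXY_cong[OF s assms(5)]; assumption)+
      have a: "cmod (wY (t n) p' (slash N v)) \<le> cmod (wX (t n) p' (slash N v)) / 2"
          "exp (c * t n) * cmod (wX (t n) p v) \<le> cmod (wX (t n) p' (slash N v))"
        using elim(1) v by blast+
      have sl: "is_sol (\<phi> n) (slash N v)" by (rule slash_sol(1)[OF aut(1)[OF assms(3)] aut(2)[OF assms(3)] v(1)])
      have b: "cmod (wY (t n) p'' (slash N' (slash N v))) \<le> cmod (wX (t n) p'' (slash N' (slash N v))) / 2"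
          "exp (c' * t n) * cmod (wX (t n) p' (slash N v)) \<le> cmod (wX (t n) p'' (slash N' (slash N v)))"
        using elim(2) sl a(1) by blast+
      have "1 \<le> exp (c * t n)" using c tpos[of n] by simp
      then have "cmod (wX (t n) p v) \<le> cmod (wX (t n) p' (slash N v))"
        using a(2) mult_right_mono[of 1 "exp (c * t n)" "cmod (wX (t n) p v)"] by simp
      then have "exp (c' * t n) * cmod (wX (t n) p v) \<le> exp (c' * t n) * cmod (wX (t n) p' (slash N v))" by simp
      then show "cmod (wY (t n) p'' (slash (N ** N') v)) \<le> cmod (wX (t n) p'' (slash (N ** N') v)) / 2 \<and>
         exp (c' * t n) * cmod (wX (t n) p v) \<le> cmod (wX (t n) p'' (slash (N ** N') v))"
        using b unfolding e by linarith
    qed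
  qed
  then show ?thesis using c' unfolding expands_def by blast
qed

text \<open>The group element carries the start \<open>(z, \<omega>)\<close> to the start of the path, and the components at the two
  points agree up to the factor \<open>j\<close> and a common error of relative order \<open>1 / t\<close>. Hence the narrower cone is mapped into
  the cone of \<open>path_expands\<close>. Half of the rate absorbs the factor \<open>2 / \<bar>j\<bar>\<close>.\<close>

lemma path_after_jump_expands:
  assumes M: "M \<in> \<G>" and z: "z \<in> HP" and path: "wkb_path q (mob M z, \<omega> * (jf M z)^2) p'" and \<omega>: "\<omega> \<noteq> 0"
  shows "\<exists>N\<in>\<G>. expands (z, \<omega>) p' N"
proof -
  obtain N where N: "N \<in> \<G>" "M ** N = mat 1" "N ** M = mat 1" using inv[OF M] by blast
  note Ma = aut(1)[OF M] and Na = aut(1)[OF N(1)]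
  define j where "j = jf M z"
  have j: "j \<noteq> 0" "mob M z \<in> HP" using Ma z by (auto simp: hp_aut_def j_def)
  let ?p1 = "(mob M z, \<omega> * j^2)"
  have path': "wkb_path q ?p1 p'" using path by (simp add: j_def)
  obtain c where c: "c > 0" and pe: "\<forall>\<^sub>F n in sequentially. \<forall>u. is_sol (\<phi> n) u \<longrightarrow> cmod (wY (t n) ?p1 u) \<le> cmod (wX (t n) ?p1 u) \<longrightarrow>
     cmod (wY (t n) p' u) \<le> cmod (wX (t n) p' u) / 2 \<and> exp (c * t n) * cmod (wX (t n) ?p1 u) \<le> cmod (wX (t n) p' u)"
    using path_expands[OF path'] by blast
  define J where "J = 1 / cmod j"
  have J: "J > 0" using j by (simp add: J_def)
  define w where "w = cmod (\<omega> * j^2)"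
  have w: "w > 0" using \<omega> j by (simp add: w_def)
  \<comment> \<open>The first bound makes the error \<open>e\<close> below at most a sixth of the sum of the main terms, the second one
    absorbs the factor \<open>2 * J\<close>.\<close>
  have ev: "\<forall>\<^sub>F n in sequentially. max (3 * cmod (mC M) / (w * J)) (2 * ln (2 * J) / c) \<le> t n"
    using tlim unfolding filterlim_at_top by blast
  have "\<forall>\<^sub>F n in sequentially. \<forall>v. is_sol (\<phi> n) v \<longrightarrow> cmod (wY (t n) (z, \<omega>) v) \<le> cmod (wX (t n) (z, \<omega>) v) / 2 \<longrightarrow>
     cmod (wY (t n) p' (slash N v)) \<le> cmod (wX (t n) p' (slash N v)) / 2 \<and>
     exp (c / 2 * t n) * cmod (wX (t n) (z, \<omega>) v) \<le> cmod (wX (t n) p' (slash N v))"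
    using pe ev
  proof eventually_elim
    case (elim n)
    show ?case
    proof (intro allI impI)
      fix v assume v: "is_sol (\<phi> n) v" "cmod (wY (t n) (z, \<omega>) v) \<le> cmod (wX (t n) (z, \<omega>) v) / 2"
      define u where "u = slash N v"
      have u: "is_sol (\<phi> n) u" unfolding u_def by (rule slash_sol(1)[OF Na aut(2)[OF N(1)] v(1)])
      have vu: "v z = slash M u z" if "z \<in> HP" for z
        using slash_slash(1)[OF Na Ma that, of v] N(3) by (simp add: u_def slash_def jf_def mob_def mat_def)
      have dv: "deriv v z = mC M * u (mob M z) + deriv u (mob M z) / j"
        using deriv_cong_HP[OF vu z] slash_sol(2)[OF Ma aut(2)[OF M] u z] by (simp add: j_def)
      have vz: "v z = j * u (mob M z)" using vu[OF z] by (simp add: slash_def j_def)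
      let ?T = "complex_of_real (t n)"
      define X1 Y1 where "X1 = wX (t n) ?p1 u" and "Y1 = wY (t n) ?p1 u"
      define X Y where "X = wX (t n) (z, \<omega>) v" and "Y = wY (t n) (z, \<omega>) v"
      define e where "e = mC M * u (mob M z)"
      have Xe: "X = X1 / j + e" "Y = Y1 / j + e"
        using j(1) by (simp_all add: X_def Y_def X1_def Y1_def wX_def wY_def dv vz e_def field_simps power2_eq_square)
      have "u (mob M z) = (X1 - Y1) / (2 * ?T * (\<omega> * j^2))"
        using j(1) \<omega> tpos[of n] by (simp add: X1_def Y1_def wX_def wY_def field_simps)
      then have "cmod e = cmod (mC M) * cmod (X1 - Y1) / (2 * t n * w)"
        using tpos[of n] by (simp add: e_def norm_mult norm_divide w_def)
      also have "\<dots> \<le> cmod (mC M) * (cmod X1 + cmod Y1) / (2 * t n * w)"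
        using w tpos[of n] by (intro divide_right_mono mult_left_mono norm_triangle_ineq4) auto
      also have "\<dots> = (cmod (mC M) / (2 * t n * w)) * (cmod X1 + cmod Y1)" by simp
      also have "\<dots> \<le> (J / 6) * (cmod X1 + cmod Y1)"
      proof (rule mult_right_mono)
        have "3 * cmod (mC M) / (w * J) \<le> t n" using elim(2) by simp
        then show "cmod (mC M) / (2 * t n * w) \<le> J / 6" using w J tpos[of n] by (simp add: field_simps)
      qed simp
      finally have e0: "cmod e \<le> J / 6 * (cmod X1 + cmod Y1)" .
      define A B where "A = J * cmod X1" and "B = J * cmod Y1"
      have e: "cmod e \<le> (A + B) / 6" using e0 by (simp add: A_def B_def algebra_simps add_divide_distrib)
      have nX: "cmod (X1 / j) = A" "cmod (Y1 / j) = B" by (simp_all add: norm_divide J_def A_def B_def)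
      have b1: "cmod X \<le> A + cmod e" unfolding Xe nX(1)[symmetric] by (rule norm_triangle_ineq)
      have b2: "B \<le> cmod Y + cmod e" unfolding Xe nX(2)[symmetric]
        using norm_triangle_ineq4[of "Y1 / j + e" e] by simp
      have YX: "cmod Y \<le> cmod X / 2" using v(2) by (simp add: X_def Y_def)
      have BA: "B \<le> A" using e b1 b2 YX by argo
      then have c1: "cmod Y1 \<le> cmod X1" using J by (simp add: A_def B_def)
      have "0 \<le> A" using J by (simp add: A_def)
      then have "cmod X \<le> 2 * A" using BA e b1 by argo
      then have b3: "cmod X \<le> 2 * J * cmod X1" by (simp add: A_def)
      have fin: "cmod (wY (t n) p' u) \<le> cmod (wX (t n) p' u) / 2" "exp (c * t n) * cmod X1 \<le> cmod (wX (t n) p' u)"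
        using elim(1) u c1 unfolding X1_def Y1_def by blast+
      have "2 * ln (2 * J) / c \<le> t n" using elim(2) by simp
      then have "ln (2 * J) \<le> c / 2 * t n" using c by (simp add: field_simps)
      then have "exp (ln (2 * J)) \<le> exp (c / 2 * t n)" by (simp only: exp_le_cancel_iff)
      then have J2: "2 * J \<le> exp (c / 2 * t n)" using J by simp
      have "exp (c / 2 * t n) * cmod X \<le> exp (c / 2 * t n) * (exp (c / 2 * t n) * cmod X1)"
        using b3 mult_right_mono[OF J2, of "cmod X1"] by (intro mult_left_mono) auto
      also have "\<dots> = exp (c * t n) * cmod X1" by (simp add: mult.assoc[symmetric] exp_add[symmetric])
      finally show "cmod (wY (t n) p' (slash N v)) \<le> cmod (wX (t n) p' (slash N v)) / 2 \<and>
         exp (c / 2 * t n) * cmod (wX (t n) (z, \<omega>) v) \<le> cmod (wX (t n) p' (slash N v))"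
        using fin unfolding u_def[symmetric] X_def[symmetric] by linarith
    qed
  qed
  then have "expands (z, \<omega>) p' N" unfolding expands_def using c by (intro exI[of _ "c / 2"]) auto
  then show ?thesis using N(1) by blast
qed

text \<open>The trace is \<open>l + 1 / l\<close> for the large eigenvalue \<open>l\<close>.\<close>

lemma loop_trace_growth:
  assumes "expands p p N" "N \<in> \<G>" and p: "fst p \<in> HP" "snd p \<noteq> 0"
  shows "\<exists>c>0. \<forall>\<^sub>F n in sequentially. \<forall>\<tau>. is_mtrace (\<phi> n) N \<tau> \<longrightarrow> exp (c * t n) - 1 \<le> cmod \<tau>"
proof -
  obtain c where c: "c > 0" and 1: "\<forall>\<^sub>F n in sequentially. \<forall>v. is_sol (\<phi> n) v \<longrightarrow> cmod (wY (t n) p v) \<le> cmod (wX (t n) p v) / 2 \<longrightarrow>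
     cmod (wY (t n) p (slash N v)) \<le> cmod (wX (t n) p (slash N v)) / 2 \<and>
     exp (c * t n) * cmod (wX (t n) p v) \<le> cmod (wX (t n) p (slash N v))"
    using assms(1) unfolding expands_def by blast
  have "\<forall>\<^sub>F n in sequentially. \<forall>\<tau>. is_mtrace (\<phi> n) N \<tau> \<longrightarrow> exp (c * t n) - 1 \<le> cmod \<tau>"
    using 1
  proof eventually_elim
    case (elim n)
    have cone: "cmod (wY (t n) p (slash N u)) \<le> cmod (wX (t n) p (slash N u)) / 2 \<and>
       exp (c * t n) * cmod (wX (t n) p u) \<le> cmod (wX (t n) p (slash N u))"
      if "is_sol (\<phi> n) u" "cmod (wY (t n) p u) \<le> cmod (wX (t n) p u) / 2" for u using elim that by blast
    obtain v l where v: "is_sol (\<phi> n) v" "v (fst p) \<noteq> 0 \<or> deriv v (fst p) \<noteq> 0" "\<forall>z\<in>HP. slash N v z = l * v z" "exp (c * t n) \<le> cmod l"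
      using slash_eigenvector[OF hol aut(1)[OF assms(2)] aut(2)[OF assms(2)] p tpos cone exp_gt_zero] by blast
    show ?case
    proof (intro allI impI)
      fix \<tau> assume \<tau>: "is_mtrace (\<phi> n) N \<tau>"
      have l: "l \<noteq> 0" "\<tau> = l + 1 / l"
        using is_mtrace_eigenvalue[OF aut(1)[OF assms(2)] aut(2)[OF assms(2)] hol \<tau> v(1) p(1) v(2)] v(3) by blast+
      have "1 \<le> exp (c * t n)" using c tpos[of n] by simp
      then have "1 \<le> cmod l" using v(4) by linarith
      then have "cmod (1 / l) \<le> 1" by (simp add: norm_divide divide_le_eq)
      then show "exp (c * t n) - 1 \<le> cmod \<tau>" using v(4) norm_triangle_ineq4[of \<tau> "1 / l"] l by simp
    qed
  qed
  then show ?thesis using c by blast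
qed

end

section \<open>Paths near the zeros of the limit\<close>

text \<open>Write \<open>- q / 2 = V\<^sup>2 (z - \<zeta>)\<^sup>k\<close>. Since \<open>V\<close> is close to \<open>V0\<close>, a root \<open>W\<close> of this function satisfies \<open>W dz = c dw\<close> for the
  multivalued coordinate \<open>w = V0 (z - \<zeta>)\<^sup>m\<^sup>/\<^sup>2\<close>, where \<open>c\<close> is close to \<open>2 / m\<close>. In this coordinate
  the path is the straight segment from a point near zero to \<open>\<kappa> \<rho>\<close>, whose direction is almost that of \<open>\<kappa>\<close>.
  The rotation \<open>\<kappa>\<close> is one unless the segment would meet the branch point; then it is a fixed number of
  modulus one, close enough to one for the real part to remain positive. As \<open>\<kappa> \<rho>\<close> takes only
  two values, the endpoint lies in a finite set which does not depend on the starting point.\<close>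

lemma punctured_reach:
  fixes \<zeta> V0 :: complex and \<rho> r :: real and k :: nat
  defines "m \<equiv> k + 2"
  assumes r: "r > 0" "ball \<zeta> r \<subseteq> HP" and V: "V holomorphic_on ball \<zeta> r"
    and q: "\<And>z. z \<in> ball \<zeta> r \<Longrightarrow> (V z)^2 * (z - \<zeta>)^k = - q z / 2"
    and V0: "V0 \<noteq> 0" "\<And>z. z \<in> ball \<zeta> r \<Longrightarrow> cmod (V z - V0) \<le> cmod V0 / 8"
    and \<rho>: "\<rho> > 0" "(\<rho> / cmod V0)^2 < r ^ m"
    and z: "z \<noteq> \<zeta>" "z \<in> ball \<zeta> r" "(cmod V0)^2 * cmod (z - \<zeta>)^m \<le> (\<rho> / 8)^2" and \<omega>: "\<omega>^2 = - q z / 2"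
  shows "\<exists>\<kappa> p. \<kappa> \<in> {1, (4 + 3 * \<i>) / 5} \<and> fst p \<in> ball \<zeta> r \<and> (fst p - \<zeta>)^m = (\<kappa> * of_real \<rho> / V0)^2 \<and>
      (snd p)^2 = - q (fst p) / 2 \<and> snd p \<noteq> 0 \<and> wkb_path q (z, \<omega>) p"
proof -
  have m0: "m > 0" by (simp add: m_def)
  \<comment> \<open>Fractional powers of \<open>z - \<zeta>\<close> are taken through a logarithm that is continued along the path.\<close>
  define \<tau>0 where "\<tau>0 = Ln (z - \<zeta>)"
  have e\<tau>0: "exp \<tau>0 = z - \<zeta>" using z by (simp add: \<tau>0_def)
  define E where "E = exp (of_nat k * \<tau>0 / 2) * V z"
  have exph: "(exp (of_nat k * x / 2))^2 = exp x ^ k" for x :: complex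
    by (simp add: exp_of_nat_mult[symmetric] flip: exp_double)
  have exphm: "(exp (of_nat m * x / 2))^2 = exp x ^ m" for x :: complex
    by (simp add: exp_of_nat_mult[symmetric] flip: exp_double)
  have Vnz: "V y \<noteq> 0" if "y \<in> ball \<zeta> r" for y
  proof
    assume "V y = 0"
    then have "cmod V0 \<le> cmod V0 / 8" using V0(2)[OF that] by simp
    then show False using V0(1) by simp
  qed
  have "E^2 = (z - \<zeta>)^k * (V z)^2" by (simp only: E_def power_mult_distrib exph e\<tau>0)
  then have "E^2 = \<omega>^2" using q[OF z(2)] \<omega> by (simp add: mult.commute)
  then have "\<omega> = E \<or> \<omega> = - E" by (metis power2_eq_iff)
  then obtain \<epsilon> :: complex where \<epsilon>: "\<epsilon> = 1 \<or> \<epsilon> = -1" "\<omega> = \<epsilon> * E" by fastforce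
  have \<epsilon>2: "\<epsilon>^2 = 1" "\<epsilon> \<noteq> 0" "cmod \<epsilon> = 1" using \<epsilon>(1) by auto
  define w0 where "w0 = \<epsilon> * V0 * exp (of_nat m * \<tau>0 / 2)"
  have w0nz: "w0 \<noteq> 0" using V0 \<epsilon>2 by (simp add: w0_def)
  have "(cmod w0)^2 = (cmod V0)^2 * cmod (exp (of_nat m * \<tau>0 / 2))^2"
    by (simp add: w0_def norm_mult \<epsilon>2 power_mult_distrib)
  also have "cmod (exp (of_nat m * \<tau>0 / 2))^2 = cmod (z - \<zeta>)^m"
    by (simp only: norm_power[symmetric] exphm e\<tau>0)
  finally have "(cmod w0)^2 \<le> (\<rho> / 8)^2" using z(3) by simp
  then have w0le: "cmod w0 \<le> \<rho> / 8" by (rule power2_le_imp_le) (use \<rho> in simp)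
  let ?\<kappa> = "(4 + 3 * \<i>) / 5 :: complex"
  have n\<kappa>: "cmod ?\<kappa> = 1" by (simp add: norm_divide cmod_def power2_eq_square)
  have "\<exists>\<kappa>\<in>{1, ?\<kappa>}. w0 / \<kappa> \<notin> \<real>\<^sub>\<le>\<^sub>0"
  proof (cases "w0 \<in> \<real>\<^sub>\<le>\<^sub>0")
    case True
    then obtain b where b: "w0 = of_real b" by (auto elim!: nonpos_Reals_cases)
    then have "b \<noteq> 0" using w0nz by auto
    have "w0 / ?\<kappa> = Complex (4 * b / 5) (- (3 * b / 5))"
      by (simp add: b complex_eq_iff Re_divide Im_divide power2_eq_square)
    then have "w0 / ?\<kappa> \<notin> \<real>\<^sub>\<le>\<^sub>0" using \<open>b \<noteq> 0\<close> by (simp add: complex_nonpos_Reals_iff)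
    then show ?thesis by blast
  qed auto
  then obtain \<kappa> where \<kappa>: "\<kappa> \<in> {1, ?\<kappa>}" "w0 / \<kappa> \<notin> \<real>\<^sub>\<le>\<^sub>0" by blast
  have \<kappa>1: "cmod \<kappa> = 1" using \<kappa>(1) n\<kappa> norm_one by blast
  then have \<kappa>nz: "\<kappa> \<noteq> 0" by auto
  note \<kappa>1 = \<kappa>1 \<kappa>nz
  have \<kappa>2: "cmod (\<kappa> - 1) \<le> 16 / 25"
  proof -
    have "?\<kappa> - 1 = Complex (-1/5) (3/5)" by (simp add: complex_eq_iff)
    then have "cmod (?\<kappa> - 1)^2 = (cmod (Complex (-1/5) (3/5)))^2" by (simp only:)
    also have "\<dots> = 2 / 5" unfolding cmod_power2 by (simp add: power2_eq_square)
    finally have "cmod (?\<kappa> - 1)^2 = 2 / 5" .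
    then have "cmod (?\<kappa> - 1)^2 \<le> (16/25)^2" by (simp add: power2_eq_square)
    then have "cmod (?\<kappa> - 1) \<le> 16/25" by (rule power2_le_imp_le) simp
    moreover have "cmod (1 - 1 :: complex) \<le> 16/25" by simp
    ultimately show ?thesis using \<kappa>(1) by blast
  qed
  define w1 where "w1 = w0 / \<kappa>"
  have w1: "w1 \<noteq> 0" "cmod w1 \<le> \<rho> / 8" "w1 \<notin> \<real>\<^sub>\<le>\<^sub>0" using w0nz w0le \<kappa> \<kappa>1 by (auto simp: w1_def norm_divide)
  define d where "d = of_real \<rho> - w1"
  define w where "w = (\<lambda>s::real. w1 + of_real s * d)"
  have ws: "w s \<notin> \<real>\<^sub>\<le>\<^sub>0" if s: "0 \<le> s" "s \<le> 1" for s
  proof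
    assume A: "w s \<in> \<real>\<^sub>\<le>\<^sub>0"
    have Rw: "Re (w s) = (1 - s) * Re w1 + s * \<rho>" "Im (w s) = (1 - s) * Im w1"
      by (simp_all add: w_def d_def algebra_simps)
    have A': "Im (w s) = 0" "Re (w s) \<le> 0" using A by (auto simp: complex_nonpos_Reals_iff)
    show False
    proof (cases "s = 1")
      case True then show False using A' Rw \<rho> by simp
    next
      case False
      then have "Im w1 = 0" using A' Rw by simp
      then have "Re w1 > 0" using w1(3) by (simp add: complex_nonpos_Reals_iff)
      then have "(1 - s) * Re w1 > 0" using False s by simp
      moreover have "s * \<rho> \<ge> 0" using s \<rho> by simp
      ultimately show False using A' Rw by linarith
    qed
  qed
  have wnz: "w s \<noteq> 0" if "0 \<le> s" "s \<le> 1" for s using ws[OF that] by auto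
  have wle: "cmod (w s) \<le> \<rho>" if s: "0 \<le> s" "s \<le> 1" for s
  proof -
    have "w s = of_real (1 - s) * w1 + of_real s * of_real \<rho>" by (simp add: w_def d_def algebra_simps)
    then have "cmod (w s) \<le> cmod (of_real (1 - s) * w1) + cmod (of_real s * of_real \<rho> :: complex)"
      using norm_triangle_ineq by metis
    also have "\<dots> = (1 - s) * cmod w1 + s * \<rho>"
      using s \<rho> by (simp add: norm_mult del: of_real_diff)
    also have "\<dots> \<le> (1 - s) * \<rho> + s * \<rho>" using w1(2) \<rho> s by (intro add_right_mono mult_left_mono) auto
    finally show ?thesis by (simp add: algebra_simps)
  qed
  define \<tau> where "\<tau> = (\<lambda>s. \<tau>0 + (2 / of_nat m) * (Ln (w s) - Ln w1))"
  define \<tau>' where "\<tau>' = (\<lambda>s. (2 / of_nat m) * (d / w s))"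
  define g where "g = (\<lambda>s. \<zeta> + exp (\<tau> s))"
  define g' where "g' = (\<lambda>s. exp (\<tau> s) * \<tau>' s)"
  define W where "W = (\<lambda>s. \<epsilon> * exp (of_nat k * \<tau> s / 2) * V (g s))"
  define W' where "W' = (\<lambda>s. \<epsilon> * (exp (of_nat k * \<tau> s / 2) * (deriv V (g s) * g' s) + exp (of_nat k * \<tau> s / 2) * (of_nat k * \<tau>' s / 2) * V (g s)))"
  have w00: "w 0 = w1" by (simp add: w_def)
  have dw: "(w has_vector_derivative d) (at s)" for s
    unfolding w_def by (auto intro!: derivative_eq_intros simp: has_vector_derivative_def scaleR_conv_of_real)
  have d\<tau>: "(\<tau> has_vector_derivative \<tau>' s) (at s)" if "0 \<le> s" "s \<le> 1" for s
  proof -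
    have "((Ln \<circ> w) has_vector_derivative d * inverse (w s)) (at s)"
      by (rule field_vector_diff_chain_at[OF dw has_field_derivative_Ln[OF ws[OF that]]])
    then have "((\<lambda>s. \<tau>0 + (2 / of_nat m) * (Ln (w s) - Ln w1)) has_vector_derivative 0 + (2 / of_nat m) * (d * inverse (w s) - 0)) (at s)"
      unfolding o_def
      by (intro has_vector_derivative_add has_vector_derivative_mult_right has_vector_derivative_diff has_vector_derivative_const)
    then show ?thesis by (simp add: \<tau>_def \<tau>'_def divide_inverse)
  qed
  have dg: "(g has_vector_derivative g' s) (at s)" if "0 \<le> s" "s \<le> 1" for s
  proof -
    have "((exp \<circ> \<tau>) has_vector_derivative \<tau>' s * exp (\<tau> s)) (at s)"
      by (rule field_vector_diff_chain_at[OF d\<tau>[OF that] DERIV_exp])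
    then have "((\<lambda>s. \<zeta> + exp (\<tau> s)) has_vector_derivative 0 + \<tau>' s * exp (\<tau> s)) (at s)"
      unfolding o_def by (intro has_vector_derivative_add has_vector_derivative_const)
    then show ?thesis by (simp add: g_def g'_def mult.commute)
  qed
  have key: "\<epsilon> * V0 * exp (of_nat m * \<tau> s / 2) = \<kappa> * w s" if "0 \<le> s" "s \<le> 1" for s
  proof -
    have "of_nat m * \<tau> s / 2 = of_nat m * \<tau>0 / 2 + (Ln (w s) - Ln w1)"
      using m0 by (simp add: \<tau>_def field_simps)
    then have "exp (of_nat m * \<tau> s / 2) = exp (of_nat m * \<tau>0 / 2 + (Ln (w s) - Ln w1))" by (rule arg_cong)
    also have "\<dots> = exp (of_nat m * \<tau>0 / 2) * (w s / w1)"
      by (simp only: exp_add exp_diff exp_Ln[OF wnz[OF that]] exp_Ln[OF w1(1)])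
    finally have "exp (of_nat m * \<tau> s / 2) = exp (of_nat m * \<tau>0 / 2) * (w s / w1)" .
    then have "\<epsilon> * V0 * exp (of_nat m * \<tau> s / 2) = w0 * (w s / w1)" by (simp add: w0_def)
    also have "\<dots> = \<kappa> * w s" using w1(1) w0nz \<kappa>1 by (simp add: w1_def)
    finally show ?thesis .
  qed
  have gm: "(g s - \<zeta>)^m = (\<kappa> * w s / V0)^2" if "0 \<le> s" "s \<le> 1" for s
  proof -
    have "(\<epsilon> * V0 * exp (of_nat m * \<tau> s / 2))^2 = V0^2 * (g s - \<zeta>)^m"
      by (simp add: power_mult_distrib \<epsilon>2 exphm g_def)
    then show ?thesis using key[OF that] V0(1) by (simp add: power_divide)
  qed
  have gb: "g s \<in> ball \<zeta> r" if "0 \<le> s" "s \<le> 1" for s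
  proof -
    have "cmod (g s - \<zeta>)^m = (cmod (w s) / cmod V0)^2"
      using arg_cong[OF gm[OF that], of cmod] by (simp add: norm_power norm_mult norm_divide \<kappa>1)
    also have "\<dots> \<le> (\<rho> / cmod V0)^2" using wle[OF that] by (intro power_mono divide_right_mono) auto
    finally have "cmod (g s - \<zeta>)^m < r^m" using \<rho>(2) by linarith
    then have "cmod (g s - \<zeta>) < r" by (rule power_less_imp_less_base) (use r in simp)
    then show ?thesis by (simp add: dist_norm norm_minus_commute)
  qed
  have dV: "(V has_field_derivative deriv V (g s)) (at (g s))" if "0 \<le> s" "s \<le> 1" for s
    using holomorphic_derivI[OF V open_ball gb[OF that]] .
  have dW: "(W has_vector_derivative W' s) (at s)" if "0 \<le> s" "s \<le> 1" for s
  proof -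
    have 1: "((V \<circ> g) has_vector_derivative g' s * deriv V (g s)) (at s)"
      by (rule field_vector_diff_chain_at[OF dg[OF that] dV[OF that]])
    have "((\<lambda>s. of_nat k * \<tau> s / 2) has_vector_derivative of_nat k * \<tau>' s / 2) (at s)"
      by (intro has_vector_derivative_divide has_vector_derivative_mult_right d\<tau> that)
    then have 2: "((exp \<circ> (\<lambda>s. of_nat k * \<tau> s / 2)) has_vector_derivative of_nat k * \<tau>' s / 2 * exp (of_nat k * \<tau> s / 2)) (at s)"
      by (rule field_vector_diff_chain_at[OF _ DERIV_exp])
    show ?thesis using has_vector_derivative_mult_right[OF has_vector_derivative_mult[OF 2 1], of \<epsilon>]
      by (simp add: W_def W'_def o_def mult_ac)
  qed
  have cw: "continuous_on {0..1} w" unfolding w_def by (intro continuous_intros)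
  have c\<tau>: "continuous_on {0..1} \<tau>"
    by (intro continuous_at_imp_continuous_on ballI, rule has_vector_derivative_continuous, use d\<tau> in force)
  have c\<tau>': "continuous_on {0..1} \<tau>'" unfolding \<tau>'_def using wnz m0 by (intro continuous_intros cw) auto
  have cg: "continuous_on {0..1} g" unfolding g_def by (intro continuous_intros c\<tau>)
  have cg': "continuous_on {0..1} g'" unfolding g'_def by (intro continuous_intros c\<tau> c\<tau>')
  have gim: "g ` {0..1} \<subseteq> ball \<zeta> r" using gb by auto
  have cV: "continuous_on {0..1} (\<lambda>s. V (g s))" "continuous_on {0..1} (\<lambda>s. deriv V (g s))"
    using continuous_on_compose2[OF holomorphic_on_imp_continuous_on[OF V] cg gim]
      continuous_on_compose2[OF holomorphic_on_imp_continuous_on[OF holomorphic_deriv[OF V open_ball]] cg gim] by auto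
  have cW': "continuous_on {0..1} W'" unfolding W'_def by (intro continuous_intros c\<tau> c\<tau>' cg' cV) auto
  have W2: "(W s)^2 = - q (g s) / 2" if "0 \<le> s" "s \<le> 1" for s
  proof -
    have "(W s)^2 = \<epsilon>^2 * exp (\<tau> s)^k * (V (g s))^2" by (simp only: W_def power_mult_distrib exph)
    also have "\<dots> = (V (g s))^2 * (g s - \<zeta>)^k" by (simp add: \<epsilon>2 g_def mult.commute)
    finally show ?thesis using q[OF gb[OF that]] by simp
  qed
  have Wnz: "W s \<noteq> 0" if "0 \<le> s" "s \<le> 1" for s
    using Vnz[OF gb[OF that]] \<epsilon>2 by (simp add: W_def)
  have Re: "Re (W s * g' s) > 0" if s: "0 \<le> s" "s \<le> 1" for s
  proof -
    have ee: "exp (of_nat k * \<tau> s / 2) * exp (\<tau> s) = exp (of_nat m * \<tau> s / 2)"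
      by (simp add: exp_add[symmetric] m_def algebra_simps add_divide_distrib)
    have "W s * g' s = (V (g s) / V0) * (\<epsilon> * V0 * exp (of_nat m * \<tau> s / 2)) * \<tau>' s"
      using V0(1) by (simp add: W_def g'_def ee[symmetric])
    also have "\<dots> = (2 / of_nat m) * ((V (g s) / V0) * \<kappa> * d)"
      unfolding key[OF s] \<tau>'_def using wnz[OF s] by (simp add: mult_ac)
    also have "\<dots> = of_real (2 * \<rho> / real m) * (\<kappa> * ((V (g s) / V0) * (1 - w1 / of_real \<rho>)))"
    proof -
      have "d = of_real \<rho> * (1 - w1 / of_real \<rho>)" using \<rho>(1) by (simp add: d_def right_diff_distrib)
      then show ?thesis by (simp add: mult_ac)
    qed
    finally have Wg: "W s * g' s = of_real (2 * \<rho> / real m) * (\<kappa> * ((V (g s) / V0) * (1 - w1 / of_real \<rho>)))" .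
    define a where "a = V (g s) / V0"
    define b where "b = w1 / of_real \<rho>"
    have "a - 1 = (V (g s) - V0) / V0" using V0(1) by (simp add: a_def field_simps)
    then have a: "cmod (a - 1) \<le> 1 / 8" using V0(2)[OF gb[OF s]] V0(1) by (simp add: norm_divide divide_le_eq)
    have b: "cmod b \<le> 1 / 8" using w1(2) \<rho>(1) by (simp add: b_def norm_divide divide_le_eq)
    have "cmod (a * (1 - b) - 1) \<le> 1 / 8 + 1 / 8 * (1 + 1 / 8)"
    proof -
      have "a * (1 - b) - 1 = (a - 1) + - (a * b)" by (simp add: algebra_simps)
      then have "cmod (a * (1 - b) - 1) = cmod ((a - 1) + - (a * b))" by (simp only:)
      also have "\<dots> \<le> cmod (a - 1) + cmod (- (a * b))" by (rule norm_triangle_ineq)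
      also have "\<dots> = cmod (a - 1) + cmod a * cmod b" by (simp add: norm_mult)
      finally have "cmod (a * (1 - b) - 1) \<le> cmod (a - 1) + cmod a * cmod b" .
      moreover have "cmod a \<le> 1 + 1 / 8" using a norm_triangle_ineq[of "a - 1" 1] by simp
      then have "cmod a * cmod b \<le> (1 + 1 / 8) * (1 / 8)" using b by (intro mult_mono) auto
      ultimately show ?thesis using a by simp
    qed
    then have ab: "cmod (a * (1 - b) - 1) \<le> 17 / 64" by simp
    have "cmod (\<kappa> * (a * (1 - b)) - 1) \<le> 17 / 64 + 16 / 25"
    proof -
      have "\<kappa> * (a * (1 - b)) - 1 = \<kappa> * (a * (1 - b) - 1) + (\<kappa> - 1)" by (simp add: algebra_simps)
      then have "cmod (\<kappa> * (a * (1 - b)) - 1) \<le> cmod (\<kappa> * (a * (1 - b) - 1)) + cmod (\<kappa> - 1)"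
        using norm_triangle_ineq by metis
      then show ?thesis using ab \<kappa>2 \<kappa>1 by (simp add: norm_mult)
    qed
    then have "\<bar>Re (\<kappa> * (a * (1 - b)) - 1)\<bar> < 1" using abs_Re_le_cmod[of "\<kappa> * (a * (1 - b)) - 1"] by linarith
    then have "Re (\<kappa> * (a * (1 - b))) > 0" by simp
    moreover have "2 * \<rho> / real m > 0" using \<rho>(1) m0 by simp
    ultimately have "2 * \<rho> / real m * Re (\<kappa> * (a * (1 - b))) > 0" by (rule mult_pos_pos[rotated])
    moreover have "Re (of_real x * y) = x * Re y" for x y by simp
    ultimately show ?thesis unfolding Wg a_def[symmetric] b_def[symmetric] by metis
  qed
  have path: "wkb_path q (z, \<omega>) (g 1, W 1)"
    unfolding wkb_path_def
  proof (intro exI conjI ballI)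
    have "\<tau> 0 = \<tau>0" by (simp add: \<tau>_def w00)
    then have "g 0 = z" by (simp add: g_def e\<tau>0)
    moreover have "W 0 = \<omega>" using \<open>\<tau> 0 = \<tau>0\<close> \<open>g 0 = z\<close> by (simp add: W_def \<epsilon>(2) E_def)
    ultimately show "(g 0, W 0) = (z, \<omega>)" by simp
    show "(g 1, W 1) = (g 1, W 1)" ..
    show "continuous_on {0..1} g'" by (rule cg')
    show "continuous_on {0..1} W'" by (rule cW')
    fix s :: real assume "s \<in> {0..1}"
    then have s: "0 \<le> s" "s \<le> 1" by auto
    show "g s \<in> HP" using gb[OF s] r by blast
    show "(g has_vector_derivative g' s) (at s)" by (rule dg[OF s])
    show "(W has_vector_derivative W' s) (at s)" by (rule dW[OF s])
    show "(W s)^2 = - q (g s) / 2" by (rule W2[OF s])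
    show "W s \<noteq> 0" by (rule Wnz[OF s])
    show "Re (W s * g' s) > 0" by (rule Re[OF s])
  qed
  have "w 1 = of_real \<rho>" by (simp add: w_def d_def)
  then have "(g 1 - \<zeta>)^m = (\<kappa> * of_real \<rho> / V0)^2" using gm[of 1] by simp
  then show ?thesis using \<kappa>(1) gb[of 1] W2[of 1] Wnz[of 1] path
    by (intro exI[of _ \<kappa>] exI[of _ "(g 1, W 1)"]) auto
qed

text \<open>The starting point \<open>\<zeta>\<close> itself, at which \<open>q\<close> does not vanish. A segment in the original coordinate
  serves here; its endpoint satisfies the equation of the endpoints above for \<open>m = 2\<close> and \<open>\<kappa> = 1\<close>.\<close>

lemma regular_center_reach:
  fixes \<zeta> V0 :: complex and \<rho> r :: real
  assumes r: "r > 0" "ball \<zeta> r \<subseteq> HP" and V: "V holomorphic_on ball \<zeta> r"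
    and q: "\<And>z. z \<in> ball \<zeta> r \<Longrightarrow> (V z)^2 = - q z / 2"
    and V0: "V0 \<noteq> 0" "\<And>z. z \<in> ball \<zeta> r \<Longrightarrow> cmod (V z - V0) \<le> cmod V0 / 8"
    and \<rho>: "\<rho> > 0" "\<rho> / cmod V0 < r" and \<omega>: "\<omega>^2 = - q \<zeta> / 2" and VV: "V \<zeta> = V0"
  shows "\<exists>p. fst p \<in> ball \<zeta> r \<and> (fst p - \<zeta>)^2 = (of_real \<rho> / V0)^2 \<and>
      (snd p)^2 = - q (fst p) / 2 \<and> snd p \<noteq> 0 \<and> wkb_path q (\<zeta>, \<omega>) p"
proof -
  have "\<omega>^2 = V0^2" using q[of \<zeta>] r \<omega> VV by simp
  then have "\<omega> = V0 \<or> \<omega> = - V0" by (metis power2_eq_iff)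
  then obtain \<epsilon> :: complex where \<epsilon>: "\<epsilon> = 1 \<or> \<epsilon> = -1" "\<omega> = \<epsilon> * V0" by fastforce
  have \<epsilon>2: "\<epsilon>^2 = 1" "\<epsilon> \<noteq> 0" "cmod \<epsilon> = 1" using \<epsilon>(1) by auto
  define d where "d = of_real \<rho> / (\<epsilon> * V0)"
  define g where "g = (\<lambda>s::real. \<zeta> + of_real s * d)"
  define W where "W = (\<lambda>s. \<epsilon> * V (g s))"
  have gb: "g s \<in> ball \<zeta> r" if "0 \<le> s" "s \<le> 1" for s
  proof -
    have "cmod (g s - \<zeta>) = s * (\<rho> / cmod V0)" using that \<rho> by (simp add: g_def d_def norm_mult norm_divide \<epsilon>2)
    also have "\<dots> \<le> \<rho> / cmod V0" using that \<rho> V0 by (intro mult_left_le_one_le) auto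
    finally show ?thesis using \<rho>(2) by (simp add: dist_norm norm_minus_commute)
  qed
  have Vnz: "V y \<noteq> 0" if "y \<in> ball \<zeta> r" for y
  proof
    assume "V y = 0"
    then have "cmod V0 \<le> cmod V0 / 8" using V0(2)[OF that] by simp
    then show False using V0(1) by simp
  qed
  have dg: "(g has_vector_derivative d) (at s)" for s
    unfolding g_def by (auto intro!: derivative_eq_intros simp: has_vector_derivative_def scaleR_conv_of_real)
  have cg: "continuous_on {0..1} g" unfolding g_def by (intro continuous_intros)
  have gim: "g ` {0..1} \<subseteq> ball \<zeta> r" using gb by auto
  have dW: "(W has_vector_derivative \<epsilon> * (d * deriv V (g s))) (at s)" if "0 \<le> s" "s \<le> 1" for s
    using has_vector_derivative_mult_right[OF field_vector_diff_chain_at[OF dg holomorphic_derivI[OF V open_ball gb[OF that]]], of \<epsilon>]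
    by (simp add: W_def o_def)
  have cW': "continuous_on {0..1} (\<lambda>s. \<epsilon> * (d * deriv V (g s)))"
    by (intro continuous_intros continuous_on_compose2[OF holomorphic_on_imp_continuous_on[OF holomorphic_deriv[OF V open_ball]] cg gim])
  have Re: "Re (W s * d) > 0" if s: "0 \<le> s" "s \<le> 1" for s
  proof -
    have Wg: "W s * d = of_real \<rho> * (V (g s) / V0)" using \<epsilon>2 V0 by (simp add: W_def d_def)
    have "V (g s) / V0 - 1 = (V (g s) - V0) / V0" using V0(1) by (simp add: field_simps)
    then have "cmod (V (g s) / V0 - 1) \<le> 1 / 8" using V0(2)[OF gb[OF s]] V0(1) by (simp add: norm_divide divide_le_eq)
    then have "\<bar>Re (V (g s) / V0 - 1)\<bar> < 1" using abs_Re_le_cmod[of "V (g s) / V0 - 1"] by linarith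
    then have "Re (V (g s) / V0) > 0" by simp
    moreover have "Re (of_real \<rho> * x) = \<rho> * Re x" for x by simp
    ultimately show ?thesis unfolding Wg using \<rho>(1) by (metis mult_pos_pos)
  qed
  have path: "wkb_path q (\<zeta>, \<omega>) (g 1, W 1)"
    unfolding wkb_path_def
  proof (intro exI conjI ballI)
    show "(g 0, W 0) = (\<zeta>, \<omega>)" by (simp add: g_def W_def \<epsilon>(2) VV)
    show "(g 1, W 1) = (g 1, W 1)" ..
    show "continuous_on {0..1} (\<lambda>s. d)" by simp
    show "continuous_on {0..1} (\<lambda>s. \<epsilon> * (d * deriv V (g s)))" by (rule cW')
    fix s :: real assume "s \<in> {0..1}"
    then have s: "0 \<le> s" "s \<le> 1" by auto
    show "g s \<in> HP" using gb[OF s] r by blast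
    show "(g has_vector_derivative d) (at s)" by (rule dg)
    show "(W has_vector_derivative \<epsilon> * (d * deriv V (g s))) (at s)" by (rule dW[OF s])
    show "(W s)^2 = - q (g s) / 2" using q[OF gb[OF s]] \<epsilon>2 by (simp add: W_def power_mult_distrib)
    show "W s \<noteq> 0" using Vnz[OF gb[OF s]] \<epsilon>2 by (simp add: W_def)
    show "Re (W s * d) > 0" by (rule Re[OF s])
  qed
  have "(g 1 - \<zeta>)^2 = (of_real \<rho> / V0)^2" by (simp add: g_def d_def power_divide power_mult_distrib \<epsilon>2)
  moreover have "(W 1)^2 = - q (g 1) / 2" using q[OF gb[of 1]] \<epsilon>2 by (simp add: W_def power_mult_distrib)
  moreover have "W 1 \<noteq> 0" using Vnz[OF gb[of 1]] \<epsilon>2 by (simp add: W_def)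
  ultimately show ?thesis using gb[of 1] path by (intro exI[of _ "(g 1, W 1)"]) auto
qed

text \<open>The targets are all points \<open>p\<close> which satisfy the algebraic equations of the endpoints above. There are
  finitely many of them, and none is a zero of \<open>q\<close>.\<close>

lemma local_reach:
  assumes qh: "q holomorphic_on HP" and nz: "\<exists>w\<in>HP. q w \<noteq> 0" and \<zeta>: "\<zeta> \<in> HP"
  shows "\<exists>U T. open U \<and> \<zeta> \<in> U \<and> finite T \<and> (\<forall>p\<in>T. fst p \<in> HP \<and> (snd p)^2 = - q (fst p) / 2 \<and> snd p \<noteq> 0) \<and>
     (\<forall>z\<in>U. \<forall>\<omega>. \<omega>^2 = - q z / 2 \<longrightarrow> \<omega> \<noteq> 0 \<longrightarrow> (\<exists>p\<in>T. wkb_path q (z, \<omega>) p))"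
proof -
  define k where "k = nat (zorder q \<zeta>)"
  define h where "h = zor_poly q \<zeta>"
  define m where "m = k + 2"
  obtain r0 where r0: "r0 > 0" "cball \<zeta> r0 \<subseteq> HP" "h holomorphic_on cball \<zeta> r0"
      "\<forall>w\<in>cball \<zeta> r0. q w = h w * (w - \<zeta>)^k \<and> h w \<noteq> 0"
    using conjunct2[OF zorder_exist_zero[OF qh open_HP connected_HP \<zeta> nz]] unfolding k_def[symmetric] h_def[symmetric]
    by blast
  have hb: "(\<lambda>z. - h z / 2) holomorphic_on ball \<zeta> r0"
    by (intro holomorphic_intros holomorphic_on_subset[OF r0(3)]) auto
  have hnz: "- h z / 2 \<noteq> 0" if "z \<in> ball \<zeta> r0" for z
    using r0(4)[rule_format, of z] that by simp
  obtain V where V: "V holomorphic_on ball \<zeta> r0" "\<And>z. z \<in> ball \<zeta> r0 \<Longrightarrow> - h z / 2 = (V z)^2"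
    by (rule contractible_imp_holomorphic_sqrt[OF hb convex_imp_contractible[OF convex_ball]]) (use hnz in blast)+
  define V0 where "V0 = V \<zeta>"
  have \<zeta>b: "\<zeta> \<in> ball \<zeta> r0" using r0 by simp
  have V0: "V0 \<noteq> 0" using V(2)[OF \<zeta>b] hnz[OF \<zeta>b] by (auto simp: V0_def)
  have "continuous (at \<zeta>) V" using holomorphic_on_imp_continuous_on[OF V(1)] \<zeta>b
    by (simp add: continuous_on_eq_continuous_at)
  then obtain r1 where r1: "r1 > 0" "\<And>z. dist z \<zeta> < r1 \<Longrightarrow> dist (V z) (V \<zeta>) < cmod V0 / 8"
    using V0 unfolding continuous_at_eps_delta by (metis divide_pos_pos zero_less_norm_iff zero_less_numeral)
  define r where "r = min r0 r1"
  have r: "r > 0" "ball \<zeta> r \<subseteq> ball \<zeta> r0" using r0 r1 by (auto simp: r_def)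
  have rHP: "ball \<zeta> r \<subseteq> HP" using r(2) r0(2) ball_subset_cball by blast
  have Vr: "V holomorphic_on ball \<zeta> r" using holomorphic_on_subset[OF V(1) r(2)] .
  have Vd: "cmod (V z - V0) \<le> cmod V0 / 8" if "z \<in> ball \<zeta> r" for z
    using r1(2)[of z] that by (simp add: r_def V0_def dist_norm dist_commute norm_minus_commute)
  have qV: "(V z)^2 * (z - \<zeta>)^k = - q z / 2" if "z \<in> ball \<zeta> r" for z
  proof -
    have "z \<in> ball \<zeta> r0" "z \<in> cball \<zeta> r0" using that r(2) ball_subset_cball by blast+
    then have "(V z)^2 = - h z / 2" "q z = h z * (z - \<zeta>)^k" using V(2) r0(4) by auto
    then show ?thesis by simp
  qed
  define r' where "r' = min r 1"
  have r': "0 < r'" "r' \<le> 1" "r' \<le> r" using r by (auto simp: r'_def)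
  \<comment> \<open>Since \<open>r' \<le> 1\<close>, this choice satisfies the requirements on \<open>\<rho>\<close> both at regular points and at zeros.\<close>
  define \<rho> where "\<rho> = cmod V0 * r'^m / 2"
  have \<rho>: "\<rho> > 0" using V0 r' by (simp add: \<rho>_def)
  have \<rho>r: "\<rho> / cmod V0 < r'^m" using V0 r' by (simp add: \<rho>_def)
  have r'm: "0 < r'^m" "r'^m \<le> 1" using r' by (auto simp: power_le_one)
  have \<rho>2: "(\<rho> / cmod V0)^2 < r^m"
  proof -
    have "(\<rho> / cmod V0)^2 < (r'^m)^2" using \<rho>r \<rho> V0 by (intro power_strict_mono) auto
    also have "\<dots> \<le> r'^m" using r'm by (simp add: power2_eq_square mult_left_le)
    also have "\<dots> \<le> r^m" using r' by (intro power_mono) auto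
    finally show ?thesis .
  qed
  have \<rho>1: "\<rho> / cmod V0 < r"
  proof -
    have "r'^m \<le> r'^1" using r' by (intro power_decreasing) (auto simp: m_def)
    then show ?thesis using \<rho>r r' by simp
  qed
  define T where "T = {p. fst p \<in> ball \<zeta> r \<and> (\<exists>\<kappa>\<in>{1, (4 + 3 * \<i>) / 5}. (fst p - \<zeta>)^m = (\<kappa> * of_real \<rho> / V0)^2) \<and>
     (snd p)^2 = - q (fst p) / 2 \<and> snd p \<noteq> 0}"
  define Z where "Z = (\<Union>\<kappa>\<in>{1, (4 + 3 * \<i>) / 5}. (\<lambda>y. \<zeta> + y) ` {y. y^m = (\<kappa> * of_real \<rho> / V0)^2})"
  have "finite Z" unfolding Z_def
    by (intro finite_UN_I finite_imageI finite_nth_roots) (auto simp: m_def)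
  then have "finite (Sigma Z (\<lambda>z. {y. y^2 = - q z / 2}))"
    by (intro finite_SigmaI finite_nth_roots) auto
  moreover have "T \<subseteq> Sigma Z (\<lambda>z. {y. y^2 = - q z / 2})"
  proof
    fix p assume p: "p \<in> T"
    then obtain \<kappa> where k: "\<kappa> \<in> {1, (4 + 3 * \<i>) / 5}" "(fst p - \<zeta>)^m = (\<kappa> * of_real \<rho> / V0)^2" unfolding T_def by blast
    then have "fst p \<in> Z" unfolding Z_def by (intro UN_I[OF k(1)] image_eqI[of _ _ "fst p - \<zeta>"]) auto
    then show "p \<in> Sigma Z (\<lambda>z. {y. y^2 = - q z / 2})" using p unfolding T_def by (cases p) auto
  qed
  ultimately have fT: "finite T" by (rule finite_subset[rotated])
  define U where "U = ball \<zeta> r \<inter> {z. (cmod V0)^2 * cmod (z - \<zeta>)^m < (\<rho> / 8)^2}"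
  have oU: "open U" unfolding U_def
    by (intro open_Int open_ball open_Collect_less continuous_intros)
  have \<zeta>U: "\<zeta> \<in> U" using r \<rho> by (simp add: U_def m_def)
  have reach: "\<exists>p\<in>T. wkb_path q (z, \<omega>) p" if z: "z \<in> U" and \<omega>: "\<omega>^2 = - q z / 2" "\<omega> \<noteq> 0" for z \<omega>
  proof (cases "z = \<zeta>")
    case True
    then have "k = 0"
    proof -
      have "q \<zeta> \<noteq> 0" using \<omega> True by auto
      then show ?thesis using r0(4)[rule_format, of \<zeta>] r0(1) by (cases k) auto
    qed
    then have qV': "(V z)^2 = - q z / 2" if "z \<in> ball \<zeta> r" for z using qV[OF that] by simp
    obtain p where p: "fst p \<in> ball \<zeta> r" "(fst p - \<zeta>)^2 = (of_real \<rho> / V0)^2"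
      "(snd p)^2 = - q (fst p) / 2" "snd p \<noteq> 0" "wkb_path q (\<zeta>, \<omega>) p"
      using regular_center_reach[OF r(1) rHP Vr qV' V0 Vd \<rho> \<rho>1 _ V0_def[symmetric], of \<omega>] \<omega> True by blast
    have m2: "m = 2" using \<open>k = 0\<close> by (simp add: m_def)
    have "(fst p - \<zeta>)^m = (1 * of_real \<rho> / V0)^2" unfolding m2 mult_1 by (rule p(2))
    then have "p \<in> T" unfolding T_def using p(1,3,4) by blast
    then show ?thesis using p(5) True by blast
  next
    case False
    have zb: "z \<in> ball \<zeta> r" "(cmod V0)^2 * cmod (z - \<zeta>)^m \<le> (\<rho> / 8)^2" using z by (auto simp: U_def)
    obtain \<kappa> p where "\<kappa> \<in> {1, (4 + 3 * \<i>) / 5}" "fst p \<in> ball \<zeta> r" "(fst p - \<zeta>)^m = (\<kappa> * of_real \<rho> / V0)^2"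
      "(snd p)^2 = - q (fst p) / 2" "snd p \<noteq> 0" "wkb_path q (z, \<omega>) p"
      using punctured_reach[OF r(1) rHP Vr qV V0 Vd \<rho> \<rho>2[unfolded m_def] False zb(1) zb(2)[unfolded m_def] \<omega>(1)]
      unfolding m_def[symmetric] by blast
    then show ?thesis unfolding T_def by blast
  qed
  show ?thesis
  proof (intro exI[of _ U] exI[of _ T] conjI)
    show "\<forall>p\<in>T. fst p \<in> HP \<and> (snd p)^2 = - q (fst p) / 2 \<and> snd p \<noteq> 0" unfolding T_def using rHP by blast
  qed (use oU \<zeta>U fT reach in blast)+
qed

section \<open>A loop in the compact quotient\<close>

text \<open>Iterating a choice of successors, some element is visited twice.\<close>

lemma cycle_exists:
  assumes T: "finite T" "T \<noteq> {}" and succ: "\<And>p. p \<in> T \<Longrightarrow> \<exists>p'\<in>T. R p p'"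
    and trans: "\<And>a b c. a \<in> T \<Longrightarrow> b \<in> T \<Longrightarrow> c \<in> T \<Longrightarrow> R a b \<Longrightarrow> R b c \<Longrightarrow> R a c"
  shows "\<exists>p\<in>T. R p p"
proof -
  obtain f where f: "\<And>p. p \<in> T \<Longrightarrow> f p \<in> T \<and> R p (f p)" using succ by metis
  obtain p0 where p0: "p0 \<in> T" using T by blast
  have it: "(f ^^ i) p0 \<in> T" for i by (induction i) (use f p0 in auto)
  have "\<not> inj_on (\<lambda>i. (f ^^ i) p0) UNIV"
  proof
    assume "inj_on (\<lambda>i. (f ^^ i) p0) UNIV"
    then have "infinite (range (\<lambda>i. (f ^^ i) p0))" using finite_imageD infinite_UNIV_nat by blast
    moreover have "range (\<lambda>i. (f ^^ i) p0) \<subseteq> T" using it by blast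
    ultimately show False using T(1) finite_subset by blast
  qed
  then obtain i j where ij: "i \<noteq> j" "(f ^^ i) p0 = (f ^^ j) p0" unfolding inj_on_def by blast
  have R: "R ((f ^^ a) p0) ((f ^^ (a + Suc n)) p0)" for a n
  proof (induction n)
    case 0 show ?case using f[OF it[of a]] by simp
  next
    case (Suc n)
    have "R ((f ^^ (a + Suc n)) p0) ((f ^^ (a + Suc (Suc n))) p0)" using f[OF it[of "a + Suc n"]] by simp
    then show ?case using trans[OF it it it Suc] by blast
  qed
  have "R ((f ^^ min i j) p0) ((f ^^ max i j) p0)"
    using R[of "min i j" "max i j - min i j - 1"] ij(1) by (cases "i < j") auto
  moreover have "(f ^^ min i j) p0 = (f ^^ max i j) p0" using ij by (cases "i < j") (auto simp: min_def max_def)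
  ultimately show ?thesis using it by metis
qed

context wkb_seq begin

lemma limit_automorphic:
  assumes "M \<in> \<G>" shows "automorphic M q"
  unfolding automorphic_def
proof
  fix z assume z: "z \<in> HP"
  have ptw: "(\<lambda>n. \<phi> n w / of_real ((t n)^2)) \<longlonglongrightarrow> q w" if "w \<in> HP" for w
    using tendsto_uniform_limitI[OF lim[of "{w}"], of w] that by simp
  have z': "mob M z \<in> HP" using aut(1)[OF assms] z by (simp add: hp_aut_def)
  have "(\<lambda>n. \<phi> n z / of_real ((t n)^2) * jf M z ^ 4) \<longlonglongrightarrow> q z * jf M z ^ 4"
    by (intro tendsto_mult_right ptw z)
  moreover have "(\<lambda>n. \<phi> n z / of_real ((t n)^2) * jf M z ^ 4) = (\<lambda>n. \<phi> n (mob M z) / of_real ((t n)^2))"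
    using aut(2)[OF assms] z by (auto simp: automorphic_def)
  ultimately show "q (mob M z) = q z * jf M z ^ 4" using ptw[OF z'] LIMSEQ_unique by metis
qed

text \<open>Finitely many of the neighbourhoods of \<open>local_reach\<close> cover \<open>D\<close>, and every point can be moved into \<open>D\<close>. So
  each of the finitely many targets leads to another one, and a cycle among them is a group element
  whose monodromy expands a cone.\<close>

theorem wkb_loop:
  assumes D: "compact D" "D \<subseteq> HP" "\<And>z. z \<in> HP \<Longrightarrow> \<exists>M\<in>\<G>. mob M z \<in> D" and nz: "\<exists>w\<in>HP. q w \<noteq> 0"
  shows "\<exists>N\<in>\<G>. \<exists>c>0. \<forall>\<^sub>F n in sequentially. \<forall>\<tau>. is_mtrace (\<phi> n) N \<tau> \<longrightarrow> exp (c * t n) - 1 \<le> cmod \<tau>"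
proof -
  define good where "good = (\<lambda>p. fst p \<in> HP \<and> (snd p)^2 = - q (fst p) / 2 \<and> snd p \<noteq> 0)"
  define Q where "Q = (\<lambda>\<zeta> U T. open U \<and> \<zeta> \<in> U \<and> finite T \<and> (\<forall>p\<in>T. good p) \<and>
     (\<forall>z\<in>U. \<forall>\<omega>. \<omega>^2 = - q z / 2 \<longrightarrow> \<omega> \<noteq> 0 \<longrightarrow> (\<exists>p\<in>T. wkb_path q (z, \<omega>) p)))"
  have "\<exists>U T. Q \<zeta> U T" if "\<zeta> \<in> D" for \<zeta>
    unfolding Q_def good_def by (rule local_reach[OF qhol nz subsetD[OF D(2) that]])
  then obtain U T where QUT: "\<And>\<zeta>. \<zeta> \<in> D \<Longrightarrow> Q \<zeta> (U \<zeta>) (T \<zeta>)" by metis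
  have UT: "\<And>\<zeta>. \<zeta> \<in> D \<Longrightarrow> open (U \<zeta>)" "\<And>\<zeta>. \<zeta> \<in> D \<Longrightarrow> \<zeta> \<in> U \<zeta>" "\<And>\<zeta>. \<zeta> \<in> D \<Longrightarrow> finite (T \<zeta>)"
      "\<And>\<zeta> p. \<zeta> \<in> D \<Longrightarrow> p \<in> T \<zeta> \<Longrightarrow> good p"
      "\<And>\<zeta> z \<omega>. \<zeta> \<in> D \<Longrightarrow> z \<in> U \<zeta> \<Longrightarrow> \<omega>^2 = - q z / 2 \<Longrightarrow> \<omega> \<noteq> 0 \<Longrightarrow> \<exists>p\<in>T \<zeta>. wkb_path q (z, \<omega>) p"
    using QUT unfolding Q_def by blast+
  have "D \<subseteq> (\<Union>\<zeta>\<in>D. U \<zeta>)" using UT(2) by blast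
  then obtain C where C: "C \<subseteq> D" "finite C" "D \<subseteq> (\<Union>\<zeta>\<in>C. U \<zeta>)"
    using compactE_image[OF D(1), of D U] UT(1) by blast
  define TT where "TT = (\<Union>\<zeta>\<in>C. T \<zeta>)"
  have fT: "finite TT" unfolding TT_def using C UT(3) by blast
  have gT: "good p" if "p \<in> TT" for p using that UT(4) C(1) unfolding TT_def by blast
  have reach: "\<exists>p\<in>TT. wkb_path q (z, \<omega>) p" if "z \<in> D" "\<omega>^2 = - q z / 2" "\<omega> \<noteq> 0" for z \<omega>
  proof -
    obtain \<zeta> where "\<zeta> \<in> C" "z \<in> U \<zeta>" using C(3) \<open>z \<in> D\<close> by blast
    then show ?thesis using UT(5)[of \<zeta> z \<omega>] that C(1) unfolding TT_def by blast
  qed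
  have step: "\<exists>M\<in>\<G>. \<exists>p'\<in>TT. wkb_path q (mob M z, \<omega> * (jf M z)^2) p'" if z: "z \<in> HP" "\<omega>^2 = - q z / 2" "\<omega> \<noteq> 0" for z \<omega>
  proof -
    obtain M where M: "M \<in> \<G>" "mob M z \<in> D" using D(3)[OF z(1)] by blast
    have "q (mob M z) = q z * jf M z ^ 4" using limit_automorphic[OF M(1)] z(1) by (simp add: automorphic_def)
    then have "(\<omega> * (jf M z)^2)^2 = - q (mob M z) / 2" using z(2) by (simp add: power_mult_distrib flip: power_mult)
    moreover have "\<omega> * (jf M z)^2 \<noteq> 0" using z aut(1)[OF M(1)] by (simp add: hp_aut_def)
    ultimately show ?thesis using reach[OF M(2)] M(1) by blast
  qed
  have "TT \<noteq> {}"
  proof -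
    obtain w where w: "w \<in> HP" "q w \<noteq> 0" using nz by blast
    have "(csqrt (- q w / 2))^2 = - q w / 2" "csqrt (- q w / 2) \<noteq> 0" using w by simp_all
    then show ?thesis using step[OF w(1)] by blast
  qed
  moreover have "\<exists>p'\<in>TT. \<exists>N\<in>\<G>. expands p p' N" if p: "p \<in> TT" for p
  proof -
    obtain z \<omega> where zo: "p = (z, \<omega>)" by (cases p)
    have g: "z \<in> HP" "\<omega>^2 = - q z / 2" "\<omega> \<noteq> 0" using gT[OF p] by (simp_all add: good_def zo)
    obtain M p' where "M \<in> \<G>" "p' \<in> TT" "wkb_path q (mob M z, \<omega> * (jf M z)^2) p'" using step[OF g] by blast
    then show ?thesis using path_after_jump_expands[OF _ g(1) _ g(3)] zo by blast
  qed
  moreover have "\<exists>N\<in>\<G>. expands a c N"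
    if c: "a \<in> TT" "b \<in> TT" "c \<in> TT" and ex: "\<exists>N\<in>\<G>. expands a b N" "\<exists>N\<in>\<G>. expands b c N" for a b c
  proof -
    obtain N N' where N: "N \<in> \<G>" "expands a b N" "N' \<in> \<G>" "expands b c N'" using ex by blast
    have "fst c \<in> HP" using gT[OF c(3)] by (simp add: good_def)
    then show ?thesis using expands_trans[OF N(2,4,1,3)] mult[OF N(1,3)] by blast
  qed
  ultimately have "\<exists>p\<in>TT. \<exists>N\<in>\<G>. expands p p N" by (rule cycle_exists[OF fT, where R = "\<lambda>a b. \<exists>N\<in>\<G>. expands a b N"])
  then obtain p N where pN: "p \<in> TT" "N \<in> \<G>" "expands p p N" by blast
  have "fst p \<in> HP" "snd p \<noteq> 0" using gT[OF pN(1)] by (simp_all add: good_def)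
  then show ?thesis using loop_trace_growth[OF pN(3,2)] pN(2) by blast
qed

end

section \<open>Growth of traces over a cocompact group\<close>

text \<open>Compactness of the quotient is used in the form that finitely many group elements suffice to move the
  points of a given compact set into \<open>D\<close>; this is why the orbits are to meet the interior of \<open>D\<close>.\<close>

locale cocompact =
  fixes \<G> :: "(complex^2^2) set" and D :: "complex set"
  assumes aut: "\<And>M. M \<in> \<G> \<Longrightarrow> hp_aut M"
    and mult: "\<And>M N. M \<in> \<G> \<Longrightarrow> N \<in> \<G> \<Longrightarrow> M ** N \<in> \<G>"
    and inv: "\<And>M. M \<in> \<G> \<Longrightarrow> \<exists>N\<in>\<G>. M ** N = mat 1 \<and> N ** M = mat 1"
    and D: "compact D" "D \<subseteq> HP" and cover: "\<And>z. z \<in> HP \<Longrightarrow> \<exists>M\<in>\<G>. mob M z \<in> interior D"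
begin

definition qds :: "(complex \<Rightarrow> complex) set" where
  "qds = {\<phi>. \<phi> holomorphic_on HP \<and> (\<forall>M\<in>\<G>. automorphic M \<phi>)}"

definition dsup :: "(complex \<Rightarrow> complex) \<Rightarrow> real" where
  "dsup \<phi> = (SUP z\<in>D. cmod (\<phi> z))"

lemma D_nonempty: "D \<noteq> {}"
proof -
  have "\<i> \<in> HP" by (simp add: upper_half_plane_def)
  then obtain M where "mob M \<i> \<in> interior D" using cover by blast
  then show ?thesis using interior_subset by blast
qed

lemma dsup_upper:
  assumes "\<phi> \<in> qds" "z \<in> D" shows "cmod (\<phi> z) \<le> dsup \<phi>"
proof -
  have "continuous_on D (\<lambda>z. cmod (\<phi> z))"
    using assms(1) D(2) unfolding qds_def
    by (intro continuous_on_norm) (auto intro: continuous_on_subset holomorphic_on_imp_continuous_on)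
  then have "bdd_above ((\<lambda>z. cmod (\<phi> z)) ` D)"
    by (intro bounded_imp_bdd_above compact_imp_bounded compact_continuous_image D(1))
  then show ?thesis unfolding dsup_def using assms(2) by (rule cSUP_upper[rotated])
qed

lemma dsup_attained:
  assumes "\<phi> \<in> qds" shows "\<exists>z\<in>D. dsup \<phi> = cmod (\<phi> z)"
proof -
  have "continuous_on D (\<lambda>z. cmod (\<phi> z))"
    using assms(1) D(2) unfolding qds_def
    by (intro continuous_on_norm) (auto intro: continuous_on_subset holomorphic_on_imp_continuous_on)
  then obtain z where z: "z \<in> D" "\<And>w. w \<in> D \<Longrightarrow> cmod (\<phi> w) \<le> cmod (\<phi> z)"
    using continuous_attains_sup[OF D(1) D_nonempty] by blast
  have "dsup \<phi> \<le> cmod (\<phi> z)" unfolding dsup_def by (rule cSUP_least[OF D_nonempty z(2)])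
  then show ?thesis using dsup_upper[OF assms z(1)] z(1) by (intro bexI[of _ z]) auto
qed

lemma dsup_nonneg: "\<phi> \<in> qds \<Longrightarrow> 0 \<le> dsup \<phi>"
  using dsup_attained by fastforce

text \<open>Finitely many group elements move the points of \<open>K\<close> into \<open>D\<close>, and their automorphy factors are
  bounded below on \<open>K\<close>.\<close>

lemma dsup_controls:
  assumes K: "compact K" "K \<subseteq> HP"
  shows "\<exists>C>0. \<forall>\<phi>\<in>qds. \<forall>z\<in>K. cmod (\<phi> z) \<le> C * dsup \<phi>"
proof -
  define O' where "O' = (\<lambda>M. {w \<in> HP. mob M w \<in> interior D})"
  have cm: "continuous_on HP (mob M)" if "M \<in> \<G>" for M
    using mob_deriv[OF aut[OF that]] by (intro continuous_at_imp_continuous_on ballI) (blast intro: DERIV_isCont)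
  have oO: "open (O' M)" if "M \<in> \<G>" for M
    using continuous_open_preimage[OF cm[OF that] open_HP open_interior, of D]
    by (simp add: O'_def vimage_def Int_def)
  have "K \<subseteq> (\<Union>M\<in>\<G>. O' M)" using K(2) cover unfolding O'_def by blast
  then obtain F where F: "F \<subseteq> \<G>" "finite F" "K \<subseteq> (\<Union>M\<in>F. O' M)"
    using compactE_image[OF K(1), of \<G> O'] oO by metis
  have "\<exists>C>0. \<forall>z\<in>K. 1 / cmod (jf M z)^4 \<le> C" if "M \<in> \<G>" for M
  proof -
    have "continuous_on K (\<lambda>z. 1 / cmod (jf M z)^4)"
      using aut[OF that] K(2) unfolding hp_aut_def jf_def by (intro continuous_intros) auto
    then have "bounded ((\<lambda>z. 1 / cmod (jf M z)^4) ` K)" using compact_continuous_image compact_imp_bounded K(1) by blast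
    then show ?thesis unfolding bounded_pos by fastforce
  qed
  then obtain C where C: "\<And>M. M \<in> \<G> \<Longrightarrow> C M > 0" "\<And>M z. M \<in> \<G> \<Longrightarrow> z \<in> K \<Longrightarrow> 1 / cmod (jf M z)^4 \<le> C M" by metis
  define S where "S = (\<Sum>M\<in>F. C M) + 1"
  have CS: "C M \<le> S" if "M \<in> F" for M
  proof -
    have "C M \<le> (\<Sum>M\<in>F. C M)" by (rule member_le_sum[OF that]) (use F C in \<open>auto intro: less_imp_le\<close>)
    then show ?thesis by (simp add: S_def)
  qed
  have "S > 0" unfolding S_def using F C by (intro add_nonneg_pos sum_nonneg) (auto intro: less_imp_le)
  moreover have "cmod (\<phi> z) \<le> S * dsup \<phi>" if \<phi>: "\<phi> \<in> qds" and z: "z \<in> K" for \<phi> z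
  proof -
    obtain M where M: "M \<in> F" "z \<in> O' M" using F(3) z by blast
    then have MG: "M \<in> \<G>" using F by blast
    have zH: "z \<in> HP" using K z by blast
    have j: "jf M z \<noteq> 0" using aut[OF MG] zH by (simp add: hp_aut_def)
    have "\<phi> (mob M z) = \<phi> z * jf M z ^ 4" using \<phi> MG zH by (auto simp: qds_def automorphic_def)
    then have "\<phi> z = \<phi> (mob M z) / jf M z ^ 4" using j by simp
    then have "cmod (\<phi> z) = (1 / cmod (jf M z)^4) * cmod (\<phi> (mob M z))" by (simp add: norm_divide norm_power)
    also have "\<dots> \<le> C M * dsup \<phi>"
    proof (rule mult_mono)
      show "cmod (\<phi> (mob M z)) \<le> dsup \<phi>"
        using M(2) interior_subset unfolding O'_def by (intro dsup_upper[OF \<phi>]) blast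
    qed (use C[OF MG] z in \<open>auto intro: less_imp_le\<close>)
    also have "\<dots> \<le> S * dsup \<phi>" by (intro mult_right_mono CS M dsup_nonneg \<phi>)
    finally show ?thesis .
  qed
  ultimately show ?thesis by blast
qed

text \<open>Montel's theorem. The limit is nonzero since the normalised functions attain the absolute value one on
  the compact set \<open>D\<close>.\<close>

lemma normal_family:
  assumes \<phi>: "\<And>n. \<phi> n \<in> qds" and pos: "\<And>n::nat. dsup (\<phi> n) > 0"
  shows "\<exists>q r. q holomorphic_on HP \<and> strict_mono (r :: nat \<Rightarrow> nat) \<and> (\<exists>w\<in>HP. q w \<noteq> 0) \<and>
     (\<forall>K. compact K \<longrightarrow> K \<subseteq> HP \<longrightarrow> uniform_limit K (\<lambda>n z. \<phi> (r n) z / of_real (dsup (\<phi> (r n)))) q sequentially)"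
proof -
  define F where "F = (\<lambda>n z. \<phi> n z / of_real (dsup (\<phi> n)))"
  have Fh: "F n holomorphic_on HP" for n
    using \<phi>[of n] pos[of n] unfolding F_def qds_def by (intro holomorphic_intros) auto
  obtain q r where q: "q holomorphic_on HP" "strict_mono (r :: nat \<Rightarrow> nat)"
     "\<And>K. compact K \<Longrightarrow> K \<subseteq> HP \<Longrightarrow> uniform_limit K (F \<circ> r) q sequentially"
  proof (rule Montel[OF open_HP, of "range F" F])
    fix K assume "compact K" "K \<subseteq> HP"
    then obtain C where C: "C > 0" "\<forall>\<phi>\<in>qds. \<forall>z\<in>K. cmod (\<phi> z) \<le> C * dsup \<phi>" using dsup_controls by blast
    have "cmod (F n z) \<le> C" if "z \<in> K" for n z
      using C(2) \<phi>[of n] pos[of n] that by (simp add: F_def norm_divide divide_le_eq)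
    then show "\<exists>B. \<forall>h\<in>range F. \<forall>z\<in>K. cmod (h z) \<le> B" by blast
  qed (use Fh that in auto)
  have "\<exists>w\<in>HP. q w \<noteq> 0"
  proof (rule ccontr)
    assume "\<not> ?thesis"
    then have q0: "q z = 0" if "z \<in> D" for z using that D(2) by blast
    have "\<forall>\<^sub>F n in sequentially. \<forall>z\<in>D. dist ((F \<circ> r) n z) (q z) < 1"
      by (rule uniform_limitD[OF q(3)[OF D]]) simp
    then obtain n where n: "\<forall>z\<in>D. dist ((F \<circ> r) n z) (q z) < 1"
      using eventually_happens'[OF sequentially_bot] by blast
    obtain z where z: "z \<in> D" "dsup (\<phi> (r n)) = cmod (\<phi> (r n) z)" using dsup_attained[OF \<phi>] by blast
    have "cmod (F (r n) z) = 1" using z(2) pos[of "r n"] by (simp add: F_def norm_divide)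
    then show False using n z(1) q0[OF z(1)] by (auto simp: dist_norm)
  qed
  then show ?thesis using q unfolding F_def o_def by blast
qed

text \<open>The group element and the subsequence depend on the sequence; for an argument by contradiction
  this is enough.\<close>

theorem trace_lower_growth:
  assumes \<phi>: "\<And>n. \<phi> n \<in> qds" and pos: "\<And>n::nat. dsup (\<phi> n) > 0" and lim: "filterlim (\<lambda>n. dsup (\<phi> n)) at_top sequentially"
  shows "\<exists>N\<in>\<G>. \<exists>c>0. \<exists>r::nat \<Rightarrow> nat. strict_mono r \<and>
     (\<forall>\<^sub>F n in sequentially. \<forall>\<tau>. is_mtrace (\<phi> (r n)) N \<tau> \<longrightarrow> exp (c * sqrt (dsup (\<phi> (r n)))) - 1 \<le> cmod \<tau>)"
proof -
  obtain q and r :: "nat \<Rightarrow> nat" where q: "q holomorphic_on HP" "strict_mono r" "\<exists>w\<in>HP. q w \<noteq> 0"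
     "\<forall>K. compact K \<longrightarrow> K \<subseteq> HP \<longrightarrow> uniform_limit K (\<lambda>n z. \<phi> (r n) z / of_real (dsup (\<phi> (r n)))) q sequentially"
    using normal_family[of \<phi>, OF \<phi> pos] by (elim exE conjE) (rule that, assumption+)
  define t where "t = (\<lambda>n. sqrt (dsup (\<phi> (r n))))"
  have t2: "(t n)^2 = dsup (\<phi> (r n))" for n using pos[of "r n"] by (simp add: t_def)
  interpret wkb_seq "\<lambda>n. \<phi> (r n)" t q \<G>
  proof
    show "\<phi> (r n) holomorphic_on HP" for n using \<phi> by (simp add: qds_def)
    show "q holomorphic_on HP" by (rule q(1))
    show "t n > 0" for n using pos by (simp add: t_def)
    have "filterlim (\<lambda>n. dsup (\<phi> (r n))) at_top sequentially"
      by (rule filterlim_compose[OF lim filterlim_subseq[OF q(2)]])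
    then show "filterlim t at_top sequentially" unfolding t_def
      by (rule filterlim_compose[OF sqrt_at_top])
    show "uniform_limit K (\<lambda>n z. \<phi> (r n) z / of_real ((t n)^2)) q sequentially" if "compact K" "K \<subseteq> HP" for K
      unfolding t2 using q(4) that by simp
    show "hp_aut M" if "M \<in> \<G>" for M by (rule aut[OF that])
    show "automorphic M (\<phi> (r n))" if "M \<in> \<G>" for M n using \<phi> that by (simp add: qds_def)
    show "M ** N \<in> \<G>" if "M \<in> \<G>" "N \<in> \<G>" for M N by (rule mult[OF that])
    show "\<exists>N\<in>\<G>. M ** N = mat 1 \<and> N ** M = mat 1" if "M \<in> \<G>" for M by (rule inv[OF that])
  qed
  have "\<exists>M\<in>\<G>. mob M z \<in> D" if "z \<in> HP" for z using cover[OF that] interior_subset by blast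
  from wkb_loop[OF D this q(3)] obtain N c where "N \<in> \<G>" "c > 0"
     "\<forall>\<^sub>F n in sequentially. \<forall>\<tau>. is_mtrace (\<phi> (r n)) N \<tau> \<longrightarrow> exp (c * t n) - 1 \<le> cmod \<tau>" by blast
  then show ?thesis using q(2) unfolding t_def by blast
qed

text \<open>Gronwall's inequality for the energy \<open>e = \<kappa>\<^sup>2 \<bar>u\<bar>\<^sup>2 + \<bar>u'\<bar>\<^sup>2\<close> on the segment. With the weight \<open>\<kappa>\<^sup>2\<close> of the
  order of \<open>\<phi>\<close>, both terms of the derivative are at most a multiple of \<open>\<kappa> e\<close>, and not only of \<open>\<kappa>\<^sup>2 e\<close>.\<close>

lemma solution_growth:
  assumes K: "closed_segment a b \<subseteq> HP"
  shows "\<exists>L\<ge>0. \<forall>\<phi>\<in>qds. \<forall>u. is_sol \<phi> u \<longrightarrow> cmod (u a) \<le> 1 \<longrightarrow> cmod (deriv u a) \<le> 1 \<longrightarrow>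
     cmod (u b) \<le> exp (L * (1 + sqrt (dsup \<phi>))) \<and> cmod (deriv u b) \<le> exp (L * (1 + sqrt (dsup \<phi>)))"
proof -
  obtain C where C: "C > 0" "\<And>\<phi> z. \<phi> \<in> qds \<Longrightarrow> z \<in> closed_segment a b \<Longrightarrow> cmod (\<phi> z) \<le> C * dsup \<phi>"
    using dsup_controls[OF compact_segment K] by blast
  define d where "d = b - a"
  define l where "l = cmod d * (2 + C)"
  have l0: "l \<ge> 0" using C by (simp add: l_def)
  define L where "L = l / 2 + 2"
  have "cmod (u b) \<le> exp (L * (1 + sqrt (dsup \<phi>))) \<and> cmod (deriv u b) \<le> exp (L * (1 + sqrt (dsup \<phi>)))"
    if \<phi>: "\<phi> \<in> qds" and u: "is_sol \<phi> u" "cmod (u a) \<le> 1" "cmod (deriv u a) \<le> 1" for \<phi> u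
  proof -
    define \<kappa> where "\<kappa> = 1 + sqrt (dsup \<phi>)"
    have \<kappa>: "\<kappa> \<ge> 1" using dsup_nonneg[OF \<phi>] by (simp add: \<kappa>_def)
    have "dsup \<phi> = (sqrt (dsup \<phi>))^2" using dsup_nonneg[OF \<phi>] by simp
    also have "\<dots> \<le> \<kappa>^2" using dsup_nonneg[OF \<phi>] by (intro power_mono) (auto simp: \<kappa>_def)
    finally have d\<kappa>: "dsup \<phi> \<le> \<kappa>^2" .
    define g where "g = (\<lambda>s::real. a + of_real s * d)"
    have gs: "g s \<in> closed_segment a b" if "0 \<le> s" "s \<le> 1" for s
      using that unfolding in_segment g_def d_def by (intro exI[of _ s]) (auto simp: algebra_simps scaleR_conv_of_real)
    have gH: "g s \<in> HP" if "0 \<le> s" "s \<le> 1" for s using gs[OF that] K by blast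
    have dg: "(g has_vector_derivative d) (at s)" for s
      unfolding g_def by (auto intro!: derivative_eq_intros simp: has_vector_derivative_def scaleR_conv_of_real)
    define x where "x = (\<lambda>s. u (g s))"
    define y where "y = (\<lambda>s. deriv u (g s))"
    have dx: "(x has_vector_derivative d * y s) (at s)"
      and dy: "(y has_vector_derivative d * (- (\<phi> (g s) / 2) * x s)) (at s)" if "0 \<le> s" "s \<le> 1" for s
      using field_vector_diff_chain_at[OF dg is_solD(1)[OF u(1) gH[OF that]]]
        field_vector_diff_chain_at[OF dg is_solD(2)[OF u(1) gH[OF that]]] by (simp_all add: o_def x_def y_def)
    have der: "((\<lambda>s. h s \<bullet> h s) has_real_derivative 2 * (h s \<bullet> h')) (at s)"
      if "(h has_vector_derivative h') (at s)" for h :: "real \<Rightarrow> complex" and h' s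
      using has_derivative_inner[OF that[unfolded has_vector_derivative_def] that[unfolded has_vector_derivative_def]]
      unfolding has_field_derivative_def
      by (rule has_derivative_eq_rhs) (auto simp: fun_eq_iff inner_commute)
    define e where "e = (\<lambda>s. \<kappa>^2 * (cmod (x s))^2 + (cmod (y s))^2)"
    define e' where "e' = (\<lambda>s. \<kappa>^2 * (2 * (x s \<bullet> (d * y s))) + 2 * (y s \<bullet> (d * (- (\<phi> (g s) / 2) * x s))))"
    have de: "(e has_real_derivative e' s) (at s)" if "0 \<le> s" "s \<le> 1" for s
      using DERIV_add[OF DERIV_cmult[OF der[OF dx[OF that]], of "\<kappa>^2"] der[OF dy[OF that]]]
      by (simp add: e_def e'_def dot_square_norm)
    have e'le: "e' s \<le> l * \<kappa> * e s" if s: "0 \<le> s" "s \<le> 1" for s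
    proof -
      let ?X = "cmod (x s)" and ?Y = "cmod (y s)"
      have 1: "x s \<bullet> (d * y s) \<le> ?X * (cmod d * ?Y)"
        using Cauchy_Schwarz_ineq2[of "x s" "d * y s"] by (simp add: norm_mult)
      have "y s \<bullet> (d * (- (\<phi> (g s) / 2) * x s)) \<le> ?Y * (cmod d * (cmod (\<phi> (g s)) / 2 * ?X))"
        using Cauchy_Schwarz_ineq2[of "y s" "d * (- (\<phi> (g s) / 2) * x s)"] by (simp add: norm_mult norm_divide)
      also have "\<dots> \<le> ?Y * (cmod d * (C * \<kappa>^2 / 2 * ?X))"
      proof -
        have "cmod (\<phi> (g s)) \<le> C * \<kappa>^2" using C(2)[OF \<phi> gs[OF s]] mult_left_mono[OF d\<kappa>, of C] C(1) by linarith
        then show ?thesis by (intro mult_left_mono mult_right_mono divide_right_mono) auto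
      qed
      finally have 2: "y s \<bullet> (d * (- (\<phi> (g s) / 2) * x s)) \<le> ?Y * (cmod d * (C * \<kappa>^2 / 2 * ?X))" .
      have "e' s \<le> \<kappa>^2 * (2 * (?X * (cmod d * ?Y))) + 2 * (?Y * (cmod d * (C * \<kappa>^2 / 2 * ?X)))"
        unfolding e'_def using 1 2 by (intro add_mono mult_left_mono) auto
      also have "\<dots> = l * \<kappa> * (\<kappa> * ?X * ?Y)" by (simp add: l_def algebra_simps power2_eq_square)
      also have "\<dots> \<le> l * \<kappa> * e s"
      proof (rule mult_left_mono)
        have "2 * ((\<kappa> * ?X) * ?Y) \<le> (\<kappa> * ?X)^2 + ?Y^2" using sum_squares_bound[of "\<kappa> * ?X" ?Y] by simp
        moreover have "0 \<le> (\<kappa> * ?X) * ?Y" using \<kappa> by simp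
        ultimately show "\<kappa> * ?X * ?Y \<le> e s" unfolding e_def by (simp add: power_mult_distrib)
      qed (use l0 \<kappa> in auto)
      finally show ?thesis .
    qed
    have "(\<lambda>s. exp (- (l * \<kappa>) * s) * e s) 1 \<le> (\<lambda>s. exp (- (l * \<kappa>) * s) * e s) 0"
    proof (rule DERIV_nonpos_imp_nonincreasing[OF zero_le_one])
      fix s :: real assume s: "0 \<le> s" "s \<le> 1"
      let ?d = "exp (- (l * \<kappa>) * s) * (- (l * \<kappa>)) * e s + e' s * exp (- (l * \<kappa>) * s)"
      have "((\<lambda>s. exp (- (l * \<kappa>) * s)) has_real_derivative exp (- (l * \<kappa>) * s) * (- (l * \<kappa>))) (at s)"
        by (rule derivative_eq_intros refl | simp)+
      from DERIV_mult[OF this de[OF s]]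
      have "((\<lambda>s. exp (- (l * \<kappa>) * s) * e s) has_real_derivative ?d) (at s)" .
      moreover have "?d = exp (- (l * \<kappa>) * s) * (e' s - l * \<kappa> * e s)" by (simp add: algebra_simps)
      then have "?d \<le> 0" using e'le[OF s] by (simp add: mult_nonneg_nonpos)
      ultimately show "\<exists>d. ((\<lambda>s. exp (- (l * \<kappa>) * s) * e s) has_real_derivative d) (at s) \<and> d \<le> 0" by blast
    qed
    then have "e 1 \<le> exp (l * \<kappa>) * e 0" by (simp add: exp_minus field_simps)
    also have "e 0 \<le> 2 * \<kappa>^2"
    proof -
      have "cmod (x 0)^2 \<le> 1" "cmod (y 0)^2 \<le> 1" using u(2,3) by (simp_all add: x_def y_def g_def power_le_one)
      then have "\<kappa>^2 * cmod (x 0)^2 \<le> \<kappa>^2 * 1" by (intro mult_left_mono) auto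
      moreover have "1 \<le> \<kappa>^2" using \<kappa> by simp
      ultimately show ?thesis using \<open>cmod (y 0)^2 \<le> 1\<close> unfolding e_def by linarith
    qed
    finally have e1: "e 1 \<le> exp (l * \<kappa>) * (2 * \<kappa>^2)" by simp
    have "2 * \<kappa>^2 \<le> (exp (2 * \<kappa>))^2"
    proof -
      have "1 + 2 * \<kappa> \<le> exp (2 * \<kappa>)" by (rule exp_ge_add_one_self)
      then have "2 * \<kappa> \<le> exp (2 * \<kappa>)" by linarith
      then have "(2 * \<kappa>)^2 \<le> (exp (2 * \<kappa>))^2" using \<kappa> by (intro power_mono) auto
      then have "4 * \<kappa>^2 \<le> (exp (2 * \<kappa>))^2" by (simp only: power_mult_distrib) simp
      moreover have "0 \<le> \<kappa>^2" by simp
      ultimately show ?thesis by linarith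
    qed
    then have "exp (l * \<kappa>) * (2 * \<kappa>^2) \<le> exp (l * \<kappa>) * (exp (2 * \<kappa>))^2" by simp
    also have "\<dots> = (exp (L * \<kappa>))^2" by (simp add: L_def exp_add[symmetric] algebra_simps flip: exp_double)
    finally have e2: "e 1 \<le> (exp (L * \<kappa>))^2" using e1 by linarith
    have "1 * cmod (x 1)^2 \<le> \<kappa>^2 * cmod (x 1)^2" using \<kappa> by (intro mult_right_mono) auto
    then have "cmod (x 1)^2 \<le> (exp (L * \<kappa>))^2" "cmod (y 1)^2 \<le> (exp (L * \<kappa>))^2" using e2 unfolding e_def
      by (smt (verit) zero_le_power2)+
    then have "cmod (x 1) \<le> exp (L * \<kappa>)" "cmod (y 1) \<le> exp (L * \<kappa>)" by (auto intro: power2_le_imp_le)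
    then show ?thesis by (simp add: x_def y_def g_def d_def \<kappa>_def)
  qed
  moreover have "L \<ge> 0" using l0 by (simp add: L_def)
  ultimately show ?thesis by blast
qed

theorem trace_upper_growth:
  assumes M: "M \<in> \<G>"
  shows "\<exists>A B. \<forall>\<phi>\<in>qds. \<forall>\<tau>. is_mtrace \<phi> M \<tau> \<longrightarrow> cmod \<tau> \<le> exp (A * sqrt (dsup \<phi>) + B)"
proof -
  have iH: "\<i> \<in> HP" by (simp add: upper_half_plane_def)
  have Mi: "mob M \<i> \<in> HP" "jf M \<i> \<noteq> 0" using aut[OF M] iH by (auto simp: hp_aut_def)
  have seg: "closed_segment \<i> (mob M \<i>) \<subseteq> HP" by (rule closed_segment_subset[OF iH Mi(1) convex_HP])
  obtain L where L: "L \<ge> 0" "\<And>\<phi> u. \<phi> \<in> qds \<Longrightarrow> is_sol \<phi> u \<Longrightarrow> cmod (u \<i>) \<le> 1 \<Longrightarrow> cmod (deriv u \<i>) \<le> 1 \<Longrightarrow>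
     cmod (u (mob M \<i>)) \<le> exp (L * (1 + sqrt (dsup \<phi>))) \<and> cmod (deriv u (mob M \<i>)) \<le> exp (L * (1 + sqrt (dsup \<phi>)))"
    using solution_growth[OF seg] by metis
  define S where "S = cmod (jf M \<i>) + cmod (mC M) + 1 / cmod (jf M \<i>)"
  have S: "S > 0" unfolding S_def using Mi(2) by (intro add_pos_pos add_pos_nonneg) auto
  have "cmod \<tau> \<le> exp (L * sqrt (dsup \<phi>) + (L + ln S))" if \<phi>: "\<phi> \<in> qds" and \<tau>: "is_mtrace \<phi> M \<tau>" for \<phi> \<tau>
  proof -
    have ho: "\<phi> holomorphic_on HP" and au: "automorphic M \<phi>" using \<phi> M by (auto simp: qds_def)
    obtain u1 where u1: "is_sol \<phi> u1" "u1 \<i> = 1" "deriv u1 \<i> = 0" using is_sol_exists[OF ho iH] by blast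
    obtain u2 where u2: "is_sol \<phi> u2" "u2 \<i> = 0" "deriv u2 \<i> = 1" using is_sol_exists[OF ho iH] by blast
    let ?E = "exp (L * (1 + sqrt (dsup \<phi>)))"
    have "\<tau> = slash M u1 \<i> + deriv (slash M u2) \<i>" by (rule is_mtrace_formula[OF aut[OF M] \<tau> iH u1 u2])
    also have "\<dots> = jf M \<i> * u1 (mob M \<i>) + (mC M * u2 (mob M \<i>) + deriv u2 (mob M \<i>) / jf M \<i>)"
      unfolding slash_sol(2)[OF aut[OF M] au u2(1) iH] by (simp add: slash_def)
    finally have "cmod \<tau> \<le> cmod (jf M \<i>) * cmod (u1 (mob M \<i>)) + (cmod (mC M) * cmod (u2 (mob M \<i>)) + cmod (deriv u2 (mob M \<i>)) / cmod (jf M \<i>))"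
      using norm_triangle_le norm_triangle_ineq by (smt (verit) norm_mult norm_divide)
    also have "\<dots> \<le> cmod (jf M \<i>) * ?E + (cmod (mC M) * ?E + ?E / cmod (jf M \<i>))"
      using L(2)[OF \<phi> u1(1)] L(2)[OF \<phi> u2(1)] u1 u2 by (intro add_mono mult_left_mono divide_right_mono) auto
    also have "\<dots> = S * ?E" by (simp add: S_def algebra_simps)
    also have "\<dots> = exp (L * sqrt (dsup \<phi>) + (L + ln S))" using S by (simp add: exp_add algebra_simps)
    finally show ?thesis .
  qed
  then show ?thesis by blast
qed

end

section \<open>Deck transformations of the universal cover\<close>

definition unit_seq :: "nat \<Rightarrow> nat \<Rightarrow>\<^sub>C real" where
  "unit_seq j = Bcontfun (\<lambda>k. if k = j then 1 else 0)"

lemma apply_unit_seq: "apply_bcontfun (unit_seq j) k = (if k = j then 1 else 0)"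
proof -
  have "(\<lambda>k::nat. if k = j then 1 else 0 :: real) \<in> bcontfun"
    by (rule bcontfun_normI[where b = 1]) auto
  then show ?thesis unfolding unit_seq_def by (simp add: Bcontfun_inverse)
qed

lemma apply_bcontfun_sum:
  "apply_bcontfun (\<Sum>i\<in>I. f i) x = (\<Sum>i\<in>I. apply_bcontfun (f i) x)" for f :: "'i \<Rightarrow> 'a::topological_space \<Rightarrow>\<^sub>C real"
  by (induction I rule: infinite_finite_induct) auto

text \<open>The values of the functions serve as coordinates. The bounded sequences are used as one normed
  space that contains tuples of every length.\<close>

lemma separating_functions_embedding:
  fixes J :: "('a::topological_space \<Rightarrow> real) set"
  assumes J: "finite J" "\<And>f. f \<in> J \<Longrightarrow> continuous_on X f"
    and sep: "\<And>x y. x \<in> X \<Longrightarrow> y \<in> X \<Longrightarrow> (\<And>f. f \<in> J \<Longrightarrow> f x = f y) \<Longrightarrow> x = y"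
  shows "\<exists>e :: 'a \<Rightarrow> nat \<Rightarrow>\<^sub>C real. continuous_on X e \<and> inj_on e X"
proof -
  obtain fs where fs: "set fs = J" using finite_list[OF J(1)] by blast
  define e where "e = (\<lambda>y. \<Sum>j<length fs. (fs ! j) y *\<^sub>R unit_seq j)"
  have ej: "apply_bcontfun (e y) j = (fs ! j) y" if "j < length fs" for y j
  proof -
    have "apply_bcontfun (e y) j = (\<Sum>i<length fs. (fs ! i) y * (if j = i then 1 else 0))"
      by (simp add: e_def apply_bcontfun_sum apply_unit_seq)
    also have "\<dots> = (\<Sum>i<length fs. if i = j then (fs ! j) y else 0)" by (rule sum.cong) auto
    also have "\<dots> = (fs ! j) y" using that by simp
    finally show ?thesis .
  qed
  have "continuous_on X e" unfolding e_def
    by (intro continuous_intros) (use J(2) fs nth_mem in blast)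
  moreover have "inj_on e X"
  proof (rule inj_onI)
    fix x y assume xy: "x \<in> X" "y \<in> X" "e x = e y"
    show "x = y"
    proof (rule sep[OF xy(1,2)])
      fix f assume "f \<in> J"
      then obtain j where "j < length fs" "fs ! j = f" using fs by (metis in_set_conv_nth)
      then show "f x = f y" using ej xy(3) by metis
    qed
  qed
  ultimately show ?thesis by blast
qed

lemma riemann_surface_chartD:
  assumes "riemann_surface X \<A>" "(U, f) \<in> \<A>"
  shows "openin (top_of_set X) U" "open (f ` U)" "continuous_on U f" "inj_on f U" "U \<subseteq> X"
    "\<exists>f'. homeomorphism U (f ` U) f f'"
proof -
  have *: "openin (top_of_set X) U \<and> open (f ` U) \<and> (\<exists>f'. homeomorphism U (f ` U) f f')"
    using assms unfolding riemann_surface_def by blast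
  then obtain f' where f': "homeomorphism U (f ` U) f f'" by blast
  show "openin (top_of_set X) U" "open (f ` U)" "\<exists>f'. homeomorphism U (f ` U) f f'" using * by auto
  then show "U \<subseteq> X" by (auto dest: openin_imp_subset)
  show "continuous_on U f" using f' by (simp add: homeomorphism_def)
  show "inj_on f U" using f' unfolding homeomorphism_def by (metis inj_on_inverseI)
qed

lemma riemann_surface_chart_ex:
  assumes "riemann_surface X \<A>" "x \<in> X"
  shows "\<exists>U f. (U, f) \<in> \<A> \<and> x \<in> U"
  using assms unfolding riemann_surface_def by blast

text \<open>Continuity at the boundary of the chart: the function vanishes off a compact set in the chart, and in a
  Hausdorff space this set is closed.\<close>

lemma chart_bump_continuous:
  assumes rs: "riemann_surface X \<A>" and c: "(U, f) \<in> \<A>" and r: "cball (f x) r \<subseteq> f ` U"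
    and G: "continuous_on UNIV G" "\<And>w. w \<notin> ball (f x) r \<Longrightarrow> G w = (0::real)"
  shows "continuous_on X (\<lambda>y. if y \<in> U then G (f y) else 0)"
proof -
  note cD = riemann_surface_chartD[OF rs c]
  obtain f' where f': "homeomorphism U (f ` U) f f'" using cD(6) by blast
  define K where "K = f' ` cball (f x) r"
  have "continuous_on (cball (f x) r) f'" using f' r unfolding homeomorphism_def by (metis continuous_on_subset)
  then have "compact K" unfolding K_def by (intro compact_continuous_image) auto
  then have K: "closed K" by (rule compact_imp_closed)
  have UX: "X = U \<union> (X - K)"
  proof -
    have "K \<subseteq> U" using image_mono[OF r, of f'] f' by (simp add: K_def homeomorphism_def)
    then show ?thesis using cD(5) by blast
  qed
  have oK: "openin (top_of_set X) (X - K)" using K openin_open_Int[of "- K" X] by (simp add: Diff_eq open_Compl)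
  have "continuous_on (U \<union> (X - K)) (\<lambda>y. if y \<in> U then G (f y) else 0)"
  proof (rule continuous_on_Un_local_open)
    show "openin (top_of_set (U \<union> (X - K))) U" "openin (top_of_set (U \<union> (X - K))) (X - K)"
      using cD(1) oK UX by simp_all
    have "continuous_on U (\<lambda>y. G (f y))"
      by (rule continuous_on_compose2[OF G(1) cD(3)]) auto
    then show "continuous_on U (\<lambda>y. if y \<in> U then G (f y) else 0)"
      by (rule continuous_on_eq) simp
    have "(if y \<in> U then G (f y) else 0) = 0" if "y \<in> X - K" for y
    proof (cases "y \<in> U")
      case True
      have "f y \<notin> ball (f x) r"
      proof
        assume "f y \<in> ball (f x) r"
        moreover have "f' (f y) = y" using f' True unfolding homeomorphism_def by blast
        ultimately have "y \<in> K" unfolding K_def by (metis ball_subset_cball image_eqI subsetD)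
        then show False using that by blast
      qed
      then show ?thesis using G(2) by simp
    qed simp
    then show "continuous_on (X - K) (\<lambda>y. if y \<in> U then G (f y) else 0)"
      by (intro continuous_on_eq[OF continuous_on_const[of _ 0]]) simp
  qed
  then show ?thesis using UX by simp
qed

text \<open>Bump functions on finitely many discs, and their products with the two real coordinates, separate
  points. The embedding makes the base of the covering a subset of a normed space, to which the
  lifting theorems for covering spaces apply.\<close>

lemma riemann_surface_embedding:
  fixes X :: "'a::t2_space set"
  assumes rs: "riemann_surface X \<A>" and cX: "compact X"
  shows "\<exists>e :: 'a \<Rightarrow> nat \<Rightarrow>\<^sub>C real. continuous_on X e \<and> inj_on e X"
proof -
  have "\<forall>x\<in>X. \<exists>U f r. (U, f) \<in> \<A> \<and> x \<in> U \<and> r > 0 \<and> cball (f x) r \<subseteq> f ` U"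
  proof
    fix x assume "x \<in> X"
    then obtain U f where c: "(U, f) \<in> \<A>" "x \<in> U" using riemann_surface_chart_ex[OF rs] by blast
    then have "\<exists>r>0. cball (f x) r \<subseteq> f ` U"
      using riemann_surface_chartD(2)[OF rs c(1)] open_contains_cball by blast
    then show "\<exists>U f r. (U, f) \<in> \<A> \<and> x \<in> U \<and> r > 0 \<and> cball (f x) r \<subseteq> f ` U" using c by blast
  qed
  then obtain U f r where c: "\<And>x. x \<in> X \<Longrightarrow> (U x, f x) \<in> \<A>" "\<And>x. x \<in> X \<Longrightarrow> x \<in> U x" "\<And>x. x \<in> X \<Longrightarrow> r x > 0"
      "\<And>x. x \<in> X \<Longrightarrow> cball (f x x) (r x) \<subseteq> f x ` U x" by metis
  define N where "N = (\<lambda>x. U x \<inter> f x -` ball (f x x) (r x))"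
  have oN: "openin (top_of_set X) (N x)" if "x \<in> X" for x
  proof -
    have "openin (top_of_set (U x)) (N x)" unfolding N_def
      by (rule continuous_openin_preimage_gen[OF riemann_surface_chartD(3)[OF rs c(1)[OF that]] open_ball])
    then show ?thesis using riemann_surface_chartD(1)[OF rs c(1)[OF that]] openin_trans by blast
  qed
  have xN: "x \<in> N x" if "x \<in> X" for x using c that by (simp add: N_def)
  obtain O' where O': "\<And>x. x \<in> X \<Longrightarrow> open (O' x) \<and> N x = X \<inter> O' x"
    using oN unfolding openin_open by metis
  have "X \<subseteq> (\<Union>x\<in>X. O' x)" using xN O' by blast
  then obtain C where C: "C \<subseteq> X" "finite C" "X \<subseteq> (\<Union>x\<in>C. O' x)"
    using compactE_image[OF cX, of X O'] O' by metis
  define b where "b = (\<lambda>x w. max 0 (r x - dist (f x x) w))"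
  define F where "F = (\<lambda>x G y. if y \<in> U x then (G (f x y) :: real) else 0)"
  define J where "J = (\<Union>x\<in>C. {F x (b x), F x (\<lambda>w. b x w * Re w), F x (\<lambda>w. b x w * Im w)})"
  have fJ: "finite J" unfolding J_def using C(2) by simp
  have cJ: "continuous_on X h" if hJ: "h \<in> J" for h
  proof -
    obtain x where x: "x \<in> C" "h \<in> {F x (b x), F x (\<lambda>w. b x w * Re w), F x (\<lambda>w. b x w * Im w)}"
      using hJ unfolding J_def by blast
    then have xX: "x \<in> X" using C(1) by blast
    have cb: "continuous_on UNIV (b x)" unfolding b_def by (intro continuous_intros)
    have z: "b x w = 0" if "w \<notin> ball (f x x) (r x)" for w using that by (simp add: b_def)
    have *: "continuous_on X (F x G)" if "continuous_on UNIV G" "\<And>w. w \<notin> ball (f x x) (r x) \<Longrightarrow> G w = 0" for G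
      unfolding F_def by (rule chart_bump_continuous[OF rs c(1)[OF xX] c(4)[OF xX] that])
    show ?thesis using x(2)
      by (elim insertE emptyE; simp only:; intro * continuous_intros cb; simp add: z)
  qed
  have sJ: "x = y" if xy: "x \<in> X" "y \<in> X" "\<And>h. h \<in> J \<Longrightarrow> h x = h y" for x y
  proof -
    obtain a where a: "a \<in> C" "x \<in> O' a" using C(3) xy(1) by blast
    then have aX: "a \<in> X" using C(1) by blast
    have xa: "x \<in> N a" using O'[OF aX] a xy by blast
    then have xU: "x \<in> U a" and bx: "b a (f a x) > 0" by (auto simp: N_def b_def)
    have h: "F a (b a) x = F a (b a) y" "F a (\<lambda>w. b a w * Re w) x = F a (\<lambda>w. b a w * Re w) y"
      "F a (\<lambda>w. b a w * Im w) x = F a (\<lambda>w. b a w * Im w) y"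
      using a(1) by (intro xy(3); force simp: J_def)+
    have yU: "y \<in> U a" and e: "b a (f a x) = b a (f a y)" using h(1) bx xU by (auto simp: F_def split: if_splits)
    have "Re (f a x) = Re (f a y)" "Im (f a x) = Im (f a y)"
      using h(2,3) bx xU yU e by (auto simp: F_def)
    then have "f a x = f a y" by (rule complex_eqI)
    then show ?thesis using riemann_surface_chartD(4)[OF rs c(1)[OF aX]] xU yU by (auto dest: inj_onD)
  qed
  show ?thesis
  proof (rule separating_functions_embedding[OF fJ cJ])
    fix x y assume a: "x \<in> X" "y \<in> X" "\<And>f. f \<in> J \<Longrightarrow> f x = f y"
    show "x = y" by (rule sJ[OF a])
  qed
qed

lemma covering_space_compose_embedding:
  assumes cov: "covering_space C p X" and e: "homeomorphism X Y e e'"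
  shows "covering_space C (e \<circ> p) Y"
proof
  have ce: "continuous_on X e" "continuous_on Y e'" "e ` X = Y" "e' ` Y = X" "\<And>x. x \<in> X \<Longrightarrow> e' (e x) = x" "\<And>y. y \<in> Y \<Longrightarrow> e (e' y) = y"
    using e by (auto simp: homeomorphism_def)
  have pC: "p ` C = X" "continuous_on C p" using cov by (auto simp: covering_space_def)
  show "continuous_on C (e \<circ> p)" using pC ce(1) by (intro continuous_on_compose) auto
  show "(e \<circ> p) ` C = Y" unfolding image_comp[symmetric] pC(1) ce(3) ..
  fix y assume y: "y \<in> Y"
  then have "e' y \<in> X" using ce(4) by blast
  then obtain T v where T: "e' y \<in> T" "openin (top_of_set X) T" and v: "\<Union>v = C \<inter> p -` T" "\<forall>u\<in>v. openin (top_of_set C) u"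
     "pairwise disjnt v" "\<forall>u\<in>v. \<exists>q. homeomorphism u T p q" using cov unfolding covering_space_def by meson
  have TX: "T \<subseteq> X" using T(2) openin_imp_subset by blast
  have eT: "homeomorphism T (e ` T) e e'" using e TX
    by (metis homeomorphism_of_subsets order_refl ce(3) image_mono)
  have oT: "openin (top_of_set Y) (e ` T)" using homeomorphism_imp_open_map[OF e T(2)] .
  have "C \<inter> (e \<circ> p) -` (e ` T) = C \<inter> p -` T"
  proof -
    have "p z \<in> T" if "z \<in> C" "e (p z) \<in> e ` T" for z
    proof -
      obtain x where x: "x \<in> T" "e (p z) = e x" using \<open>e (p z) \<in> e ` T\<close> by blast
      have "p z \<in> X" using pC(1) \<open>z \<in> C\<close> by blast
      then have "p z = x" using x TX ce(5) by (metis subsetD)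
      then show ?thesis using x by simp
    qed
    then show ?thesis by auto
  qed
  moreover have "\<exists>q. homeomorphism u (e ` T) (e \<circ> p) q" if uv: "u \<in> v" for u
  proof -
    obtain q where "homeomorphism u T p q" using bspec[OF v(4) uv] by (rule exE)
    from homeomorphism_compose[OF this eT] show ?thesis by blast
  qed
  moreover have "y \<in> e ` T" using T(1) ce(6)[OF y] by (metis image_eqI)
  ultimately show "\<exists>T. y \<in> T \<and> openin (top_of_set Y) T \<and> (\<exists>v. \<Union>v = C \<inter> (e \<circ> p) -` T \<and>
       (\<forall>u\<in>v. openin (top_of_set C) u) \<and> pairwise disjnt v \<and> (\<forall>u\<in>v. \<exists>q. homeomorphism u T (e \<circ> p) q))"
    using oT v by (intro exI[of _ "e ` T"] conjI exI[of _ v]) auto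
qed

lemma deck_group_carrier:
  "\<gamma> \<in> carrier (deck_group p) \<longleftrightarrow> \<gamma> \<in> Bij HP \<and> (\<exists>\<gamma>'. homeomorphism HP HP \<gamma> \<gamma>') \<and> (\<forall>z\<in>HP. p (\<gamma> z) = p z)"
  by (simp add: deck_group_def)

text \<open>The half-plane is simply connected, so that the covering map lifts along itself to maps \<open>g\<close> and \<open>h\<close> with
  \<open>g z = w\<close> and \<open>h w = z\<close>. Lifts with a common value agree, so these two are inverse to each other.\<close>

lemma deck_group_transitive:
  fixes X :: "'a::t2_space set"
  assumes rs: "riemann_surface X \<A>" and cX: "compact X" and cov: "covering_space HP p X"
    and z: "z \<in> HP" "w \<in> HP" "p z = p w"
  shows "\<exists>\<gamma>\<in>carrier (deck_group p). \<gamma> z = w"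
proof -
  obtain e :: "'a \<Rightarrow> nat \<Rightarrow>\<^sub>C real" where e: "continuous_on X e" "inj_on e X" using riemann_surface_embedding[OF rs cX] by blast
  obtain e' where e': "homeomorphism X (e ` X) e e'" using homeomorphism_compact[OF cX e(1) refl e(2)] by blast
  define P where "P = e \<circ> p"
  have covP: "covering_space HP P (e ` X)" unfolding P_def by (rule covering_space_compose_embedding[OF cov e'])
  have pX: "p ` HP = X" using cov by (simp add: covering_space_def)
  have Pc: "continuous_on HP P" "P \<in> HP \<rightarrow> e ` X" using covP by (auto simp: covering_space_def)
  have Pp: "P a = P b \<longleftrightarrow> p a = p b" if "a \<in> HP" "b \<in> HP" for a b
  proof -
    have "p a \<in> X" "p b \<in> X" using that pX by blast+
    then show ?thesis using e(2) by (simp add: P_def inj_on_eq_iff)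
  qed
  have sc: "simply_connected HP" by (rule convex_imp_simply_connected[OF convex_HP])
  have lp: "locally path_connected HP" by (rule open_imp_locally_path_connected[OF open_HP])
  have lift: "\<exists>g. continuous_on HP g \<and> g \<in> HP \<rightarrow> HP \<and> g a = b \<and> (\<forall>y\<in>HP. P (g y) = P y)"
    if "a \<in> HP" "b \<in> HP" "p a = p b" for a b
  proof -
    have "P a = P b" using Pp that by blast
    from covering_space_lift_strong[OF covP that(2,1) sc lp Pc this] show ?thesis by metis
  qed
  obtain g where g: "continuous_on HP g" "g \<in> HP \<rightarrow> HP" "g z = w" "\<forall>y\<in>HP. P (g y) = P y" using lift[OF z] by blast
  obtain h where h: "continuous_on HP h" "h \<in> HP \<rightarrow> HP" "h w = z" "\<forall>y\<in>HP. P (h y) = P y" using lift[OF z(2,1) z(3)[symmetric]] by blast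
  have idl: "k y = y" if k: "continuous_on HP k" "k \<in> HP \<rightarrow> HP" "\<forall>y\<in>HP. P (k y) = P y" "k a = a" "a \<in> HP" and y: "y \<in> HP" for k a y
  proof -
    have "k y = id y"
      by (rule covering_space_lift_unique[OF covP, of k a id HP P]) (use k y Pc connected_HP in auto)
    then show ?thesis by simp
  qed
  have hg: "h (g y) = y" if "y \<in> HP" for y
  proof -
    have "(h \<circ> g) y = y"
    proof (rule idl[of _ z])
      show "continuous_on HP (h \<circ> g)" using g h by (intro continuous_on_compose continuous_on_subset[OF h(1)]) auto
      show "\<forall>y\<in>HP. P ((h \<circ> g) y) = P y"
      proof
        fix y assume "y \<in> HP"
        then show "P ((h \<circ> g) y) = P y" using g(4) h(4) funcset_mem[OF g(2)] by simp
      qed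
      show "(h \<circ> g) \<in> HP \<rightarrow> HP" using g(2) h(2) by auto
    qed (use g h z that in auto)
    then show ?thesis by simp
  qed
  have gh: "g (h y) = y" if "y \<in> HP" for y
  proof -
    have "(g \<circ> h) y = y"
    proof (rule idl[of _ w])
      show "continuous_on HP (g \<circ> h)" using g h by (intro continuous_on_compose continuous_on_subset[OF g(1)]) auto
      show "\<forall>y\<in>HP. P ((g \<circ> h) y) = P y"
      proof
        fix y assume "y \<in> HP"
        then show "P ((g \<circ> h) y) = P y" using g(4) h(4) funcset_mem[OF h(2)] by simp
      qed
      show "(g \<circ> h) \<in> HP \<rightarrow> HP" using g(2) h(2) by auto
    qed (use g h z that in auto)
    then show ?thesis by simp
  qed
  define \<gamma> where "\<gamma> = restrict g HP"
  have "bij_betw g HP HP" by (rule bij_betw_byWitness[of _ h]) (use g h gh hg in auto)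
  then have "\<gamma> \<in> Bij HP" unfolding \<gamma>_def Bij_def by (simp add: bij_betw_restrict_eq)
  moreover have "homeomorphism HP HP \<gamma> h"
  proof -
    have "homeomorphism HP HP g h" by (rule homeomorphismI) (use g h gh hg in auto)
    then show ?thesis by (rule homeomorphism_cong) (simp_all add: \<gamma>_def)
  qed
  moreover have "\<forall>y\<in>HP. p (\<gamma> y) = p y" using g Pp by (auto simp: \<gamma>_def Pi_iff)
  ultimately have "\<gamma> \<in> carrier (deck_group p)" unfolding deck_group_carrier by blast
  moreover have "\<gamma> z = w" using g z by (simp add: \<gamma>_def)
  ultimately show ?thesis by blast
qed

text \<open>The covering map is open and locally injective, and the surface is compact.\<close>

lemma fundamental_balls:
  fixes X :: "'a::t2_space set"
  assumes rs: "riemann_surface X \<A>" and cX: "compact X" and cov: "covering_space HP p X"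
  shows "\<exists>C r. finite C \<and> C \<subseteq> HP \<and> (\<forall>a\<in>C. r a > 0 \<and> cball a (r a) \<subseteq> HP \<and> inj_on p (ball a (r a))) \<and>
     X = (\<Union>a\<in>C. p ` ball a (r a))"
proof -
  have pX: "p ` HP = X" using cov by (simp add: covering_space_def)
  have "\<exists>r>0. cball z r \<subseteq> HP \<and> inj_on p (ball z r) \<and> openin (top_of_set X) (p ` ball z r)" if z: "z \<in> HP" for z
  proof -
    obtain T u q where T: "z \<in> T" "openin (top_of_set HP) T" and u: "homeomorphism T u p q" "openin (top_of_set X) u"
      using covering_space_local_homeomorphism[OF cov z] by metis
    have "open T" using T(2) open_HP by (metis openin_open_eq)
    then obtain r where r: "r > 0" "cball z r \<subseteq> T" using T(1) open_contains_cball by blast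
    have "inj_on p T" using u(1) unfolding homeomorphism_def by (metis inj_on_inverseI)
    then have "inj_on p (ball z r)" using r(2) ball_subset_cball by (meson inj_on_subset)
    moreover have "T \<subseteq> HP" using T(2) openin_imp_subset by blast
    moreover have "openin (top_of_set X) (p ` ball z r)"
    proof -
      have "ball z r \<subseteq> T" using r(2) ball_subset_cball by blast
      then have "openin (top_of_set T) (ball z r)" by (simp add: open_subset)
      from homeomorphism_imp_open_map[OF u(1) this] show ?thesis using u(2) openin_trans by blast
    qed
    ultimately show ?thesis using r by blast
  qed
  then obtain r where r: "\<And>z. z \<in> HP \<Longrightarrow> r z > 0 \<and> cball z (r z) \<subseteq> HP \<and> inj_on p (ball z (r z)) \<and> openin (top_of_set X) (p ` ball z (r z))" by metis
  have bH: "ball z (r z) \<subseteq> HP" if "z \<in> HP" for z using r[OF that] ball_subset_cball by blast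
  have "\<exists>O'. open O' \<and> p ` ball z (r z) = X \<inter> O'" if "z \<in> HP" for z
    using r[OF that] by (auto simp: openin_open)
  then obtain O' where O': "\<And>z. z \<in> HP \<Longrightarrow> open (O' z) \<and> p ` ball z (r z) = X \<inter> O' z" by metis
  have "X \<subseteq> (\<Union>z\<in>HP. O' z)"
  proof
    fix x assume "x \<in> X"
    then obtain z where z: "z \<in> HP" "p z = x" using pX by blast
    then have "p z \<in> p ` ball z (r z)" using r by (intro imageI) auto
    then show "x \<in> (\<Union>z\<in>HP. O' z)" using z O' by blast
  qed
  then obtain C where C: "C \<subseteq> HP" "finite C" "X \<subseteq> (\<Union>z\<in>C. O' z)"
    using compactE_image[OF cX, of HP O'] O' by metis
  have "X = (\<Union>a\<in>C. p ` ball a (r a))"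
  proof
    show "X \<subseteq> (\<Union>a\<in>C. p ` ball a (r a))"
    proof
      fix x assume x: "x \<in> X"
      then obtain a where a: "a \<in> C" "x \<in> O' a" using C(3) by blast
      then have "x \<in> p ` ball a (r a)" using O'[OF subsetD[OF C(1) a(1)]] x by blast
      then show "x \<in> (\<Union>a\<in>C. p ` ball a (r a))" using a(1) by blast
    qed
    show "(\<Union>a\<in>C. p ` ball a (r a)) \<subseteq> X" using C(1) bH pX by blast
  qed
  then show ?thesis using C r by (intro exI[of _ C] exI[of _ r]) blast
qed

text \<open>The deck group acts transitively on the fibres.\<close>

lemma fundamental_balls_cover:
  fixes X :: "'a::t2_space set"
  assumes rs: "riemann_surface X \<A>" and cX: "compact X" and cov: "covering_space HP p X"
    and C: "\<And>a. a \<in> C \<Longrightarrow> cball a (r a) \<subseteq> HP" "X = (\<Union>a\<in>C. p ` ball a (r a))" and z: "z \<in> HP"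
  shows "\<exists>\<gamma>\<in>carrier (deck_group p). \<gamma> z \<in> interior (\<Union>a\<in>C. cball a (r a))"
proof -
  have "p z \<in> X" using cov z by (auto simp: covering_space_def)
  then obtain a w where a: "a \<in> C" "w \<in> ball a (r a)" "p z = p w" using C(2) by blast
  have "w \<in> HP" using a C(1) ball_subset_cball by blast
  then obtain \<gamma> where "\<gamma> \<in> carrier (deck_group p)" "\<gamma> z = w" using deck_group_transitive[OF rs cX cov z _ a(3)] by blast
  moreover have "ball a (r a) \<subseteq> interior (\<Union>a\<in>C. cball a (r a))"
    by (rule interior_maximal) (use a(1) ball_subset_cball in auto)
  ultimately show ?thesis using a(2) by blast
qed

section \<open>Spin structures and lifted differentials\<close>

lemma spin_structure_mob:
  assumes spin: "spin_structure p \<sigma>" and \<gamma>: "\<gamma> \<in> carrier (deck_group p)"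
  shows "hp_aut (\<sigma> \<gamma>)" "\<And>z. z \<in> HP \<Longrightarrow> mob (\<sigma> \<gamma>) z = \<gamma> z"
proof -
  have d: "det (\<sigma> \<gamma>) = 1" using spin \<gamma> by (auto simp: spin_structure_def hom_def SL2C_def)
  have H: "\<gamma> z \<in> HP" if "z \<in> HP" for z using \<gamma> that Bij_imp_funcset unfolding deck_group_carrier by blast
  have m: "jf (\<sigma> \<gamma>) z \<noteq> 0 \<and> mob (\<sigma> \<gamma>) z = \<gamma> z" if "z \<in> HP" for z
  proof -
    have "Fin (\<gamma> z) = moebius (\<sigma> \<gamma>) (Fin z)" using spin \<gamma> that by (auto simp: spin_structure_def)
    then show ?thesis by (auto simp: jf_def mob_def split: if_splits)
  qed
  show "mob (\<sigma> \<gamma>) z = \<gamma> z" if "z \<in> HP" for z using m[OF that] by blast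
  show "hp_aut (\<sigma> \<gamma>)" unfolding hp_aut_def using d m H by auto
qed

lemma deck_group_mult:
  assumes "\<gamma> \<in> carrier (deck_group p)" "\<delta> \<in> carrier (deck_group p)"
  shows "\<gamma> \<otimes>\<^bsub>deck_group p\<^esub> \<delta> = compose HP \<gamma> \<delta>" "compose HP \<gamma> \<delta> \<in> carrier (deck_group p)"
proof -
  have b: "\<gamma> \<in> Bij HP" "\<delta> \<in> Bij HP" using assms by (auto simp: deck_group_carrier)
  show "\<gamma> \<otimes>\<^bsub>deck_group p\<^esub> \<delta> = compose HP \<gamma> \<delta>" using b by (simp add: deck_group_def BijGroup_def)
  obtain g h where gh: "homeomorphism HP HP \<gamma> g" "homeomorphism HP HP \<delta> h" using assms by (auto simp: deck_group_carrier)
  have "homeomorphism HP HP (\<gamma> \<circ> \<delta>) (h \<circ> g)" by (rule homeomorphism_compose[OF gh(2,1)])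
  then have "homeomorphism HP HP (compose HP \<gamma> \<delta>) (h \<circ> g)"
    by (rule homeomorphism_cong) (simp_all add: compose_def)
  moreover have "\<delta> z \<in> HP" if "z \<in> HP" for z using Bij_imp_funcset[OF b(2)] that by blast
  ultimately show "compose HP \<gamma> \<delta> \<in> carrier (deck_group p)"
    using assms compose_Bij[OF b] unfolding deck_group_carrier by (auto simp: compose_def)
qed

lemma spin_compose:
  assumes spin: "spin_structure p \<sigma>" and g: "\<gamma> \<in> carrier (deck_group p)" "\<delta> \<in> carrier (deck_group p)"
  shows "\<sigma> (compose HP \<gamma> \<delta>) = \<sigma> \<gamma> ** \<sigma> \<delta>"
proof -
  have "\<sigma> (\<gamma> \<otimes>\<^bsub>deck_group p\<^esub> \<delta>) = \<sigma> \<gamma> ** \<sigma> \<delta>"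
    using spin g by (simp add: spin_structure_def hom_def SL2C_def)
  then show ?thesis by (simp only: deck_group_mult(1)[OF g])
qed

lemma spin_group_mult:
  assumes spin: "spin_structure p \<sigma>" and M: "M \<in> \<sigma> ` carrier (deck_group p)" "N \<in> \<sigma> ` carrier (deck_group p)"
  shows "M ** N \<in> \<sigma> ` carrier (deck_group p)"
proof -
  obtain \<gamma> \<delta> where g: "\<gamma> \<in> carrier (deck_group p)" "\<delta> \<in> carrier (deck_group p)" "M = \<sigma> \<gamma>" "N = \<sigma> \<delta>" using M by blast
  show ?thesis unfolding g(3,4) spin_compose[OF spin g(1,2), symmetric]
    by (rule imageI[OF deck_group_mult(2)[OF g(1,2)]])
qed

lemma spin_group_inverse:
  assumes spin: "spin_structure p \<sigma>" and M: "M \<in> \<sigma> ` carrier (deck_group p)"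
  shows "\<exists>N\<in>\<sigma> ` carrier (deck_group p). M ** N = mat 1 \<and> N ** M = mat 1"
proof -
  obtain \<gamma> where g: "\<gamma> \<in> carrier (deck_group p)" "M = \<sigma> \<gamma>" using M by blast
  then obtain h where h: "homeomorphism HP HP \<gamma> h" by (auto simp: deck_group_carrier)
  have hH: "h z \<in> HP" "\<gamma> (h z) = z" "h (\<gamma> z) = z" if "z \<in> HP" for z using h that unfolding homeomorphism_def by blast+
  have gH: "\<gamma> z \<in> HP" if "z \<in> HP" for z using h that unfolding homeomorphism_def by blast
  define \<delta> where "\<delta> = restrict h HP"
  have hom: "homeomorphism HP HP \<delta> \<gamma>"
    by (rule homeomorphism_cong[OF homeomorphism_symD[OF h]]) (simp_all add: \<delta>_def)
  have "bij_betw h HP HP" by (rule bij_betw_byWitness[of _ \<gamma>]) (use hH gH in auto)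
  then have "\<delta> \<in> Bij HP" unfolding \<delta>_def Bij_def by (simp add: bij_betw_restrict_eq)
  moreover have "p (\<delta> z) = p z" if "z \<in> HP" for z
  proof -
    have "p (\<gamma> (h z)) = p (h z)" using g(1) hH(1)[OF that] by (auto simp: deck_group_carrier)
    then show ?thesis using hH(2)[OF that] that by (simp add: \<delta>_def)
  qed
  ultimately have \<delta>: "\<delta> \<in> carrier (deck_group p)" unfolding deck_group_carrier using hom by blast
  define u where "u = compose HP \<gamma> \<delta>"
  have u: "u \<in> carrier (deck_group p)" unfolding u_def by (rule deck_group_mult(2)[OF g(1) \<delta>])
  have uz: "u z = z" if "z \<in> HP" for z using that hH by (simp add: u_def compose_def \<delta>_def)
  \<comment> \<open>The identity is idempotent, hence so is its image, which is also invertible.\<close>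
  have "compose HP u u = u" using u uz unfolding deck_group_carrier compose_def
    by (auto simp: fun_eq_iff u_def compose_def)
  then have s: "\<sigma> u ** \<sigma> u = \<sigma> u" using spin_compose[OF spin u u] by simp
  have "det (\<sigma> u) = 1" using spin u by (auto simp: spin_structure_def hom_def SL2C_def)
  then have "invertible (\<sigma> u)" by (simp add: invertible_det_nz)
  then obtain B where B: "B ** \<sigma> u = mat 1" unfolding invertible_def by blast
  have "\<sigma> u = (B ** \<sigma> u) ** \<sigma> u" by (simp add: B)
  also have "\<dots> = B ** (\<sigma> u ** \<sigma> u)" by (simp add: matrix_mul_assoc)
  also have "\<dots> = mat 1" by (simp add: s B)
  finally have "\<sigma> u = mat 1" .
  moreover have "\<sigma> u = \<sigma> \<gamma> ** \<sigma> \<delta>"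
    unfolding u_def by (rule spin_compose[OF spin g(1) \<delta>])
  ultimately have MN: "M ** \<sigma> \<delta> = mat 1" using g(2) by simp
  then have "\<sigma> \<delta> ** M = mat 1" by (simp add: matrix_left_right_inverse)
  then show ?thesis using MN \<delta> by blast
qed

lemma cover_chart_facts:
  assumes rs: "riemann_surface X \<A>" and hc: "holomorphic_universal_cover p X \<A>" and c: "(U, f) \<in> \<A>"
  shows "open (HP \<inter> p -` U)" "(f \<circ> p) holomorphic_on (HP \<inter> p -` U)"
    "(f \<circ> p) ` (HP \<inter> p -` U) \<subseteq> f ` U" "z \<in> HP \<Longrightarrow> p z \<in> X"
proof -
  have cov: "continuous_on HP p" "p ` HP = X" using hc by (auto simp: holomorphic_universal_cover_def covering_space_def)
  have "openin (top_of_set HP) (HP \<inter> p -` U)"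
    by (rule continuous_openin_preimage[OF cov(1) _ riemann_surface_chartD(1)[OF rs c]]) (use cov(2) in auto)
  then show "open (HP \<inter> p -` U)" using open_HP by (metis openin_open_eq)
  show "(f \<circ> p) holomorphic_on (HP \<inter> p -` U)" using hc c by (auto simp: holomorphic_universal_cover_def)
  show "(f \<circ> p) ` (HP \<inter> p -` U) \<subseteq> f ` U" by auto
  show "z \<in> HP \<Longrightarrow> p z \<in> X" using cov(2) by blast
qed

text \<open>The lift is defined with an arbitrary chart; the transformation law of the differential cancels the
  derivative of the change of charts.\<close>

lemma qd_lift_chart:
  assumes rs: "riemann_surface X \<A>" and hc: "holomorphic_universal_cover p X \<A>" and \<phi>: "\<phi> \<in> quad_diffs \<A>"
    and c: "(U, f) \<in> \<A>" and z: "z \<in> HP" "p z \<in> U"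
  shows "qd_lift \<A> p \<phi> z = \<phi> (U, f) (f (p z)) * (deriv (f \<circ> p) z)^2"
proof -
  define c' where "c' = (SOME c. c \<in> \<A> \<and> p z \<in> fst c)"
  have "c' \<in> \<A> \<and> p z \<in> fst c'" unfolding c'_def by (rule someI[of _ "(U, f)"]) (use c z in simp)
  then obtain V g where Vg: "c' = (V, g)" "(V, g) \<in> \<A>" "p z \<in> V" by (cases c') auto
  note cU = cover_chart_facts[OF rs hc c] and cV = cover_chart_facts[OF rs hc Vg(2)]
  let ?T = "g \<circ> inv_into U f"
  have T: "?T holomorphic_on (f ` (U \<inter> V))" using rs c Vg(2) unfolding riemann_surface_def by blast
  obtain f' where f': "homeomorphism U (f ` U) f f'" using riemann_surface_chartD(6)[OF rs c] by blast
  have "openin (top_of_set U) (U \<inter> V)"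
  proof -
    have UX: "U \<subseteq> X" by (rule riemann_surface_chartD(5)[OF rs c])
    obtain O' where O': "open O'" "V = X \<inter> O'" using riemann_surface_chartD(1)[OF rs Vg(2)] by (auto simp: openin_open)
    then show ?thesis using UX unfolding openin_open by blast
  qed
  from homeomorphism_imp_open_map[OF f' this] have oUV: "open (f ` (U \<inter> V))"
    using riemann_surface_chartD(2)[OF rs c] by (metis openin_open_eq)
  have in1: "f (p z) \<in> f ` (U \<inter> V)" using z Vg by blast
  have d1: "(?T has_field_derivative deriv ?T (f (p z))) (at ((f \<circ> p) z))"
    using holomorphic_derivI[OF T oUV in1] by simp
  have d2: "((f \<circ> p) has_field_derivative deriv (f \<circ> p) z) (at z)"
    by (rule holomorphic_derivI[OF cU(2,1)]) (use z in auto)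
  have "((\<lambda>z. ?T ((f \<circ> p) z)) has_field_derivative deriv ?T (f (p z)) * deriv (f \<circ> p) z) (at z)"
    by (rule DERIV_chain2[OF d1 d2])
  then have "((g \<circ> p) has_field_derivative deriv ?T (f (p z)) * deriv (f \<circ> p) z) (at z)"
  proof (rule has_field_derivative_transform_within_open)
    show "open (HP \<inter> p -` U)" by (rule cU(1))
    show "z \<in> HP \<inter> p -` U" using z by auto
    fix y assume "y \<in> HP \<inter> p -` U"
    then show "?T ((f \<circ> p) y) = (g \<circ> p) y" using riemann_surface_chartD(4)[OF rs c] by (simp add: inv_into_f_f)
  qed
  then have d: "deriv (g \<circ> p) z = deriv ?T (f (p z)) * deriv (f \<circ> p) z" by (rule DERIV_imp_deriv)
  have tr: "\<phi> (U, f) (f (p z)) = \<phi> (V, g) (g (p z)) * (deriv ?T (f (p z)))^2"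
    using \<phi> c Vg(2,3) z(2) unfolding quad_diffs_def by blast
  have "qd_lift \<A> p \<phi> z = \<phi> (V, g) (g (p z)) * (deriv (g \<circ> p) z)^2"
    unfolding qd_lift_def c'_def[symmetric] by (simp add: Vg(1))
  then show ?thesis by (simp add: d tr power_mult_distrib)
qed

lemma qd_lift_holomorphic:
  assumes rs: "riemann_surface X \<A>" and hc: "holomorphic_universal_cover p X \<A>" and \<phi>: "\<phi> \<in> quad_diffs \<A>"
  shows "qd_lift \<A> p \<phi> holomorphic_on HP"
proof -
  have "\<exists>O'. open O' \<and> z \<in> O' \<and> qd_lift \<A> p \<phi> holomorphic_on O'" if z: "z \<in> HP" for z
  proof -
    have "p z \<in> X" using hc z by (auto simp: holomorphic_universal_cover_def covering_space_def)
    then obtain U f where c: "(U, f) \<in> \<A>" "p z \<in> U" using riemann_surface_chart_ex[OF rs] by blast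
    note cU = cover_chart_facts[OF rs hc c(1)]
    have h: "\<phi> (U, f) holomorphic_on (f ` U)" using \<phi> c(1) unfolding quad_diffs_def by blast
    have "(\<lambda>z. (\<phi> (U, f) \<circ> (f \<circ> p)) z * (deriv (f \<circ> p) z)^2) holomorphic_on (HP \<inter> p -` U)"
      by (intro holomorphic_intros holomorphic_on_compose_gen[OF cU(2) h cU(3)] holomorphic_deriv cU)
    then have "qd_lift \<A> p \<phi> holomorphic_on (HP \<inter> p -` U)"
      by (rule holomorphic_transform) (use qd_lift_chart[OF rs hc \<phi> c(1)] in auto)
    then show ?thesis using cU(1) z c(2) by (intro exI[of _ "HP \<inter> p -` U"]) auto
  qed
  note loc = this
  show ?thesis unfolding holomorphic_on_def
  proof
    fix z assume "z \<in> HP"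
    then obtain O' where "open O'" "z \<in> O'" "qd_lift \<A> p \<phi> holomorphic_on O'" using loc by blast
    then have "qd_lift \<A> p \<phi> field_differentiable at z" by (metis holomorphic_on_imp_differentiable_at)
    then show "qd_lift \<A> p \<phi> field_differentiable at z within HP" by (rule field_differentiable_at_within)
  qed
qed

text \<open>Differentiating \<open>f \<circ> p \<circ> \<gamma> = f \<circ> p\<close>, where \<open>\<gamma>' = 1 / (c z + d)\<^sup>2\<close>; the square of \<open>dz\<close> gives the weight
  \<open>4\<close>.\<close>

lemma qd_lift_automorphic:
  assumes rs: "riemann_surface X \<A>" and hc: "holomorphic_universal_cover p X \<A>" and \<phi>: "\<phi> \<in> quad_diffs \<A>"
    and spin: "spin_structure p \<sigma>" and \<gamma>: "\<gamma> \<in> carrier (deck_group p)"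
  shows "automorphic (\<sigma> \<gamma>) (qd_lift \<A> p \<phi>)"
  unfolding automorphic_def
proof
  fix z assume z: "z \<in> HP"
  define M where "M = \<sigma> \<gamma>"
  have M: "hp_aut M" "\<And>z. z \<in> HP \<Longrightarrow> mob M z = \<gamma> z" using spin_structure_mob[OF spin \<gamma>] by (auto simp: M_def)
  have pM: "p (mob M z) = p z" if "z \<in> HP" for z using M(2)[OF that] \<gamma> that by (auto simp: deck_group_carrier)
  have j: "jf M z \<noteq> 0" "mob M z \<in> HP" using M(1) z by (auto simp: hp_aut_def)
  have "p z \<in> X" using hc z by (auto simp: holomorphic_universal_cover_def covering_space_def)
  then obtain U f where c: "(U, f) \<in> \<A>" "p z \<in> U" using riemann_surface_chart_ex[OF rs] by blast
  note cU = cover_chart_facts[OF rs hc c(1)]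
  have d1: "((f \<circ> p) has_field_derivative deriv (f \<circ> p) (mob M z)) (at (mob M z))"
    by (rule holomorphic_derivI[OF cU(2,1)]) (use j pM[OF z] c in auto)
  have "((\<lambda>y. (f \<circ> p) (mob M y)) has_field_derivative deriv (f \<circ> p) (mob M z) * (1 / (jf M z)^2)) (at z)"
    by (rule DERIV_chain2[OF d1 mob_deriv[OF M(1) z]])
  then have "((f \<circ> p) has_field_derivative deriv (f \<circ> p) (mob M z) * (1 / (jf M z)^2)) (at z)"
    by (rule has_field_derivative_transform_within_open[OF _ open_HP z]) (simp add: pM)
  then have d: "deriv (f \<circ> p) z = deriv (f \<circ> p) (mob M z) * (1 / (jf M z)^2)" by (rule DERIV_imp_deriv)
  then have d': "deriv (f \<circ> p) (mob M z) = deriv (f \<circ> p) z * (jf M z)^2" using j by simp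
  have "qd_lift \<A> p \<phi> (mob M z) = \<phi> (U, f) (f (p z)) * (deriv (f \<circ> p) (mob M z))^2"
    using qd_lift_chart[OF rs hc \<phi> c(1) j(2)] pM[OF z] c by simp
  also have "\<dots> = qd_lift \<A> p \<phi> z * jf M z ^ 4"
    unfolding d' qd_lift_chart[OF rs hc \<phi> c(1) z c(2)] by (simp add: power_mult_distrib flip: power_mult)
  finally show "qd_lift \<A> p \<phi> (mob (\<sigma> \<gamma>) z) = qd_lift \<A> p \<phi> z * jf (\<sigma> \<gamma>) z ^ 4" unfolding M_def .
qed

section \<open>Change of variables for holomorphic maps\<close>

text \<open>The change of variables formula with Jacobian determinants refers to coordinate space.\<close>

definition toC :: "real^2 \<Rightarrow> complex" where "toC v = Complex (vec_nth v 1) (vec_nth v 2)"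
definition ofC :: "complex \<Rightarrow> real^2" where "ofC w = (\<chi> i. if i = 1 then Re w else Im w)"

lemma toC_ofC [simp]: "toC (ofC w) = w" by (simp add: toC_def ofC_def)
lemma ofC_toC [simp]: "ofC (toC v) = v"
  by (simp add: toC_def ofC_def vec_eq_iff) (metis exhaust_2)

lemma linear_toC: "linear toC" and linear_ofC: "linear ofC"
  by (auto intro!: linearI simp: toC_def ofC_def vec_eq_iff complex_eq_iff)

lemma bounded_linear_toC: "bounded_linear toC" and bounded_linear_ofC: "bounded_linear ofC"
  using linear_toC linear_ofC linear_conv_bounded_linear by blast+

lemma toC_measurable [measurable]: "toC \<in> borel_measurable borel"
  by (intro borel_measurable_continuous_onI linear_continuous_on bounded_linear_toC)

lemma lborel_toC: "distr lborel borel toC = lborel"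
proof (rule lborel_eqI[symmetric])
  fix l u :: complex assume le: "\<And>b. b \<in> Basis \<Longrightarrow> l \<bullet> b \<le> u \<bullet> b"
  have B2: "(Basis :: (real^2) set) = {axis 1 1, axis 2 1}"
    by (auto simp: Basis_vec_def UNIV_2)
  have ne: "axis 1 1 \<noteq> (axis 2 1 :: real^2)" by (simp add: axis_eq_axis)
  have "toC -` box l u = box (ofC l) (ofC u)"
    by (auto simp: box_def B2 Basis_complex_def toC_def ofC_def inner_axis inner_complex_def)
  then have "emeasure (distr lborel borel toC) (box l u) = emeasure lborel (box (ofC l) (ofC u))"
    by (subst emeasure_distr) auto
  also have "\<dots> = (\<Prod>b\<in>Basis. (ofC u - ofC l) \<bullet> b)"
  proof (rule emeasure_lborel_box)
    fix b :: "real^2" assume "b \<in> Basis"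
    then show "ofC l \<bullet> b \<le> ofC u \<bullet> b"
      using le[of 1] le[of \<i>] by (auto simp: B2 inner_axis ofC_def Basis_complex_def inner_complex_def)
  qed
  also have "(\<Prod>b\<in>Basis. (ofC u - ofC l) \<bullet> b) = (\<Prod>b\<in>Basis. (u - l) \<bullet> b)"
    unfolding B2 Basis_complex_def using ne
    by (simp add: inner_axis ofC_def inner_complex_def inner_diff_left)
  finally show "emeasure (distr lborel borel toC) (box l u) = (\<Prod>b\<in>Basis. (u - l) \<bullet> b)" .
qed simp

text \<open>Real-valued functions are treated as functions with values in one-dimensional vectors.\<close>

lemma change_of_variables_real_valued:
  fixes f :: "real^2 \<Rightarrow> real" and g :: "real^2 \<Rightarrow> real^2"
  assumes S: "S \<in> sets lebesgue" and der: "\<And>x. x \<in> S \<Longrightarrow> (g has_derivative g' x) (at x within S)" and inj: "inj_on g S"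
  shows "(\<lambda>x. \<bar>det (matrix (g' x))\<bar> * f (g x)) absolutely_integrable_on S \<and>
      integral S (\<lambda>x. \<bar>det (matrix (g' x))\<bar> * f (g x)) = b
     \<longleftrightarrow> f absolutely_integrable_on (g ` S) \<and> integral (g ` S) f = b"
proof -
  let ?v = "\<lambda>x. vec x :: real^1" and ?d = "\<lambda>v::real^1. vec_nth v 1"
  have bl: "bounded_linear ?v" "bounded_linear ?d"
    by (auto intro!: linear_conv_bounded_linear[THEN iffD1] linearI simp: vec_eq_iff)
  have iff: "F absolutely_integrable_on A \<and> integral A F = c \<longleftrightarrow>
     (\<lambda>x. ?v (F x)) absolutely_integrable_on A \<and> integral A (\<lambda>x. ?v (F x)) = ?v c" for F :: "real^2 \<Rightarrow> real" and A c
  proof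
    assume A: "F absolutely_integrable_on A \<and> integral A F = c"
    then have "(?v \<circ> F) absolutely_integrable_on A" using absolutely_integrable_linear bl by blast
    moreover have "integral A (?v \<circ> F) = ?v (integral A F)"
      by (rule integral_linear[OF _ bl(1)]) (use A in \<open>auto simp: absolutely_integrable_on_def\<close>)
    ultimately show "(\<lambda>x. ?v (F x)) absolutely_integrable_on A \<and> integral A (\<lambda>x. ?v (F x)) = ?v c" using A by (simp add: o_def)
  next
    assume A: "(\<lambda>x. ?v (F x)) absolutely_integrable_on A \<and> integral A (\<lambda>x. ?v (F x)) = ?v c"
    then have "(?d \<circ> (\<lambda>x. ?v (F x))) absolutely_integrable_on A" using absolutely_integrable_linear bl by blast
    moreover have "integral A (?d \<circ> (\<lambda>x. ?v (F x))) = ?d (integral A (\<lambda>x. ?v (F x)))"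
      by (rule integral_linear[OF _ bl(2)]) (use A in \<open>auto simp: absolutely_integrable_on_def\<close>)
    ultimately show "F absolutely_integrable_on A \<and> integral A F = c" using A by (simp add: o_def)
  qed
  have sc: "(\<lambda>x. ?v (\<bar>det (matrix (g' x))\<bar> * f (g x))) = (\<lambda>x. \<bar>det (matrix (g' x))\<bar> *\<^sub>R ?v (f (g x)))"
    by (auto simp: vec_eq_iff)
  show ?thesis unfolding iff sc
    by (rule has_absolute_integral_change_of_variables[OF S der inj])
qed

lemma borel_integrable_toC:
  fixes F :: "complex \<Rightarrow> real"
  assumes A: "A \<in> sets borel" and F: "(\<lambda>w. indicator A w * F w) \<in> borel_measurable borel"
  shows "(\<lambda>v. F (toC v)) absolutely_integrable_on (toC -` A) \<longleftrightarrow> integrable lborel (\<lambda>w. indicator A w * F w)"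
    "integrable lborel (\<lambda>w. indicator A w * F w) \<Longrightarrow>
       integral (toC -` A) (\<lambda>v. F (toC v)) = (\<integral>w. indicator A w * F w \<partial>lborel)"
proof -
  let ?G = "\<lambda>w. indicator A w * F w"
  have m: "(\<lambda>v. ?G (toC v)) \<in> borel_measurable lborel"
    using measurable_compose[OF toC_measurable F] by simp
  have e: "(\<lambda>x. indicat_real (toC -` A) x *\<^sub>R F (toC x)) = (\<lambda>v. ?G (toC v))" by (auto simp: indicator_def)
  have 1: "(\<lambda>v. F (toC v)) absolutely_integrable_on (toC -` A) \<longleftrightarrow> integrable lborel (\<lambda>v. ?G (toC v))"
    unfolding set_integrable_def e using integrable_completion[OF m] by simp
  also have "\<dots> \<longleftrightarrow> integrable (distr lborel borel toC) ?G"
    by (rule integrable_distr_eq[symmetric]) (use F in auto)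
  finally show i: "(\<lambda>v. F (toC v)) absolutely_integrable_on (toC -` A) \<longleftrightarrow> integrable lborel ?G"
    unfolding lborel_toC .
  assume "integrable lborel ?G"
  then have "(\<lambda>v. F (toC v)) absolutely_integrable_on (toC -` A)" using i by blast
  from set_lebesgue_integral_eq_integral(2)[OF this]
  have "integral (toC -` A) (\<lambda>v. F (toC v)) = integral\<^sup>L lebesgue (\<lambda>v. ?G (toC v))"
    unfolding set_lebesgue_integral_def e by simp
  also have "\<dots> = integral\<^sup>L lborel (\<lambda>v. ?G (toC v))" by (rule integral_completion[OF m])
  also have "\<dots> = integral\<^sup>L (distr lborel borel toC) ?G" by (rule integral_distr[symmetric]) (use F in auto)
  finally show "integral (toC -` A) (\<lambda>v. F (toC v)) = integral\<^sup>L lborel ?G" unfolding lborel_toC .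
qed

lemma det_complex_mult: "det (matrix (\<lambda>v. ofC (d * toC v))) = (cmod d)^2"
  unfolding cmod_power2 by (simp add: det_2 matrix_def ofC_def toC_def axis_def power2_eq_square)

text \<open>The Jacobian determinant of \<open>h\<close> is \<open>\<bar>h'\<bar>\<^sup>2\<close>. If one side is not integrable, neither is the other, and then
  both integrals are infinite.\<close>

lemma holomorphic_nn_change_of_variables:
  fixes g :: "complex \<Rightarrow> real"
  assumes O: "open U" and h: "h holomorphic_on U" and inj: "inj_on h U" and S: "S \<subseteq> U" "S \<in> sets borel" "h ` S \<in> sets borel"
    and g: "g \<in> borel_measurable borel" "\<And>w. g w \<ge> 0"
  shows "(\<integral>\<^sup>+w. ennreal (indicator (h ` S) w * g w) \<partial>lborel) =
         (\<integral>\<^sup>+z. ennreal (indicator S z * ((cmod (deriv h z))^2 * g (h z))) \<partial>lborel)"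
proof -
  let ?R = "\<lambda>z. (cmod (deriv h z))^2 * g (h z)"
  have hm: "(\<lambda>z. if z \<in> U then h z else 0) \<in> borel_measurable borel"
    using borel_measurable_continuous_on_if[OF _ holomorphic_on_imp_continuous_on[OF h] continuous_on_const] O by auto
  have dm: "(\<lambda>z. if z \<in> U then deriv h z else 0) \<in> borel_measurable borel"
    using borel_measurable_continuous_on_if[OF _ holomorphic_on_imp_continuous_on[OF holomorphic_deriv[OF h O]] continuous_on_const] O by auto
  have "(\<lambda>z. indicator S z * ((cmod (if z \<in> U then deriv h z else 0))^2 * g (if z \<in> U then h z else 0))) \<in> borel_measurable borel"
    using hm dm g(1) S(2) by measurable
  moreover have "(\<lambda>z. indicator S z * ((cmod (if z \<in> U then deriv h z else 0))^2 * g (if z \<in> U then h z else 0))) = (\<lambda>z. indicator S z * ?R z)"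
    using S(1) by (auto simp: indicator_def fun_eq_iff)
  ultimately have Rm: "(\<lambda>z. indicator S z * ?R z) \<in> borel_measurable borel" by simp
  have Lm: "(\<lambda>w. indicator (h ` S) w * g w) \<in> borel_measurable borel" using g(1) S(3) by measurable
  define H where "H = (\<lambda>v. ofC (h (toC v)))"
  define H' where "H' = (\<lambda>x v. ofC (deriv h (toC x) * toC v))"
  have S2: "toC -` S \<in> sets lebesgue"
    using measurable_sets[OF toC_measurable S(2)] by (simp add: sets_completionI_sets)
  have der: "(H has_derivative H' x) (at x within toC -` S)" if "x \<in> toC -` S" for x
  proof -
    have "(h has_field_derivative deriv h (toC x)) (at (toC x))"
      using holomorphic_derivI[OF h O] that S(1) by blast
    then have 1: "(h has_derivative (\<lambda>v. deriv h (toC x) * v)) (at (toC x))" by (simp add: has_field_derivative_def)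
    have 2: "(toC has_derivative toC) (at x within toC -` S)" by (rule bounded_linear_imp_has_derivative[OF bounded_linear_toC])
    have "((\<lambda>v. h (toC v)) has_derivative (\<lambda>v. deriv h (toC x) * toC v)) (at x within toC -` S)"
      by (rule has_derivative_compose[OF 2 1])
    from bounded_linear.has_derivative[OF bounded_linear_ofC this] show ?thesis unfolding H_def H'_def .
  qed
  have injH: "inj_on H (toC -` S)"
  proof (rule inj_onI)
    fix x y assume xy: "x \<in> toC -` S" "y \<in> toC -` S" "H x = H y"
    then have "h (toC x) = h (toC y)" unfolding H_def by (metis toC_ofC)
    then have "toC x = toC y" using inj xy S(1) unfolding inj_on_def by blast
    then show "x = y" by (metis ofC_toC)
  qed
  have im: "H ` (toC -` S) = toC -` (h ` S)"
  proof
    show "H ` (toC -` S) \<subseteq> toC -` (h ` S)" by (auto simp: H_def)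
    show "toC -` (h ` S) \<subseteq> H ` (toC -` S)"
    proof
      fix y assume "y \<in> toC -` (h ` S)"
      then obtain s where "s \<in> S" "toC y = h s" by auto
      then have "y = H (ofC s)" "ofC s \<in> toC -` S" by (simp_all add: H_def) (metis ofC_toC)
      then show "y \<in> H ` (toC -` S)" by blast
    qed
  qed
  have int: "(\<lambda>x. \<bar>det (matrix (H' x))\<bar> * g (toC (H x))) = (\<lambda>x. ?R (toC x))"
    unfolding H'_def det_complex_mult by (simp add: H_def)
  have cov: "(\<lambda>x. ?R (toC x)) absolutely_integrable_on (toC -` S) \<and> integral (toC -` S) (\<lambda>x. ?R (toC x)) = b \<longleftrightarrow>
     (\<lambda>x. g (toC x)) absolutely_integrable_on (toC -` (h ` S)) \<and> integral (toC -` (h ` S)) (\<lambda>x. g (toC x)) = b" for b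
    using change_of_variables_real_valued[OF S2 der injH, of "\<lambda>x. g (toC x)" b] unfolding int im .
  note R = borel_integrable_toC[OF S(2) Rm] and L = borel_integrable_toC[OF S(3) Lm]
  show ?thesis
  proof (cases "integrable lborel (\<lambda>z. indicator S z * ?R z)")
    case True
    have "(\<lambda>x. g (toC x)) absolutely_integrable_on (toC -` (h ` S)) \<and>
        integral (toC -` (h ` S)) (\<lambda>x. g (toC x)) = (\<integral>z. indicator S z * ?R z \<partial>lborel)"
      using cov R True by blast
    then have iL: "integrable lborel (\<lambda>w. indicator (h ` S) w * g w)"
      and eq: "(\<integral>w. indicator (h ` S) w * g w \<partial>lborel) = (\<integral>z. indicator S z * ?R z \<partial>lborel)"
      using L by auto
    show ?thesis using nn_integral_eq_integral[OF True] nn_integral_eq_integral[OF iL] eq g(2) by simp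
  next
    case False
    then have "\<not> integrable lborel (\<lambda>w. indicator (h ` S) w * g w)" using cov R L by blast
    moreover have "(\<integral>\<^sup>+z. ennreal (f z) \<partial>lborel) = \<infinity>" if "\<not> integrable lborel f" "f \<in> borel_measurable borel" "\<And>z. f z \<ge> 0"
      for f :: "complex \<Rightarrow> real"
      using that unfolding integrable_iff_bounded by (auto simp: less_top[symmetric])
    ultimately show ?thesis using False Rm Lm g(2) by simp
  qed
qed

section \<open>The norm of a quadratic differential\<close>

text \<open>Take a finite list of charts that cover, and use the first one that contains the given point. The
  pieces are differences of open sets.\<close>

lemma chart_selection_exists:
  assumes rs: "riemann_surface X \<A>" and cX: "compact X"
  shows "\<exists>\<kappa>. chart_selection X \<A> \<kappa>"
proof -
  have "\<exists>O'. open O' \<and> fst c = X \<inter> O'" if "c \<in> \<A>" for c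
    using riemann_surface_chartD(1)[OF rs, of "fst c" "snd c"] that by (auto simp: openin_open)
  then obtain O' where O': "\<And>c. c \<in> \<A> \<Longrightarrow> open (O' c) \<and> fst c = X \<inter> O' c" by metis
  have "X \<subseteq> (\<Union>c\<in>\<A>. O' c)"
  proof
    fix x assume x: "x \<in> X"
    then obtain U f where "(U, f) \<in> \<A>" "x \<in> U" using riemann_surface_chart_ex[OF rs] by blast
    then show "x \<in> (\<Union>c\<in>\<A>. O' c)" using O'[of "(U, f)"] by (intro UN_I[of "(U, f)"]) auto
  qed
  then obtain C where C: "C \<subseteq> \<A>" "finite C" "X \<subseteq> (\<Union>c\<in>C. O' c)"
    using compactE_image[OF cX, of \<A> O'] O' by metis
  obtain cs where cs: "set cs = C" using finite_list[OF C(2)] by blast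
  define P where "P = (\<lambda>x i. i < length cs \<and> x \<in> fst (cs ! i))"
  have ex: "\<exists>i. P x i" if x: "x \<in> X" for x
  proof -
    obtain c where "c \<in> C" "x \<in> O' c" using C(3) x by blast
    then have "x \<in> fst c" using O'[of c] C(1) x by blast
    then show ?thesis using \<open>c \<in> C\<close> cs unfolding P_def by (metis in_set_conv_nth)
  qed
  define \<kappa> where "\<kappa> = (\<lambda>x. cs ! (LEAST i. P x i))"
  have L: "P x (LEAST i. P x i)" if "x \<in> X" for x using ex[OF that] by (metis LeastI)
  have eq: "{x \<in> X. \<kappa> x = c} = (\<Union>i\<in>{i. i < length cs \<and> cs ! i = c}. {x \<in> fst c. \<forall>j<i. x \<notin> fst (cs ! j)})"
    if c: "c \<in> \<A>" for c
  proof (intro equalityI subsetI)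
    fix x assume "x \<in> {x \<in> X. \<kappa> x = c}"
    then have x: "x \<in> X" "\<kappa> x = c" by auto
    let ?i = "LEAST i. P x i"
    have "\<forall>j<?i. x \<notin> fst (cs ! j)"
    proof (intro allI impI)
      fix j assume j: "j < ?i"
      then have "\<not> P x j" by (rule not_less_Least)
      moreover have "j < length cs" using j L[OF x(1)] unfolding P_def by linarith
      ultimately show "x \<notin> fst (cs ! j)" unfolding P_def by blast
    qed
    note least = this
    show "x \<in> (\<Union>i\<in>{i. i < length cs \<and> cs ! i = c}. {x \<in> fst c. \<forall>j<i. x \<notin> fst (cs ! j)})"
    proof (rule UN_I)
      show "?i \<in> {i. i < length cs \<and> cs ! i = c}" using L[OF x(1)] x(2) by (simp add: P_def \<kappa>_def)
      have "x \<in> fst c" using L[OF x(1)] x(2) by (simp add: P_def \<kappa>_def)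
      then show "x \<in> {x \<in> fst c. \<forall>j<?i. x \<notin> fst (cs ! j)}" using least by simp
    qed
  next
    fix x assume "x \<in> (\<Union>i\<in>{i. i < length cs \<and> cs ! i = c}. {x \<in> fst c. \<forall>j<i. x \<notin> fst (cs ! j)})"
    then obtain i where i: "i < length cs" "cs ! i = c" "x \<in> fst c" "\<forall>j<i. x \<notin> fst (cs ! j)" by blast
    have "x \<in> X" using O'[OF c] i(3) by blast
    moreover have "(LEAST i. P x i) = i"
      by (rule Least_equality) (use i in \<open>auto simp: P_def not_less[symmetric]\<close>)
    ultimately show "x \<in> {x \<in> X. \<kappa> x = c}" using i(2) by (simp add: \<kappa>_def)
  qed
  have "chart_selection X \<A> \<kappa>" unfolding chart_selection_def
  proof (intro conjI ballI)
    have "\<kappa> ` X \<subseteq> C" using L cs nth_mem unfolding P_def \<kappa>_def by blast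
    then show "finite (\<kappa> ` X)" using C(2) finite_subset by blast
    fix x assume x: "x \<in> X"
    show "\<kappa> x \<in> \<A>" using \<open>\<kappa> ` X \<subseteq> C\<close> C(1) x by blast
    show "x \<in> fst (\<kappa> x)" using L[OF x] unfolding P_def \<kappa>_def by blast
  next
    fix c assume c: "c \<in> \<A>"
    obtain U f where Uf: "c = (U, f)" by (cases c)
    note cD = riemann_surface_chartD[OF rs c[unfolded Uf]]
    obtain f' where f': "homeomorphism U (f ` U) f f'" using cD(6) by blast
    have "f ` {x \<in> U. \<forall>j<i. x \<notin> fst (cs ! j)} \<in> sets borel" if i: "i < length cs" for i
    proof -
      define Y where "Y = U \<inter> (\<Union>j<i. O' (cs ! j))"
      have csA: "cs ! j \<in> \<A>" if "j < i" for j using that i cs C(1) nth_mem by (metis order_less_trans subsetD)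
      have "fst (cs ! j) = X \<inter> O' (cs ! j)" if "j < i" for j using O'[OF csA[OF that]] by blast
      then have "{x \<in> U. \<forall>j<i. x \<notin> fst (cs ! j)} = U - Y" unfolding Y_def using cD(5) by auto
      then have "f ` {x \<in> U. \<forall>j<i. x \<notin> fst (cs ! j)} = f ` U - f ` Y"
        using inj_on_image_set_diff[OF cD(4), of U Y] by (simp add: Y_def)
      moreover have "open (f ` Y)"
      proof -
        have "open (\<Union>j<i. O' (cs ! j))" using O' csA by (intro open_UN ballI) auto
        then have "openin (top_of_set U) Y" unfolding Y_def by (rule openin_open_Int)
        from homeomorphism_imp_open_map[OF f' this] show ?thesis using cD(2) by (metis openin_open_eq)
      qed
      ultimately show ?thesis using cD(2) by auto
    qed
    then have "(\<Union>i\<in>{i. i < length cs \<and> cs ! i = c}. f ` {x \<in> U. \<forall>j<i. x \<notin> fst (cs ! j)}) \<in> sets borel"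
      by (intro sets.finite_UN) auto
    then show "snd c ` {x \<in> X. \<kappa> x = c} \<in> sets borel" unfolding eq[OF c] by (simp add: image_UN Uf)
  qed
  then show ?thesis by blast
qed

lemma chart_coefficient_measurable:
  assumes rs: "riemann_surface X \<A>" and \<phi>: "\<phi> \<in> quad_diffs \<A>" and c: "c \<in> \<A>"
  shows "(\<lambda>w. cmod (\<phi> c w)) \<in> borel_measurable borel"
proof -
  obtain U f where Uf: "c = (U, f)" by (cases c)
  have h: "\<phi> c holomorphic_on (f ` U)" using \<phi> c Uf unfolding quad_diffs_def by blast
  have z: "\<phi> c w = 0" if "w \<notin> f ` U" for w using \<phi> that unfolding quad_diffs_def Uf by blast
  have "(\<lambda>w. if w \<in> f ` U then \<phi> c w else 0) \<in> borel_measurable borel"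
    using borel_measurable_continuous_on_if[OF _ holomorphic_on_imp_continuous_on[OF h] continuous_on_const]
      riemann_surface_chartD(2)[OF rs c[unfolded Uf]] by auto
  moreover have "(\<lambda>w. if w \<in> f ` U then \<phi> c w else 0) = \<phi> c" using z by auto
  ultimately show ?thesis by simp
qed

text \<open>Cut the disc into the pieces that belong to the charts. On the piece of \<open>(U, f)\<close> change
  variables by the injective map \<open>f \<circ> p\<close>; the Jacobian \<open>\<bar>(f \<circ> p)'\<bar>\<^sup>2\<close> turns the coefficient into the lift.\<close>

lemma ball_integral_charts:
  assumes rs: "riemann_surface X \<A>" and hc: "holomorphic_universal_cover p X \<A>" and \<phi>: "\<phi> \<in> quad_diffs \<A>"
    and \<kappa>: "chart_selection X \<A> \<kappa>" and B: "open B" "B \<subseteq> HP" "inj_on p B"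
  shows "(\<integral>\<^sup>+z. ennreal (indicator B z * cmod (qd_lift \<A> p \<phi> z)) \<partial>lborel) =
     (\<Sum>c\<in>\<kappa> ` X. \<integral>\<^sup>+w. ennreal (indicator (snd c ` {x \<in> X. \<kappa> x = c} \<inter> (snd c \<circ> p) ` (B \<inter> p -` fst c)) w * cmod (\<phi> c w)) \<partial>lborel)"
proof -
  have pX: "p z \<in> X" if "z \<in> HP" for z using hc that by (auto simp: holomorphic_universal_cover_def covering_space_def)
  have fin: "finite (\<kappa> ` X)" and \<kappa>A: "\<And>x. x \<in> X \<Longrightarrow> \<kappa> x \<in> \<A>" "\<And>x. x \<in> X \<Longrightarrow> x \<in> fst (\<kappa> x)"
    and bor: "\<And>c. c \<in> \<A> \<Longrightarrow> snd c ` {x \<in> X. \<kappa> x = c} \<in> sets borel" using \<kappa> by (auto simp: chart_selection_def)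
  define S where "S = (\<lambda>c. {z \<in> B. \<kappa> (p z) = c})"
  have piece: "S c \<in> sets borel \<and> (\<integral>\<^sup>+z. ennreal (indicator (S c) z * cmod (qd_lift \<A> p \<phi> z)) \<partial>lborel) =
     (\<integral>\<^sup>+w. ennreal (indicator (snd c ` {x \<in> X. \<kappa> x = c} \<inter> (snd c \<circ> p) ` (B \<inter> p -` fst c)) w * cmod (\<phi> c w)) \<partial>lborel)"
    if cX: "c \<in> \<kappa> ` X" for c
  proof -
    have cA: "c \<in> \<A>" using cX \<kappa>A by blast
    obtain U f where Uf: "c = (U, f)" by (cases c)
    note cA' = cA[unfolded Uf]
    note cD = riemann_surface_chartD[OF rs cA'] and cU = cover_chart_facts[OF rs hc cA']
    define P where "P = f ` {x \<in> X. \<kappa> x = c}"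
    define h where "h = f \<circ> p"
    define V where "V = B \<inter> p -` U"
    have V: "open V" "V \<subseteq> HP \<inter> p -` U"
    proof -
      have "V = B \<inter> (HP \<inter> p -` U)" using B(2) by (auto simp: V_def)
      then show "open V" using B(1) cU(1) by auto
      show "V \<subseteq> HP \<inter> p -` U" using B(2) by (auto simp: V_def)
    qed
    have hh: "h holomorphic_on V" unfolding h_def by (rule holomorphic_on_subset[OF cU(2) V(2)])
    have hi: "inj_on h V" unfolding h_def
      by (rule comp_inj_on) (use B(3) cD(4) in \<open>auto simp: V_def inj_on_def\<close>)
    have hS: "h ` S c = P \<inter> h ` V" and SV: "S c \<subseteq> V" and SP: "S c = V \<inter> h -` P"
    proof -
      have 1: "p z \<in> U" if "z \<in> S c" for z using that \<kappa>A(2)[OF pX] B(2) Uf by (force simp: S_def)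
      then show SV: "S c \<subseteq> V" by (auto simp: V_def S_def)
      have 2: "h z \<in> P" if "z \<in> S c" for z using that pX B(2) by (auto simp: S_def P_def h_def)
      have 3: "z \<in> S c" if z: "z \<in> V" "h z \<in> P" for z
      proof -
        obtain x where x: "x \<in> X" "\<kappa> x = c" "f (p z) = f x" using z(2) by (auto simp: P_def h_def)
        have "x \<in> U" using \<kappa>A(2)[OF x(1)] x(2) Uf by simp
        moreover have "p z \<in> U" using z(1) by (simp add: V_def)
        ultimately have "p z = x" using cD(4) x(3) by (auto dest: inj_onD)
        then show ?thesis using x(2) z(1) by (simp add: S_def V_def)
      qed
      show "h ` S c = P \<inter> h ` V" using SV 2 3 by blast
      show "S c = V \<inter> h -` P" using SV 2 3 by blast
    qed
    have Pb: "P \<in> sets borel" using bor[OF cA] by (simp add: P_def Uf)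
    have Sb: "S c \<in> sets borel"
    proof -
      have "h \<in> borel_measurable (restrict_space borel V)"
        by (rule borel_measurable_continuous_on_restrict[OF holomorphic_on_imp_continuous_on[OF hh]])
      from measurable_sets[OF this Pb] have "h -` P \<inter> V \<in> sets (restrict_space borel V)" by (simp add: space_restrict_space)
      then show ?thesis using V(1) unfolding SP by (subst (asm) sets_restrict_space_iff) (auto simp: Int_commute)
    qed
    have "open (h ` V)" by (rule open_mapping_thm3[OF hh V(1) hi])
    then have hSb: "h ` S c \<in> sets borel" unfolding hS using Pb by auto
    have "(\<integral>\<^sup>+w. ennreal (indicator (h ` S c) w * cmod (\<phi> c w)) \<partial>lborel) =
         (\<integral>\<^sup>+z. ennreal (indicator (S c) z * ((cmod (deriv h z))^2 * cmod (\<phi> c (h z)))) \<partial>lborel)"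
      by (rule holomorphic_nn_change_of_variables[OF V(1) hh hi SV Sb hSb chart_coefficient_measurable[OF rs \<phi> cA]]) simp
    also have "\<dots> = (\<integral>\<^sup>+z. ennreal (indicator (S c) z * cmod (qd_lift \<A> p \<phi> z)) \<partial>lborel)"
    proof (intro nn_integral_cong arg_cong[where f = ennreal])
      fix z
      show "indicator (S c) z * ((cmod (deriv h z))^2 * cmod (\<phi> c (h z))) = indicator (S c) z * cmod (qd_lift \<A> p \<phi> z)"
      proof (cases "z \<in> S c")
        case True
        then have "z \<in> HP" "p z \<in> U" using SV V(2) by auto
        from qd_lift_chart[OF rs hc \<phi> cA' this] show ?thesis
          by (simp add: norm_mult norm_power h_def Uf mult.commute)
      qed simp
    qed
    finally show ?thesis using Sb unfolding hS by (simp add: P_def h_def V_def Uf)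
  qed
  have lm: "(\<lambda>z. indicator (S c) z * cmod (qd_lift \<A> p \<phi> z)) \<in> borel_measurable borel" if "c \<in> \<kappa> ` X" for c
  proof -
    have [measurable]: "S c \<in> sets borel" using piece[OF that] by blast
    have [measurable]: "(\<lambda>z. if z \<in> HP then qd_lift \<A> p \<phi> z else 0) \<in> borel_measurable borel"
      using borel_measurable_continuous_on_if[OF _ holomorphic_on_imp_continuous_on[OF qd_lift_holomorphic[OF rs hc \<phi>]] continuous_on_const]
        open_HP by auto
    have "(\<lambda>z. indicator (S c) z * cmod (if z \<in> HP then qd_lift \<A> p \<phi> z else 0)) \<in> borel_measurable borel"
      by measurable
    moreover have "(\<lambda>z. indicator (S c) z * cmod (if z \<in> HP then qd_lift \<A> p \<phi> z else 0)) = (\<lambda>z. indicator (S c) z * cmod (qd_lift \<A> p \<phi> z))"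
      using B(2) by (auto simp: fun_eq_iff indicator_def S_def)
    ultimately show ?thesis by simp
  qed
  have "ennreal (indicator B z * cmod (qd_lift \<A> p \<phi> z)) = (\<Sum>c\<in>\<kappa> ` X. ennreal (indicator (S c) z * cmod (qd_lift \<A> p \<phi> z)))" for z
  proof (cases "z \<in> B")
    case True
    then have k: "\<kappa> (p z) \<in> \<kappa> ` X" using pX B(2) by blast
    have "(\<Sum>c\<in>\<kappa> ` X. ennreal (indicator (S c) z * cmod (qd_lift \<A> p \<phi> z))) =
       (\<Sum>c\<in>\<kappa> ` X. if c = \<kappa> (p z) then ennreal (cmod (qd_lift \<A> p \<phi> z)) else 0)"
      by (rule sum.cong) (use True in \<open>auto simp: S_def\<close>)
    also have "\<dots> = ennreal (cmod (qd_lift \<A> p \<phi> z))" using fin k by simp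
    finally show ?thesis using True by simp
  next
    case False
    then show ?thesis by (simp add: S_def)
  qed
  then have "(\<integral>\<^sup>+z. ennreal (indicator B z * cmod (qd_lift \<A> p \<phi> z)) \<partial>lborel) =
     (\<integral>\<^sup>+z. (\<Sum>c\<in>\<kappa> ` X. ennreal (indicator (S c) z * cmod (qd_lift \<A> p \<phi> z))) \<partial>lborel)" by simp
  also have "\<dots> = (\<Sum>c\<in>\<kappa> ` X. \<integral>\<^sup>+z. ennreal (indicator (S c) z * cmod (qd_lift \<A> p \<phi> z)) \<partial>lborel)"
    by (rule nn_integral_sum) (use lm in simp)
  also have "\<dots> = (\<Sum>c\<in>\<kappa> ` X. \<integral>\<^sup>+w. ennreal (indicator (snd c ` {x \<in> X. \<kappa> x = c} \<inter> (snd c \<circ> p) ` (B \<inter> p -` fst c)) w * cmod (\<phi> c w)) \<partial>lborel)"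
    by (rule sum.cong) (use piece in auto)
  finally show ?thesis .
qed

text \<open>The image of each disc is a part of the surface, and the images cover it. The integrals in the norm
  are real-valued and default to zero if they diverge, whence the assumption of finite areas.\<close>

lemma qd_norm_ball_integrals:
  fixes X :: "'a::t2_space set"
  assumes rs: "riemann_surface X \<A>" and cX: "compact X" and hc: "holomorphic_universal_cover p X \<A>"
    and \<phi>: "\<phi> \<in> quad_diffs \<A>"
    and C: "finite C" "\<And>a. a \<in> C \<Longrightarrow> cball a (r a) \<subseteq> HP \<and> inj_on p (ball a (r a))" "X = (\<Union>a\<in>C. p ` ball a (r a))"
  defines "I \<equiv> \<lambda>a. \<integral>\<^sup>+z. ennreal (indicator (ball a (r a)) z * cmod (qd_lift \<A> p \<phi> z)) \<partial>lborel"
  assumes Ifin: "\<And>a. a \<in> C \<Longrightarrow> I a < \<infinity>"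
  shows "0 \<le> qd_norm X \<A> \<phi>" "\<And>a. a \<in> C \<Longrightarrow> I a \<le> ennreal (qd_norm X \<A> \<phi>)" "ennreal (qd_norm X \<A> \<phi>) \<le> (\<Sum>a\<in>C. I a)"
proof -
  define \<kappa> where "\<kappa> = (SOME \<kappa>. chart_selection X \<A> \<kappa>)"
  have \<kappa>: "chart_selection X \<A> \<kappa>" unfolding \<kappa>_def using chart_selection_exists[OF rs cX] by (rule someI_ex)
  have fin: "finite (\<kappa> ` X)" and \<kappa>A: "\<And>x. x \<in> X \<Longrightarrow> \<kappa> x \<in> \<A>" "\<And>x. x \<in> X \<Longrightarrow> x \<in> fst (\<kappa> x)"
    and bor: "\<And>c. c \<in> \<A> \<Longrightarrow> snd c ` {x \<in> X. \<kappa> x = c} \<in> sets borel" using \<kappa> by (auto simp: chart_selection_def)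
  define P where "P = (\<lambda>c. snd c ` {x \<in> X. \<kappa> x = c})"
  define J where "J = (\<lambda>c. \<integral>\<^sup>+w. ennreal (indicator (P c) w * cmod (\<phi> c w)) \<partial>lborel)"
  define Q where "Q = (\<lambda>c a. P c \<inter> (snd c \<circ> p) ` (ball a (r a) \<inter> p -` fst c))"
  define K where "K = (\<lambda>c a. \<integral>\<^sup>+w. ennreal (indicator (Q c a) w * cmod (\<phi> c w)) \<partial>lborel)"
  have bH: "ball a (r a) \<subseteq> HP" if "a \<in> C" for a using C(2)[OF that] ball_subset_cball by blast
  have IK: "I a = (\<Sum>c\<in>\<kappa> ` X. K c a)" if "a \<in> C" for a
    unfolding I_def K_def Q_def P_def
    by (rule ball_integral_charts[OF rs hc \<phi> \<kappa> open_ball bH[OF that]]) (use C(2)[OF that] in blast)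
  have cm: "(\<lambda>w. cmod (\<phi> c w)) \<in> borel_measurable borel" if "c \<in> \<kappa> ` X" for c
    using chart_coefficient_measurable[OF rs \<phi>] that \<kappa>A by blast
  have Pb: "P c \<in> sets borel" if "c \<in> \<kappa> ` X" for c unfolding P_def using bor that \<kappa>A by blast
  have Qb: "Q c a \<in> sets borel" if c: "c \<in> \<kappa> ` X" and a: "a \<in> C" for c a
  proof -
    obtain U f where Uf: "c = (U, f)" by (cases c)
    have cA: "(U, f) \<in> \<A>" using c \<kappa>A(1) unfolding Uf by (elim imageE) simp
    note cD = riemann_surface_chartD[OF rs cA] and cU = cover_chart_facts[OF rs hc cA]
    have e: "ball a (r a) \<inter> p -` U = ball a (r a) \<inter> (HP \<inter> p -` U)" using bH[OF a] by blast
    have "open ((f \<circ> p) ` (ball a (r a) \<inter> p -` U))"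
    proof (rule open_mapping_thm3)
      show "(f \<circ> p) holomorphic_on ball a (r a) \<inter> p -` U" unfolding e by (rule holomorphic_on_subset[OF cU(2)]) auto
      show "open (ball a (r a) \<inter> p -` U)" unfolding e using cU(1) by auto
      show "inj_on (f \<circ> p) (ball a (r a) \<inter> p -` U)"
        by (rule comp_inj_on) (use C(2)[OF a] cD(4) in \<open>auto simp: inj_on_def\<close>)
    qed
    then show ?thesis using Pb[OF c] unfolding Q_def Uf by auto
  qed
  have KJ: "K c a \<le> J c" for c a unfolding K_def J_def Q_def
    by (intro nn_integral_mono ennreal_leI mult_right_mono) (auto simp: indicator_def)
  have JK: "J c \<le> (\<Sum>a\<in>C. K c a)" if c: "c \<in> \<kappa> ` X" for c
  proof -
    have "J c \<le> (\<integral>\<^sup>+w. (\<Sum>a\<in>C. ennreal (indicator (Q c a) w * cmod (\<phi> c w))) \<partial>lborel)"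
      unfolding J_def
    proof (rule nn_integral_mono)
      fix w
      show "ennreal (indicator (P c) w * cmod (\<phi> c w)) \<le> (\<Sum>a\<in>C. ennreal (indicator (Q c a) w * cmod (\<phi> c w)))"
      proof (cases "w \<in> P c")
        case True
        then obtain x where x: "x \<in> X" "\<kappa> x = c" "w = snd c x" unfolding P_def by blast
        then obtain a z where a: "a \<in> C" "z \<in> ball a (r a)" "x = p z" using C(3) by blast
        have "x \<in> fst c" using \<kappa>A(2)[OF x(1)] x(2) by simp
        then have "w \<in> (snd c \<circ> p) ` (ball a (r a) \<inter> p -` fst c)"
          using a x by (intro image_eqI[of _ _ z]) auto
        then have "w \<in> Q c a" unfolding Q_def using True by blast
        then have "ennreal (indicator (P c) w * cmod (\<phi> c w)) = ennreal (indicator (Q c a) w * cmod (\<phi> c w))" using True by simp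
        also have "\<dots> \<le> (\<Sum>a\<in>C. ennreal (indicator (Q c a) w * cmod (\<phi> c w)))"
          by (rule member_le_sum[OF a(1)]) (use C(1) in auto)
        finally show ?thesis .
      qed simp
    qed
    also have "\<dots> = (\<Sum>a\<in>C. K c a)" unfolding K_def
    proof (rule nn_integral_sum)
      fix a assume "a \<in> C"
      then have [measurable]: "Q c a \<in> sets borel" using Qb[OF c] by blast
      have [measurable]: "(\<lambda>w. cmod (\<phi> c w)) \<in> borel_measurable borel" by (rule cm[OF c])
      have "(\<lambda>w. indicator (Q c a) w * cmod (\<phi> c w)) \<in> borel_measurable borel" by measurable
      then show "(\<lambda>w. ennreal (indicator (Q c a) w * cmod (\<phi> c w))) \<in> borel_measurable lborel" by simp
    qed
    finally show ?thesis .
  qed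
  have Ks: "K c a < \<infinity>" if "c \<in> \<kappa> ` X" "a \<in> C" for c a
  proof -
    have "K c a \<le> I a" unfolding IK[OF that(2)] by (rule member_le_sum[OF that(1)]) (use fin in auto)
    then show ?thesis using Ifin[OF that(2)] by (rule order_le_less_trans)
  qed
  have Jf: "J c < \<infinity>" if "c \<in> \<kappa> ` X" for c
  proof -
    have "(\<Sum>a\<in>C. K c a) < \<infinity>" using Ks[OF that] C(1) by (simp add: less_top)
    then show ?thesis using JK[OF that] by (rule order_le_less_trans[rotated])
  qed
  have lint: "(LINT w : P c | lborel. cmod (\<phi> c w)) = enn2real (J c)" if c: "c \<in> \<kappa> ` X" for c
  proof -
    have [measurable]: "P c \<in> sets borel" by (rule Pb[OF c])
    have [measurable]: "(\<lambda>w. cmod (\<phi> c w)) \<in> borel_measurable borel" by (rule cm[OF c])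
    have "(LINT w : P c | lborel. cmod (\<phi> c w)) = (\<integral>w. indicator (P c) w * cmod (\<phi> c w) \<partial>lborel)"
      by (simp add: set_lebesgue_integral_def)
    also have "\<dots> = enn2real (J c)" unfolding J_def by (rule integral_eq_nn_integral) auto
    finally show ?thesis .
  qed
  have qn: "qd_norm X \<A> \<phi> = (\<Sum>c\<in>\<kappa> ` X. enn2real (J c))"
    unfolding qd_norm_def Let_def \<kappa>_def[symmetric] by (rule sum.cong) (use lint in \<open>auto simp: P_def\<close>)
  show "0 \<le> qd_norm X \<A> \<phi>" unfolding qn by (intro sum_nonneg) simp
  have eq: "ennreal (qd_norm X \<A> \<phi>) = (\<Sum>c\<in>\<kappa> ` X. J c)"
  proof -
    have "ennreal (qd_norm X \<A> \<phi>) = (\<Sum>c\<in>\<kappa> ` X. ennreal (enn2real (J c)))" unfolding qn by (simp add: sum_ennreal)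
    also have "\<dots> = (\<Sum>c\<in>\<kappa> ` X. J c)" by (rule sum.cong) (use Jf in \<open>auto simp: less_top\<close>)
    finally show ?thesis .
  qed
  show "I a \<le> ennreal (qd_norm X \<A> \<phi>)" if "a \<in> C" for a
    unfolding eq IK[OF that] by (intro sum_mono KJ)
  have "(\<Sum>c\<in>\<kappa> ` X. J c) \<le> (\<Sum>c\<in>\<kappa> ` X. \<Sum>a\<in>C. K c a)" by (intro sum_mono JK)
  also have "\<dots> = (\<Sum>a\<in>C. \<Sum>c\<in>\<kappa> ` X. K c a)" by (rule sum.swap)
  also have "\<dots> = (\<Sum>a\<in>C. I a)" using IK by simp
  finally show "ennreal (qd_norm X \<A> \<phi>) \<le> (\<Sum>a\<in>C. I a)" unfolding eq .
qed

section \<open>Proof of the growth estimate\<close>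

lemma ln_bound_of_component_growth:
  fixes v :: "'i \<Rightarrow> complex^'n" and N :: "complex^'n \<Rightarrow> real"
  assumes N: "is_norm N" and k: "\<And>i. i \<in> I \<Longrightarrow> k i \<ge> 0"
    and v: "\<And>j. \<exists>A B. A > 0 \<and> B > 0 \<and> (\<forall>i\<in>I. cmod (vec_nth (v i) j) \<le> exp (A * k i + B))"
  shows "\<exists>A B. A > 0 \<and> (\<forall>i\<in>I. ln (1 + N (v i)) \<le> A * k i + B)"
proof -
  obtain A B where AB: "\<And>j. A j > 0" "\<And>j. B j > 0" "\<And>i j. i \<in> I \<Longrightarrow> cmod (vec_nth (v i) j) \<le> exp (A j * k i + B j)"
    using v by metis
  have N0: "N w \<ge> 0" for w using N by (simp add: is_norm_def)
  define A' B' where "A' = (\<Sum>j\<in>UNIV. A j)" and "B' = (\<Sum>j\<in>UNIV. B j)"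
  define S where "S = (\<Sum>j\<in>(UNIV::'n set). N (axis j 1))"
  have S: "S \<ge> 0" unfolding S_def by (intro sum_nonneg N0)
  have le: "A j \<le> A'" "B j \<le> B'" for j
    unfolding A'_def B'_def using member_le_sum[of j UNIV A] member_le_sum[of j UNIV B] AB(1,2)
    by (simp_all add: less_imp_le)
  have A': "A' > 0" using le(1) AB(1) less_le_trans by blast
  have B': "B' > 0" using le(2) AB(2) less_le_trans by blast
  have "ln (1 + N (v i)) \<le> A' * k i + (B' + ln (1 + S))" if i: "i \<in> I" for i
  proof -
    have "N (v i) \<le> (\<Sum>j\<in>UNIV. cmod (vec_nth (v i) j) * N (axis j 1))" by (rule is_norm_le_sum[OF N])
    also have "\<dots> \<le> (\<Sum>j\<in>(UNIV::'n set). exp (A' * k i + B') * N (axis j 1))"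
    proof (intro sum_mono mult_right_mono N0)
      fix j
      have "A j * k i \<le> A' * k i" by (intro mult_right_mono le k i)
      then have "exp (A j * k i + B j) \<le> exp (A' * k i + B')" using le(2)[of j] by simp
      then show "cmod (vec_nth (v i) j) \<le> exp (A' * k i + B')" using AB(3)[OF i, of j] by linarith
    qed
    also have "\<dots> = exp (A' * k i + B') * S" by (simp add: S_def sum_distrib_left)
    finally have "N (v i) \<le> exp (A' * k i + B') * S" .
    moreover have "1 \<le> exp (A' * k i + B')" using A' B' k[OF i] by simp
    ultimately have "1 + N (v i) \<le> exp (A' * k i + B') * (1 + S)"
      unfolding distrib_left mult_1_right by linarith
    then have "ln (1 + N (v i)) \<le> ln (exp (A' * k i + B') * (1 + S))"
      using N0[of "v i"] S by (subst ln_le_cancel_iff) auto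
    also have "\<dots> = A' * k i + (B' + ln (1 + S))" using S by (simp add: ln_mult)
    finally show ?thesis .
  qed
  then show ?thesis using A' by blast
qed

text \<open>The discs \<open>ball a (r a)\<close> play two roles: their closures form the compact set that meets all orbits, and
  the norm is compared with integrals over them.\<close>

locale holonomy_setting =
  fixes X :: "'a::t2_space set" and \<A> :: "'a chart set" and p :: "complex \<Rightarrow> 'a"
    and \<sigma> :: "(complex \<Rightarrow> complex) \<Rightarrow> complex^2^2" and C :: "complex set" and r :: "complex \<Rightarrow> real"
  assumes rs: "riemann_surface X \<A>" and cX: "compact X"
    and hc: "holomorphic_universal_cover p X \<A>" and spin: "spin_structure p \<sigma>"
    and C: "finite C" "C \<subseteq> HP" "\<And>a. a \<in> C \<Longrightarrow> r a > 0 \<and> cball a (r a) \<subseteq> HP \<and> inj_on p (ball a (r a))"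
      "X = (\<Union>a\<in>C. p ` ball a (r a))"
begin

abbreviation "\<G> \<equiv> \<sigma> ` carrier (deck_group p)"
abbreviation "lft \<equiv> qd_lift \<A> p"

lemma cov: "covering_space HP p X"
  using hc by (simp add: holomorphic_universal_cover_def)

sublocale cocompact \<G> "\<Union>a\<in>C. cball a (r a)"
proof
  show "hp_aut M" if "M \<in> \<G>" for M using that spin_structure_mob[OF spin] by blast
  show "M ** N \<in> \<G>" if "M \<in> \<G>" "N \<in> \<G>" for M N by (rule spin_group_mult[OF spin that])
  show "\<exists>N\<in>\<G>. M ** N = mat 1 \<and> N ** M = mat 1" if "M \<in> \<G>" for M by (rule spin_group_inverse[OF spin that])
  show "compact (\<Union>a\<in>C. cball a (r a))" using C(1) by (intro compact_UN) auto
  show "(\<Union>a\<in>C. cball a (r a)) \<subseteq> HP" using C(3) by blast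
  show "\<exists>M\<in>\<G>. mob M z \<in> interior (\<Union>a\<in>C. cball a (r a))" if z: "z \<in> HP" for z
  proof -
    obtain \<gamma> where g: "\<gamma> \<in> carrier (deck_group p)" "\<gamma> z \<in> interior (\<Union>a\<in>C. cball a (r a))"
      using fundamental_balls_cover[OF rs cX cov _ C(4) z] C(3) by blast
    then have "mob (\<sigma> \<gamma>) z \<in> interior (\<Union>a\<in>C. cball a (r a))" using spin_structure_mob(2)[OF spin g(1) z] by simp
    then show ?thesis using g(1) by blast
  qed
qed

lemma lft_qds: "\<phi> \<in> quad_diffs \<A> \<Longrightarrow> lft \<phi> \<in> qds"
  unfolding qds_def using qd_lift_holomorphic[OF rs hc] qd_lift_automorphic[OF rs hc _ spin] by blast

definition area :: "('a chart \<Rightarrow> complex \<Rightarrow> complex) \<Rightarrow> complex \<Rightarrow> ennreal" where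
  "area \<phi> a = (\<integral>\<^sup>+z. ennreal (indicator (ball a (r a)) z * cmod (lft \<phi> z)) \<partial>lborel)"

text \<open>In particular the area is finite.\<close>

lemma area_le:
  assumes "\<phi> \<in> quad_diffs \<A>" "a \<in> C"
  shows "area \<phi> a \<le> ennreal (dsup (lft \<phi>) * measure lborel (ball a (r a)))"
proof -
  have fin: "emeasure lborel (ball a (r a)) < \<infinity>" by (rule emeasure_lborel_ball_finite)
  have "area \<phi> a \<le> (\<integral>\<^sup>+z. ennreal (dsup (lft \<phi>)) * indicator (ball a (r a)) z \<partial>lborel)"
    unfolding area_def
  proof (rule nn_integral_mono)
    fix z
    show "ennreal (indicator (ball a (r a)) z * cmod (lft \<phi> z)) \<le> ennreal (dsup (lft \<phi>)) * indicator (ball a (r a)) z"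
    proof (cases "z \<in> ball a (r a)")
      case True
      then have "z \<in> (\<Union>a\<in>C. cball a (r a))" using assms(2) ball_subset_cball by blast
      then show ?thesis using True dsup_upper[OF lft_qds[OF assms(1)]] by (simp add: ennreal_leI)
    qed simp
  qed
  also have "\<dots> = ennreal (dsup (lft \<phi>)) * emeasure lborel (ball a (r a))"
    by (rule nn_integral_cmult_indicator) simp
  also have "\<dots> = ennreal (dsup (lft \<phi>) * measure lborel (ball a (r a)))"
    using fin dsup_nonneg[OF lft_qds[OF assms(1)]] by (simp add: emeasure_eq_ennreal_measure ennreal_mult less_top)
  finally show ?thesis .
qed

lemma qd_norm_area:
  assumes "\<phi> \<in> quad_diffs \<A>"
  shows "0 \<le> qd_norm X \<A> \<phi>" "a \<in> C \<Longrightarrow> area \<phi> a \<le> ennreal (qd_norm X \<A> \<phi>)"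
    "ennreal (qd_norm X \<A> \<phi>) \<le> (\<Sum>a\<in>C. area \<phi> a)"
proof -
  have fin: "area \<phi> a < \<infinity>" if "a \<in> C" for a
    using area_le[OF assms that] by (rule order_le_less_trans) simp
  have c: "cball a (r a) \<subseteq> HP \<and> inj_on p (ball a (r a))" if "a \<in> C" for a using C(3)[OF that] by blast
  note q = qd_norm_ball_integrals[OF rs cX hc assms C(1) c C(4), folded area_def]
  show "0 \<le> qd_norm X \<A> \<phi>" using q(1) fin by blast
  show "a \<in> C \<Longrightarrow> area \<phi> a \<le> ennreal (qd_norm X \<A> \<phi>)" using q(2) fin by blast
  show "ennreal (qd_norm X \<A> \<phi>) \<le> (\<Sum>a\<in>C. area \<phi> a)" using q(3) fin by blast
qed

lemma qd_norm_le_dsup: "\<exists>K>0. \<forall>\<phi>\<in>quad_diffs \<A>. qd_norm X \<A> \<phi> \<le> K * dsup (lft \<phi>)"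
proof -
  define K where "K = (\<Sum>a\<in>C. measure lborel (ball a (r a))) + 1"
  have K: "K > 0" unfolding K_def by (intro add_nonneg_pos sum_nonneg) auto
  have "qd_norm X \<A> \<phi> \<le> K * dsup (lft \<phi>)" if \<phi>: "\<phi> \<in> quad_diffs \<A>" for \<phi>
  proof -
    have d: "dsup (lft \<phi>) \<ge> 0" by (rule dsup_nonneg[OF lft_qds[OF \<phi>]])
    have "ennreal (qd_norm X \<A> \<phi>) \<le> (\<Sum>a\<in>C. ennreal (dsup (lft \<phi>) * measure lborel (ball a (r a))))"
      using qd_norm_area(3)[OF \<phi>] sum_mono[of C "area \<phi>", OF area_le[OF \<phi>]] by (rule order_trans)
    also have "\<dots> = ennreal (\<Sum>a\<in>C. dsup (lft \<phi>) * measure lborel (ball a (r a)))"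
      by (rule sum_ennreal) (use d in auto)
    also have "(\<Sum>a\<in>C. dsup (lft \<phi>) * measure lborel (ball a (r a))) = (K - 1) * dsup (lft \<phi>)"
      by (simp add: K_def sum_distrib_right mult.commute)
    finally have "qd_norm X \<A> \<phi> \<le> (K - 1) * dsup (lft \<phi>)"
      using d by (subst (asm) ennreal_le_iff) (auto simp: K_def intro!: mult_nonneg_nonneg sum_nonneg)
    then show ?thesis using d by (simp add: algebra_simps)
  qed
  then show ?thesis using K by blast
qed

text \<open>A sequence violating the converse inequality would, after normalisation, converge to a
  nonzero holomorphic function without area.\<close>

lemma dsup_le_qd_norm: "\<exists>K>0. \<forall>\<phi>\<in>quad_diffs \<A>. dsup (lft \<phi>) \<le> K * qd_norm X \<A> \<phi>"
proof (rule ccontr)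
  assume neg: "\<not> ?thesis"
  have "\<exists>\<phi>\<in>quad_diffs \<A>. dsup (lft \<phi>) > (real n + 1) * qd_norm X \<A> \<phi>" for n
  proof -
    have "real n + 1 > 0" by simp
    then show ?thesis using neg by (meson not_le)
  qed
  then obtain \<phi> where \<phi>: "\<And>n. \<phi> n \<in> quad_diffs \<A>" "\<And>n. dsup (lft (\<phi> n)) > (real n + 1) * qd_norm X \<A> (\<phi> n)" by metis
  have pos: "dsup (lft (\<phi> n)) > 0" for n
  proof -
    have "0 \<le> (real n + 1) * qd_norm X \<A> (\<phi> n)" using qd_norm_area(1)[OF \<phi>(1)] by simp
    then show ?thesis using \<phi>(2)[of n] by linarith
  qed
  obtain q s where q: "q holomorphic_on HP" "strict_mono (s :: nat \<Rightarrow> nat)" "\<exists>w\<in>HP. q w \<noteq> 0"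
     "\<forall>K. compact K \<longrightarrow> K \<subseteq> HP \<longrightarrow> uniform_limit K (\<lambda>n z. lft (\<phi> (s n)) z / of_real (dsup (lft (\<phi> (s n))))) q sequentially"
    using normal_family[of "\<lambda>n. lft (\<phi> n)", OF lft_qds[OF \<phi>(1)] pos] by (elim exE conjE) (rule that, assumption+)
  obtain a where a: "a \<in> C" using D_nonempty by blast
  note Ca = C(3)[OF a]
  have bH: "ball a (r a) \<subseteq> HP" using Ca ball_subset_cball by blast
  have "\<exists>z\<in>ball a (r a). q z \<noteq> 0"
  proof (rule ccontr)
    assume "\<not> ?thesis"
    then have "q z = 0" if "z \<in> ball a (r a)" for z using that by blast
    then have "q w = 0" if "w \<in> HP" for w
      using analytic_continuation_open[OF open_ball open_HP _ connected_HP bH q(1), of "\<lambda>_. 0"] Ca that by auto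
    then show False using q(3) by blast
  qed
  then obtain z where z: "z \<in> ball a (r a)" "q z \<noteq> 0" by blast
  define \<eta> where "\<eta> = cmod (q z) / 4"
  have \<eta>: "\<eta> > 0" using z by (simp add: \<eta>_def)
  have "continuous (at z) q" using holomorphic_on_imp_continuous_on[OF q(1)] open_HP z bH
    by (metis continuous_on_eq_continuous_at subsetD)
  then obtain d0 where d0: "d0 > 0" "\<And>w. dist w z < d0 \<Longrightarrow> dist (q w) (q z) < \<eta>"
    using \<eta> unfolding continuous_at_eps_delta by blast
  obtain d1 where d1: "d1 > 0" "ball z d1 \<subseteq> ball a (r a)" using z(1) open_contains_ball[of "ball a (r a)"] open_ball by blast
  define b where "b = ball z (min d0 d1)"
  have b: "b \<subseteq> ball a (r a)" using d1(2) by (auto simp: b_def)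
  define m where "m = measure lborel b"
  have em: "emeasure lborel b = ennreal m" unfolding m_def b_def
    by (rule emeasure_eq_ennreal_measure) (metis emeasure_lborel_ball_finite less_top infinity_ennreal_def)
  have "emeasure lborel b \<noteq> 0"
  proof
    assume "emeasure lborel b = 0"
    then have "b \<in> null_sets lborel" by (simp add: null_sets_def b_def)
    then have "negligible b" by (simp add: negligible_iff_null_sets null_sets_completionI)
    moreover have "open b" "z \<in> b" using d0(1) d1(1) by (simp_all add: b_def)
    ultimately show False using open_not_negligible[of b] by blast
  qed
  then have m: "m > 0" using em by (metis ennreal_0 measure_nonneg m_def order_le_less)
  have "\<forall>\<^sub>F n in sequentially. \<forall>w\<in>cball a (r a). dist (lft (\<phi> (s n)) w / of_real (dsup (lft (\<phi> (s n))))) (q w) < \<eta>"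
    by (rule uniform_limitD[OF q(4)[rule_format] \<eta>]) (use Ca in auto)
  moreover have "\<forall>\<^sub>F n in sequentially. n \<ge> nat \<lceil>1 / (\<eta> * m)\<rceil>" by (rule eventually_ge_at_top)
  ultimately have "\<forall>\<^sub>F n in sequentially. (\<forall>w\<in>cball a (r a). dist (lft (\<phi> (s n)) w / of_real (dsup (lft (\<phi> (s n))))) (q w) < \<eta>) \<and> n \<ge> nat \<lceil>1 / (\<eta> * m)\<rceil>"
    by (rule eventually_conj)
  then obtain n where n: "\<And>w. w \<in> cball a (r a) \<Longrightarrow> dist (lft (\<phi> (s n)) w / of_real (dsup (lft (\<phi> (s n))))) (q w) < \<eta>" "n \<ge> nat \<lceil>1 / (\<eta> * m)\<rceil>"
    using eventually_happens'[OF sequentially_bot] by blast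
  let ?\<phi> = "\<phi> (s n)" and ?d = "dsup (lft (\<phi> (s n)))"
  have low: "\<eta> * ?d \<le> cmod (lft ?\<phi> w)" if "w \<in> b" for w
  proof -
    have 1: "cmod (lft ?\<phi> w / of_real ?d - q w) < \<eta>"
      using n(1)[of w] that b ball_subset_cball by (auto simp: dist_norm)
    have 2: "cmod (q w - q z) < \<eta>" using d0(2)[of w] that by (simp add: b_def dist_norm dist_commute norm_minus_commute)
    have "cmod (q z) \<le> cmod (lft ?\<phi> w / of_real ?d) + cmod (lft ?\<phi> w / of_real ?d - q w) + cmod (q w - q z)"
      using norm_triangle_ineq4[of "lft ?\<phi> w / of_real ?d - (lft ?\<phi> w / of_real ?d - q w)" "q w - q z"]
        norm_triangle_ineq4[of "lft ?\<phi> w / of_real ?d" "lft ?\<phi> w / of_real ?d - q w"] by simp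
    then have "\<eta> \<le> cmod (lft ?\<phi> w / of_real ?d)" using 1 2 \<eta> unfolding \<eta>_def by linarith
    then show ?thesis using pos[of "s n"] by (simp add: norm_divide field_simps)
  qed
  have "ennreal (\<eta> * ?d) * emeasure lborel b = (\<integral>\<^sup>+w. ennreal (\<eta> * ?d) * indicator b w \<partial>lborel)"
    by (rule nn_integral_cmult_indicator[symmetric]) (simp add: b_def)
  also have "\<dots> \<le> area ?\<phi> a" unfolding area_def
  proof (rule nn_integral_mono)
    fix w
    show "ennreal (\<eta> * ?d) * indicator b w \<le> ennreal (indicator (ball a (r a)) w * cmod (lft ?\<phi> w))"
      using low[of w] b by (cases "w \<in> b") (auto simp: ennreal_leI)
  qed
  also have "\<dots> \<le> ennreal (qd_norm X \<A> ?\<phi>)" by (rule qd_norm_area(2)[OF \<phi>(1) a])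
  finally have "ennreal (\<eta> * ?d * m) \<le> ennreal (qd_norm X \<A> ?\<phi>)"
    using \<eta> pos[of "s n"] m by (simp add: em ennreal_mult)
  then have 1: "\<eta> * ?d * m \<le> qd_norm X \<A> ?\<phi>" using qd_norm_area(1)[OF \<phi>(1)] by (simp add: ennreal_le_iff)
  have "1 / (\<eta> * m) \<le> real (s n) + 1"
  proof -
    have "1 / (\<eta> * m) \<le> real n" using n(2) by linarith
    also have "\<dots> \<le> real (s n)" using seq_suble[OF q(2), of n] by simp
    finally show ?thesis by simp
  qed
  then have "1 \<le> (real (s n) + 1) * (\<eta> * m)" using \<eta> m by (simp add: field_simps)
  then have "?d * 1 \<le> ?d * ((real (s n) + 1) * (\<eta> * m))" using pos[of "s n"] by (intro mult_left_mono) auto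
  also have "\<dots> = (real (s n) + 1) * (\<eta> * ?d * m)" by (simp add: mult_ac)
  also have "\<dots> \<le> (real (s n) + 1) * qd_norm X \<A> ?\<phi>" using 1 by (intro mult_left_mono) auto
  also have "\<dots> < ?d" by (rule \<phi>(2))
  finally show False by simp
qed

end

theorem theorem5p2:
  fixes X :: "'a::t2_space set"
    and \<A> :: "'a chart set"
    and g :: nat
    and p :: "complex \<Rightarrow> 'a"
    and \<sigma> :: "(complex \<Rightarrow> complex) \<Rightarrow> complex^2^2"
    and hol :: "('a chart \<Rightarrow> complex \<Rightarrow> complex) \<Rightarrow> (complex \<Rightarrow> complex) \<Rightarrow> complex"
    and E :: "((complex \<Rightarrow> complex) \<Rightarrow> complex) \<Rightarrow> complex^'n"
    and N :: "complex^'n \<Rightarrow> real"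
  assumes "riemann_surface X \<A>" and "compact X" and "has_genus X g" and "g \<ge> 2"
    and "holomorphic_universal_cover p X \<A>"
    and "spin_structure p \<sigma>"
    and "holonomy_map X \<A> p \<sigma> hol"
    and "affine_embedding (deck_group p) E"
    and "is_norm N"
  shows "\<exists>A B :: real. A > 0 \<and>
    (\<forall>\<phi>\<in>quad_diffs \<A>.
       inverse A * sqrt (qd_norm X \<A> \<phi>) - B < ln (1 + N (E (hol \<phi>))) \<and>
       ln (1 + N (E (hol \<phi>))) < A * sqrt (qd_norm X \<A> \<phi>) + B)"
proof -
  note rs = assms(1) and cX = assms(2) and hc = assms(5) and spin = assms(6) and emb = assms(8) and N = assms(9)
  have cv: "covering_space HP p X" using hc by (simp add: holomorphic_universal_cover_def)
  obtain C r where Cr: "finite C" "C \<subseteq> HP" "\<forall>a\<in>C. r a > 0 \<and> cball a (r a) \<subseteq> HP \<and> inj_on p (ball a (r a))"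
     "X = (\<Union>a\<in>C. p ` ball a (r a))" using fundamental_balls[OF rs cX cv] by blast
  interpret holonomy_setting X \<A> p \<sigma> C r
  proof (rule holonomy_setting.intro[OF rs cX hc spin Cr(1,2) _ Cr(4)])
    show "r a > 0 \<and> cball a (r a) \<subseteq> HP \<and> inj_on p (ball a (r a))" if "a \<in> C" for a
      by (rule bspec[OF Cr(3) that])
  qed
  let ?G = "deck_group p"
  obtain \<rho> where \<rho>0: "\<forall>\<phi>\<in>quad_diffs \<A>. \<rho> \<phi> \<in> hom ?G SL2C \<and> (\<exists>F. developing_map \<A> p \<phi> F \<and>
        (\<forall>\<gamma>\<in>carrier ?G. \<forall>z\<in>HP. F (\<gamma> z) = moebius (\<rho> \<phi> \<gamma>) (F z)))"
    and \<rho>1: "\<forall>\<phi>\<in>quad_diffs \<A>. hol \<phi> = char_of ?G (\<rho> \<phi>)"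
    using assms(7) unfolding holonomy_map_def by (elim exE conjE) (rule that, assumption+)
  have \<rho>: "\<rho> \<phi> \<in> hom ?G SL2C" "\<exists>F. developing_map \<A> p \<phi> F \<and>
        (\<forall>\<gamma>\<in>carrier ?G. \<forall>z\<in>HP. F (\<gamma> z) = moebius (\<rho> \<phi> \<gamma>) (F z))" "hol \<phi> = char_of ?G (\<rho> \<phi>)"
    if "\<phi> \<in> quad_diffs \<A>" for \<phi>
    using bspec[OF \<rho>0 that] bspec[OF \<rho>1 that] by blast+
  have hol_in: "hol \<phi> \<in> character_variety ?G" if "\<phi> \<in> quad_diffs \<A>" for \<phi>
    using \<rho>(1,3)[OF that] by (simp add: character_variety_def)
  have mt: "\<exists>\<tau>. is_mtrace (lft \<phi>) (\<sigma> \<gamma>) \<tau> \<and> cmod \<tau> = cmod (hol \<phi> \<gamma>)"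
    if \<phi>: "\<phi> \<in> quad_diffs \<A>" and \<gamma>: "\<gamma> \<in> carrier ?G" for \<phi> \<gamma>
  proof -
    obtain F where F: "developing_map \<A> p \<phi> F" "\<And>\<gamma> z. \<gamma> \<in> carrier ?G \<Longrightarrow> z \<in> HP \<Longrightarrow> F (\<gamma> z) = moebius (\<rho> \<phi> \<gamma>) (F z)"
      using \<rho>(2)[OF \<phi>] by blast
    have F': "cp1_holomorphic_on F HP" "locally_injective_on F HP" "\<And>z. z \<in> HP \<Longrightarrow> cp1_schwarzian F z = lft \<phi> z"
      using F(1) by (auto simp: developing_map_def)
    have q: "lft \<phi> holomorphic_on HP" "automorphic (\<sigma> \<gamma>) (lft \<phi>)" using lft_qds[OF \<phi>] \<gamma> by (auto simp: qds_def)
    have d: "det (\<rho> \<phi> \<gamma>) = 1" using \<rho>(1)[OF \<phi>] \<gamma> by (auto simp: hom_def SL2C_def)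
    have eqv: "F (mob (\<sigma> \<gamma>) z) = moebius (\<rho> \<phi> \<gamma>) (F z)" if "z \<in> HP" for z
      using F(2)[OF \<gamma> that] spin_structure_mob(2)[OF spin \<gamma> that] by simp
    have "hol \<phi> \<gamma> = trace (\<rho> \<phi> \<gamma>)" using \<rho>(3)[OF \<phi>] \<gamma> by (simp add: char_of_def)
    then show ?thesis using holonomy_trace[OF q(1) F' spin_structure_mob(1)[OF spin \<gamma>] q(2) d eqv] by simp
  qed
  obtain K1 where K1: "K1 > 0" "\<And>\<phi>. \<phi> \<in> quad_diffs \<A> \<Longrightarrow> qd_norm X \<A> \<phi> \<le> K1 * dsup (lft \<phi>)" using qd_norm_le_dsup by blast
  obtain K2 where K2: "K2 > 0" "\<And>\<phi>. \<phi> \<in> quad_diffs \<A> \<Longrightarrow> dsup (lft \<phi>) \<le> K2 * qd_norm X \<A> \<phi>" using dsup_le_qd_norm by blast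
  define k where "k = (\<lambda>\<phi>. sqrt (qd_norm X \<A> \<phi>))"
  have k0: "k \<phi> \<ge> 0" if "\<phi> \<in> quad_diffs \<A>" for \<phi> using qd_norm_area(1)[OF that] by (simp add: k_def)
  have k1: "k \<phi> \<le> sqrt K1 * sqrt (dsup (lft \<phi>))" if "\<phi> \<in> quad_diffs \<A>" for \<phi>
    using K1(2)[OF that] by (simp add: k_def flip: real_sqrt_mult)
  have k2: "sqrt (dsup (lft \<phi>)) \<le> sqrt K2 * k \<phi>" if "\<phi> \<in> quad_diffs \<A>" for \<phi>
    using K2(2)[OF that] by (simp add: k_def flip: real_sqrt_mult)
  define L where "L = (\<lambda>\<phi>. ln (1 + N (E (hol \<phi>))))"
  have N0: "N v \<ge> 0" for v using N by (simp add: is_norm_def)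
  have L0: "L \<phi> \<ge> 0" for \<phi> using N0 by (simp add: L_def)
  have tr_up: "\<exists>A B. \<forall>\<phi>\<in>quad_diffs \<A>. cmod (hol \<phi> \<gamma>) \<le> exp (A * k \<phi> + B)" if \<gamma>: "\<gamma> \<in> carrier ?G" for \<gamma>
  proof -
    obtain A B where AB: "\<And>\<phi> \<tau>. \<phi> \<in> qds \<Longrightarrow> is_mtrace \<phi> (\<sigma> \<gamma>) \<tau> \<Longrightarrow> cmod \<tau> \<le> exp (A * sqrt (dsup \<phi>) + B)"
      using trace_upper_growth[of "\<sigma> \<gamma>"] \<gamma> by blast
    have "cmod (hol \<phi> \<gamma>) \<le> exp ((\<bar>A\<bar> * sqrt K2) * k \<phi> + B)" if \<phi>: "\<phi> \<in> quad_diffs \<A>" for \<phi>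
    proof -
      obtain \<tau> where \<tau>: "is_mtrace (lft \<phi>) (\<sigma> \<gamma>) \<tau>" "cmod \<tau> = cmod (hol \<phi> \<gamma>)" using mt[OF \<phi> \<gamma>] by blast
      have "A * sqrt (dsup (lft \<phi>)) \<le> \<bar>A\<bar> * sqrt (dsup (lft \<phi>))"
        using dsup_nonneg[OF lft_qds[OF \<phi>]] by (intro mult_right_mono) auto
      also have "\<dots> \<le> \<bar>A\<bar> * (sqrt K2 * k \<phi>)" by (intro mult_left_mono k2 \<phi>) auto
      finally have "exp (A * sqrt (dsup (lft \<phi>)) + B) \<le> exp ((\<bar>A\<bar> * sqrt K2) * k \<phi> + B)" by (simp add: mult.assoc)
      then show ?thesis using AB[OF lft_qds[OF \<phi>] \<tau>(1)] \<tau>(2) by linarith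
    qed
    then show ?thesis by blast
  qed
  have "\<exists>A B. A > 0 \<and> B > 0 \<and> (\<forall>\<phi>\<in>quad_diffs \<A>. cmod (vec_nth (E (hol \<phi>)) j) \<le> exp (A * k \<phi> + B))" for j
  proof -
    obtain f where f: "f \<in> regular_functions ?G" "\<And>x. x \<in> character_variety ?G \<Longrightarrow> vec_nth (E x) j = f x"
      using emb unfolding affine_embedding_def by blast
    have "\<exists>A B. A > 0 \<and> B > 0 \<and> (\<forall>\<phi>\<in>quad_diffs \<A>. cmod (f (hol \<phi>)) \<le> exp (A * k \<phi> + B))"
      by (rule generated_algebra_growth[OF f(1)[unfolded regular_functions_def] k0]) (use tr_up in auto)
    then show ?thesis using f(2) hol_in by simp
  qed
  from ln_bound_of_component_growth[where v = "\<lambda>\<phi>. E (hol \<phi>)" and I = "quad_diffs \<A>" and k = k, OF N k0 this]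
  obtain A2 B2 where up: "A2 > 0" "\<And>\<phi>. \<phi> \<in> quad_diffs \<A> \<Longrightarrow> L \<phi> \<le> A2 * k \<phi> + B2" unfolding L_def by blast
  \<comment> \<open>The failure of all lower bounds gives a sequence \<open>\<phi> m\<close> along which \<open>L\<close> is small compared with \<open>k\<close>, and
    \<open>k\<close> tends to infinity.\<close>
  have "\<exists>m::nat. \<forall>\<phi>\<in>quad_diffs \<A>. k \<phi> / (real m + 1) - (real m + 1) \<le> L \<phi>"
  proof (rule ccontr)
    assume "\<not> ?thesis"
    then have "\<exists>\<phi>\<in>quad_diffs \<A>. k \<phi> / (real m + 1) - (real m + 1) > L \<phi>" for m :: nat by (meson not_le)
    then obtain \<phi> where \<phi>: "\<And>m::nat. \<phi> m \<in> quad_diffs \<A>" "\<And>m. k (\<phi> m) / (real m + 1) - (real m + 1) > L (\<phi> m)" by metis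
    have kb: "(real m + 1)^2 < k (\<phi> m)" for m
    proof -
      have "real m + 1 < k (\<phi> m) / (real m + 1)" using \<phi>(2)[of m] L0[of "\<phi> m"] by linarith
      then show ?thesis by (simp add: field_simps power2_eq_square)
    qed
    have db: "(real m + 1)^2 / sqrt K1 < sqrt (dsup (lft (\<phi> m)))" for m
    proof -
      have "(real m + 1)^2 < sqrt K1 * sqrt (dsup (lft (\<phi> m)))" using kb[of m] k1[OF \<phi>(1), of m] by linarith
      then show ?thesis using K1(1) by (simp add: divide_less_eq mult.commute)
    qed
    have dpos: "dsup (lft (\<phi> m)) > 0" for m
    proof -
      have "0 \<le> (real m + 1)^2 / sqrt K1" using K1(1) by simp
      then have "0 < sqrt (dsup (lft (\<phi> m)))" using db[of m] by linarith
      then show ?thesis by simp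
    qed
    have "filterlim (\<lambda>m. dsup (lft (\<phi> m))) at_top sequentially"
    proof (rule filterlim_at_top_mono)
      have "filterlim (\<lambda>m. (1 / K1) * real m) at_top sequentially"
        by (rule filterlim_tendsto_pos_mult_at_top[OF tendsto_const _ filterlim_real_sequentially]) (use K1(1) in simp)
      then show "filterlim (\<lambda>m. real m / K1) at_top sequentially" by simp
      have "real m / K1 \<le> dsup (lft (\<phi> m))" for m
      proof -
        have "((real m + 1)^2 / sqrt K1)^2 \<le> (sqrt (dsup (lft (\<phi> m))))^2"
          using db[of m] K1(1) by (intro power_mono) auto
        then have "((real m + 1)^2)^2 / K1 \<le> dsup (lft (\<phi> m))" using K1(1) dpos[of m] by (simp add: power_divide)
        moreover have "real m \<le> ((real m + 1)^2)^2"
        proof -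
          have "real m + 1 \<le> (real m + 1)^2" by (simp add: self_le_power)
          moreover have "(real m + 1)^2 \<le> ((real m + 1)^2)^2" by (rule self_le_power) (simp_all add: one_le_power)
          ultimately show ?thesis by linarith
        qed
        then have "real m / K1 \<le> ((real m + 1)^2)^2 / K1" using K1(1) by (intro divide_right_mono) auto
        ultimately show ?thesis by linarith
      qed
      then show "\<forall>\<^sub>F m in sequentially. real m / K1 \<le> dsup (lft (\<phi> m))" by simp
    qed
    from trace_lower_growth[of "\<lambda>m. lft (\<phi> m)", OF lft_qds[OF \<phi>(1)] dpos this]
    obtain M c s where M: "M \<in> \<G>" "c > 0" "strict_mono (s :: nat \<Rightarrow> nat)"
       "\<forall>\<^sub>F n in sequentially. \<forall>\<tau>. is_mtrace (lft (\<phi> (s n))) M \<tau> \<longrightarrow> exp (c * sqrt (dsup (lft (\<phi> (s n))))) - 1 \<le> cmod \<tau>"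
      by blast
    obtain \<gamma> where \<gamma>: "\<gamma> \<in> carrier ?G" "M = \<sigma> \<gamma>" using M(1) by blast
    have reg: "(\<lambda>x. x \<gamma>) \<in> regular_functions ?G" unfolding regular_functions_def using \<gamma>(1) by (intro generated_algebra.gen) blast
    have "\<forall>f\<in>regular_functions ?G. \<exists>h\<in>polynomial_functions. \<forall>x\<in>character_variety ?G. f x = h (E x)"
      using emb unfolding affine_embedding_def by (elim conjE)
    from bspec[OF this reg] obtain h where h: "h \<in> polynomial_functions" "\<And>x. x \<in> character_variety ?G \<Longrightarrow> x \<gamma> = h (E x)"
      by blast
    obtain Cn where Cn: "Cn > 0" "\<And>v j. cmod (vec_nth v j) \<le> Cn * N v" using is_norm_component_le[OF N] by blast
    have "\<exists>A B. A > 0 \<and> B > 0 \<and> (\<forall>\<phi>\<in>quad_diffs \<A>. cmod (h (E (hol \<phi>))) \<le> exp (A * L \<phi> + B))"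
    proof (rule generated_algebra_growth[OF h(1)[unfolded polynomial_functions_def]])
      fix u :: "complex^'n \<Rightarrow> complex" assume "u \<in> {\<lambda>v. vec_nth v i |i. True}"
      then obtain i where i: "u = (\<lambda>v. vec_nth v i)" by blast
      have "cmod (u (E (hol \<phi>))) \<le> exp (1 * L \<phi> + ln Cn)" for \<phi>
      proof -
        have "cmod (u (E (hol \<phi>))) \<le> Cn * N (E (hol \<phi>))" unfolding i by (rule Cn(2))
        also have "\<dots> \<le> Cn * (1 + N (E (hol \<phi>)))" using Cn(1) by simp
        also have "\<dots> = exp (1 * L \<phi> + ln Cn)" using Cn(1) N0[of "E (hol \<phi>)"] by (simp add: L_def exp_add)
        finally show ?thesis .
      qed
      then show "\<exists>A B. \<forall>\<phi>\<in>quad_diffs \<A>. cmod (u (E (hol \<phi>))) \<le> exp (A * L \<phi> + B)" by blast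
    qed (rule L0)
    then obtain a b where ab: "a > 0" "b > 0" "\<And>\<phi>. \<phi> \<in> quad_diffs \<A> \<Longrightarrow> cmod (hol \<phi> \<gamma>) \<le> exp (a * L \<phi> + b)"
      using h(2) hol_in by metis
    define c' where "c' = c / sqrt K1"
    have c': "c' > 0" using M(2) K1(1) by (simp add: c'_def)
    \<comment> \<open>For such \<open>n\<close> the factor \<open>m = s n + 1\<close> is so large that \<open>c' k \<le> a L + b + 1\<close> and \<open>L < k / m\<close> force
      \<open>k \<le> m\<close>, contrary to \<open>m\<^sup>2 < k\<close>.\<close>
    have "\<forall>\<^sub>F n in sequentially. n \<ge> nat \<lceil>2 * a / c'\<rceil> + nat \<lceil>2 * (b + 1) / c'\<rceil>" by (rule eventually_ge_at_top)
    with M(4) have "\<forall>\<^sub>F n in sequentially. (\<forall>\<tau>. is_mtrace (lft (\<phi> (s n))) M \<tau> \<longrightarrow> exp (c * sqrt (dsup (lft (\<phi> (s n))))) - 1 \<le> cmod \<tau>)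
        \<and> n \<ge> nat \<lceil>2 * a / c'\<rceil> + nat \<lceil>2 * (b + 1) / c'\<rceil>" by (rule eventually_conj)
    then obtain n where n: "\<And>\<tau>. is_mtrace (lft (\<phi> (s n))) M \<tau> \<Longrightarrow> exp (c * sqrt (dsup (lft (\<phi> (s n))))) - 1 \<le> cmod \<tau>"
        "n \<ge> nat \<lceil>2 * a / c'\<rceil> + nat \<lceil>2 * (b + 1) / c'\<rceil>"
      using eventually_happens'[OF sequentially_bot] by blast
    define \<psi> where "\<psi> = \<phi> (s n)"
    define m where "m = real (s n) + 1"
    have \<psi>: "\<psi> \<in> quad_diffs \<A>" by (simp add: \<psi>_def \<phi>(1))
    have sn: "n \<le> s n" by (rule seq_suble[OF M(3)])
    have m: "2 * a / c' \<le> m" "2 * (b + 1) / c' \<le> m" "m \<ge> 1" using n(2) sn unfolding m_def by linarith+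
    obtain \<tau> where \<tau>: "is_mtrace (lft \<psi>) M \<tau>" "cmod \<tau> = cmod (hol \<psi> \<gamma>)" using mt[OF \<psi> \<gamma>(1)] \<gamma>(2) by blast
    define y where "y = a * L \<psi> + b"
    have y: "y \<ge> 0" using ab L0 by (simp add: y_def)
    have "exp (c * sqrt (dsup (lft \<psi>))) \<le> 1 + exp y"
      using n(1)[of \<tau>] \<tau> ab(3)[OF \<psi>] unfolding \<psi>_def[symmetric] y_def by linarith
    also have "\<dots> \<le> 2 * exp y" using y by simp
    also have "\<dots> \<le> exp 1 * exp y" using exp_ge_add_one_self[of 1] by (intro mult_right_mono) auto
    also have "\<dots> = exp (y + 1)" by (simp add: exp_add)
    finally have 1: "c * sqrt (dsup (lft \<psi>)) \<le> y + 1" by simp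
    have "c' * k \<psi> \<le> c' * (sqrt K1 * sqrt (dsup (lft \<psi>)))" using c' by (intro mult_left_mono k1 \<psi>) auto
    also have "\<dots> = c * sqrt (dsup (lft \<psi>))" using K1(1) by (simp add: c'_def)
    finally have 2: "c' * k \<psi> \<le> a * L \<psi> + b + 1" using 1 by (simp add: y_def)
    have Lk: "L \<psi> < k \<psi> / m - m" using \<phi>(2)[of "s n"] by (simp add: \<psi>_def m_def)
    then have "L \<psi> \<le> k \<psi> / m" using m(3) by linarith
    then have "a * L \<psi> \<le> a * (k \<psi> / m)" using ab(1) by (intro mult_left_mono) auto
    also have "\<dots> = (a / m) * k \<psi>" by simp
    also have "\<dots> \<le> (c' / 2) * k \<psi>"
    proof (rule mult_right_mono)
      show "a / m \<le> c' / 2" using m(1,3) c' by (simp add: field_simps)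
    qed (rule k0[OF \<psi>])
    finally have "c' * k \<psi> \<le> (c' / 2) * k \<psi> + b + 1" using 2 by linarith
    then have "c' * k \<psi> \<le> 2 * (b + 1)" by (simp add: field_simps)
    then have "k \<psi> \<le> 2 * (b + 1) / c'" using c' by (simp add: field_simps)
    then have "k \<psi> \<le> m" using m(2) by linarith
    moreover have "m^2 < k \<psi>" using kb[of "s n"] by (simp add: \<psi>_def m_def)
    moreover have "m \<le> m^2" using m(3) by (simp add: self_le_power)
    ultimately show False by linarith
  qed
  then obtain mm :: nat where low: "\<And>\<phi>. \<phi> \<in> quad_diffs \<A> \<Longrightarrow> k \<phi> / (real mm + 1) - (real mm + 1) \<le> L \<phi>" by blast
  define A where "A = max (real mm + 1) A2"
  define B where "B = max (real mm + 1) B2 + 1"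
  have A: "A > 0" "real mm + 1 \<le> A" "A2 \<le> A" by (auto simp: A_def)
  have "inverse A * k \<phi> - B < L \<phi> \<and> L \<phi> < A * k \<phi> + B" if \<phi>: "\<phi> \<in> quad_diffs \<A>" for \<phi>
  proof
    have "inverse A * k \<phi> \<le> inverse (real mm + 1) * k \<phi>"
      using A k0[OF \<phi>] by (intro mult_right_mono le_imp_inverse_le) auto
    also have "\<dots> = k \<phi> / (real mm + 1)" by (simp add: divide_inverse mult.commute)
    finally show "inverse A * k \<phi> - B < L \<phi>" using low[OF \<phi>] unfolding B_def by linarith
    have "A2 * k \<phi> \<le> A * k \<phi>" using A k0[OF \<phi>] by (intro mult_right_mono) auto
    then show "L \<phi> < A * k \<phi> + B" using up(2)[OF \<phi>] unfolding B_def by linarith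
  qed
  then show ?thesis using A(1) unfolding k_def L_def by blast
qed

end
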